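(* Let $U=(w,w_t,\psi,\psi_t,\varphi,\varphi_t)^T$ be the solution of the damped system given in the context. Then its energy $E(t)$ satisfies $$E'(t)=-\int_\Omega\big(\psi_t\,\chi_1(\psi_t)+\varphi_t\,\chi_2(\varphi_t)\big)\,dx\,dy\qquad\text{for all }t\ge0,$$ and hence $E(t)\le E(0)$ for all $t\ge0$.
   Context: Setting. $L_1,L_2>0$, $\Omega=(0,L_1)\times(0,L_2)$, $\Gamma=\partial\Omega$; $\rho_1,\rho_2,K,D>0$ and $0<\mu<1/2$ are constants. The nonlinearly damped Reissner–Mindlin–Timoshenko system for $(w,\psi,\varphi)(t,x,y)$, $t>0$, $(x,y)\in\Omega$, is $$\rho_1w_{tt}-K(\psi+w_x)_x-K(\varphi+w_y)_y=0,$$ $$\rho_2\psi_{tt}-D\psi_{xx}-D\tfrac{1-\mu}{2}\psi_{yy}-D\tfrac{1+\mu}{2}\varphi_{xy}+K(\psi+w_x)+\chi_1(\psi_t)=0,$$ $$\rho_2\varphi_{tt}-D\varphi_{yy}-D\tfrac{1-\mu}{2}\varphi_{xx}-D\tfrac{1+\mu}{2}\psi_{xy}+K(\varphi+w_y)+\chi_2(\varphi_t)=0,$$ with $w=\psi=\varphi=0$ on $\Gamma\times\mathbb{R}^+$ and initial data $U(0)=U_0$, where $U=(w,w_t,\psi,\psi_t,\varphi,\varphi_t)^T$. The state space is $\mathcal H=(H_0^1(\Omega)\times L^2(\Omega))^3$ and $\mathcal D(\mathcal A)=((H^2(\Omega)\cap H_0^1(\Omega))\times H_0^1(\Omega))^3$.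 The solution is the unique $U\in C([0,\infty);\mathcal H)$ for $U_0\in\mathcal H$, with $U\in L^\infty([0,\infty);\mathcal D(\mathcal A))\cap W^{1,\infty}([0,\infty);\mathcal H)$ if $U_0\in\mathcal D(\mathcal A)$. Standing assumption $(H_0)$: for $i=1,2$, $\chi_i\in C(\mathbb R)$ is monotone increasing, and there are $c_1,c_2>0$ and a strictly increasing odd function $g\in C^1(\mathbb R)$ with $c_1g(|s|)\le|\chi_i(s)|\le c_2g^{-1}(|s|)$ for $|s|\le1$ and $c_1|s|\le|\chi_i(s)|\le c_2|s|$ for $|s|\ge1$ ($g^{-1}$ is the inverse function of $g$). Energy: $$E(t)=\frac12\int_\Omega\Big[\rho_1|w_t|^2+\rho_2|\psi_t|^2+\rho_2|\varphi_t|^2+K|\psi+w_x|^2+K|\varphi+w_y|^2+D|\psi_x|^2+D|\varphi_y|^2+D\tfrac{1-\mu}{2}|\psi_y+\varphi_x|^2+2D\mu\,\psi_x\varphi_y\Big]dx\,dy.$$ *)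

theory Defs
  imports "HOL-Analysis.Analysis"
begin

section \<open>Sobolev spaces on a planar open set\<close>

text \<open>
  Elements of Lebesgue and Sobolev spaces are represented by functions on the plane, of which
  only the restriction to the domain, up to null sets, is relevant.
\<close>

type_synonym field = "real \<times> real \<Rightarrow> real"

definition px :: "field \<Rightarrow> field" where
  "px f = (\<lambda>(x, y). deriv (\<lambda>s. f (s, y)) x)"

definition py :: "field \<Rightarrow> field" where
  "py f = (\<lambda>(x, y). deriv (\<lambda>s. f (x, s)) y)"

fun Ck :: "nat \<Rightarrow> field \<Rightarrow> bool" where
  "Ck 0 f \<longleftrightarrow> continuous_on UNIV f"
| "Ck (Suc k) f \<longleftrightarrow> (\<forall>z. f differentiable (at z)) \<and> Ck k (px f) \<and> Ck k (py f)"

definition test_functions :: "(real \<times> real) set \<Rightarrow> field set" where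
  "test_functions \<Omega> =
     {v. (\<forall>k. Ck k v) \<and> compact (closure {z. v z \<noteq> 0}) \<and> closure {z. v z \<noteq> 0} \<subseteq> \<Omega>}"

definition L2_space :: "(real \<times> real) set \<Rightarrow> field set" where
  "L2_space \<Omega> =
     {u. u \<in> borel_measurable (lebesgue_on \<Omega>) \<and> integrable (lebesgue_on \<Omega>) (\<lambda>z. (u z)\<^sup>2)}"

definition L2_norm :: "(real \<times> real) set \<Rightarrow> field \<Rightarrow> real" where
  "L2_norm \<Omega> u = sqrt (LINT z|lebesgue_on \<Omega>. (u z)\<^sup>2)"

definition weak_px :: "(real \<times> real) set \<Rightarrow> field \<Rightarrow> field \<Rightarrow> bool" where
  "weak_px \<Omega> u g \<longleftrightarrow>
     (\<forall>v\<in>test_functions \<Omega>.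
        (LINT z|lebesgue_on \<Omega>. u z * px v z) = - (LINT z|lebesgue_on \<Omega>. g z * v z))"

definition weak_py :: "(real \<times> real) set \<Rightarrow> field \<Rightarrow> field \<Rightarrow> bool" where
  "weak_py \<Omega> u g \<longleftrightarrow>
     (\<forall>v\<in>test_functions \<Omega>.
        (LINT z|lebesgue_on \<Omega>. u z * py v z) = - (LINT z|lebesgue_on \<Omega>. g z * v z))"

definition H1_space :: "(real \<times> real) set \<Rightarrow> field set" where
  "H1_space \<Omega> =
     {u \<in> L2_space \<Omega>. (\<exists>g\<in>L2_space \<Omega>. weak_px \<Omega> u g) \<and> (\<exists>g\<in>L2_space \<Omega>. weak_py \<Omega> u g)}"

text \<open>
  Weak derivatives of \<^term>\<open>u \<in> H1_space \<Omega>\<close> are unique almost everywhere; the following select a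
  representative.
\<close>

definition Dx :: "(real \<times> real) set \<Rightarrow> field \<Rightarrow> field" where
  "Dx \<Omega> u = (SOME g. g \<in> L2_space \<Omega> \<and> weak_px \<Omega> u g)"

definition Dy :: "(real \<times> real) set \<Rightarrow> field \<Rightarrow> field" where
  "Dy \<Omega> u = (SOME g. g \<in> L2_space \<Omega> \<and> weak_py \<Omega> u g)"

definition H1_norm :: "(real \<times> real) set \<Rightarrow> field \<Rightarrow> real" where
  "H1_norm \<Omega> u = sqrt ((L2_norm \<Omega> u)\<^sup>2 + (L2_norm \<Omega> (Dx \<Omega> u))\<^sup>2 + (L2_norm \<Omega> (Dy \<Omega> u))\<^sup>2)"

definition H10_space :: "(real \<times> real) set \<Rightarrow> field set" where
  "H10_space \<Omega> =
     {u \<in> H1_space \<Omega>. \<exists>v. (\<forall>n. v n \<in> test_functions \<Omega>) \<and>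
        (\<lambda>n::nat. H1_norm \<Omega> (\<lambda>z. u z - v n z)) \<longlonglongrightarrow> 0}"

definition continuous_curve :: "field set \<Rightarrow> (field \<Rightarrow> real) \<Rightarrow> (real \<Rightarrow> field) \<Rightarrow> bool" where
  "continuous_curve X nrm u \<longleftrightarrow>
     (\<forall>t\<ge>0. u t \<in> X \<and> ((\<lambda>s. nrm (\<lambda>z. u s z - u t z)) \<longlongrightarrow> 0) (at t within {0..}))"


section \<open>The damped Reissner--Mindlin--Timoshenko system\<close>

definition rectangle :: "real \<Rightarrow> real \<Rightarrow> (real \<times> real) set" where
  "rectangle a b = {0<..<a} \<times> {0<..<b}"

text \<open>
  The bound by the inverse function of \<open>g\<close> presupposes that the inverse is defined on
  \<open>[0, 1]\<close>; this is what \<open>\<bar>s\<bar> \<in> range g\<close> says. The function \<open>g\<close> is injective, so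
  \<^term>\<open>inv g\<close> is its inverse on its range.
\<close>

definition damping_assumption :: "(real \<Rightarrow> real) \<Rightarrow> (real \<Rightarrow> real) \<Rightarrow> bool" where
  "damping_assumption chi\<^sub>1 chi\<^sub>2 \<longleftrightarrow>
     (\<forall>chi\<in>{chi\<^sub>1, chi\<^sub>2}. continuous_on UNIV chi \<and> mono chi) \<and>
     (\<exists>c\<^sub>1>0. \<exists>c\<^sub>2>0. \<exists>g :: real \<Rightarrow> real.
        strict_mono g \<and> (\<forall>s. g (- s) = - g s) \<and>
        (\<forall>s. g differentiable (at s)) \<and> continuous_on UNIV (deriv g) \<and>
        (\<forall>chi\<in>{chi\<^sub>1, chi\<^sub>2}.
           (\<forall>s. \<bar>s\<bar> \<le> 1 \<longrightarrow>
              \<bar>s\<bar> \<in> range g \<and> c\<^sub>1 * g \<bar>s\<bar> \<le> \<bar>chi s\<bar> \<and> \<bar>chi s\<bar> \<le> c\<^sub>2 * inv g \<bar>s\<bar>) \<and>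
           (\<forall>s. \<bar>s\<bar> \<ge> 1 \<longrightarrow> c\<^sub>1 * \<bar>s\<bar> \<le> \<bar>chi s\<bar> \<and> \<bar>chi s\<bar> \<le> c\<^sub>2 * \<bar>s\<bar>)))"

text \<open>
  Solutions are continuous curves \<open>U = (w, wt, \<psi>, \<psi>t, \<phi>, \<phi>t)\<close> from \<open>[0, \<infinity>)\<close> to
  \<open>(H\<^sub>0\<^sup>1 \<times> L\<^sup>2)\<^sup>3\<close> that solve the first-order form of the system in the
  sense of distributions: every equation is tested with \<open>v \<in> C\<^sub>c\<^sup>\<infinity>(\<Omega>)\<close> and the outer
  space derivative of each second-order term is moved to \<open>v\<close>. Since
  all terms are continuous in \<open>t\<close>, the time derivatives of the tested quantities exist
  classically, one-sided at \<open>t = 0\<close>. The first three equations say that \<open>wt\<close>, \<open>\<psi>t\<close>, \<open>\<phi>t\<close> are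
  the time derivatives of \<open>w\<close>, \<open>\<psi>\<close>, \<open>\<phi>\<close>; the boundary condition is membership in \<open>H\<^sub>0\<^sup>1\<close>.
  No additional regularity is required when the initial data lie in the domain of the generator,
  so the strong solutions arising from such data are included.
\<close>

definition RMT_solution ::
  "(real \<times> real) set \<Rightarrow> real \<Rightarrow> real \<Rightarrow> real \<Rightarrow> real \<Rightarrow> real \<Rightarrow> (real \<Rightarrow> real) \<Rightarrow> (real \<Rightarrow> real) \<Rightarrow>
   field \<times> field \<times> field \<times> field \<times> field \<times> field \<Rightarrow>
   (real \<Rightarrow> field) \<Rightarrow> (real \<Rightarrow> field) \<Rightarrow> (real \<Rightarrow> field) \<Rightarrow> (real \<Rightarrow> field) \<Rightarrow>
   (real \<Rightarrow> field) \<Rightarrow> (real \<Rightarrow> field) \<Rightarrow> bool" where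
  "RMT_solution \<Omega> \<rho>\<^sub>1 \<rho>\<^sub>2 K D \<mu> chi\<^sub>1 chi\<^sub>2 U\<^sub>0 w wt \<psi> \<psi>t \<phi> \<phi>t \<longleftrightarrow>
     (\<forall>u\<in>{w, \<psi>, \<phi>}. continuous_curve (H10_space \<Omega>) (H1_norm \<Omega>) u) \<and>
     (\<forall>u\<in>{wt, \<psi>t, \<phi>t}. continuous_curve (L2_space \<Omega>) (L2_norm \<Omega>) u) \<and>
     (AE z in lebesgue_on \<Omega>. case U\<^sub>0 of (w\<^sub>0, w\<^sub>1, \<psi>\<^sub>0, \<psi>\<^sub>1, \<phi>\<^sub>0, \<phi>\<^sub>1) \<Rightarrow>
        w 0 z = w\<^sub>0 z \<and> wt 0 z = w\<^sub>1 z \<and> \<psi> 0 z = \<psi>\<^sub>0 z \<and> \<psi>t 0 z = \<psi>\<^sub>1 z \<and>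
        \<phi> 0 z = \<phi>\<^sub>0 z \<and> \<phi>t 0 z = \<phi>\<^sub>1 z) \<and>
     (\<forall>v\<in>test_functions \<Omega>. \<forall>t\<ge>0.
        ((\<lambda>s. LINT z|lebesgue_on \<Omega>. w s z * v z) has_real_derivative
           (LINT z|lebesgue_on \<Omega>. wt t z * v z)) (at t within {0..}) \<and>
        ((\<lambda>s. LINT z|lebesgue_on \<Omega>. \<psi> s z * v z) has_real_derivative
           (LINT z|lebesgue_on \<Omega>. \<psi>t t z * v z)) (at t within {0..}) \<and>
        ((\<lambda>s. LINT z|lebesgue_on \<Omega>. \<phi> s z * v z) has_real_derivative
           (LINT z|lebesgue_on \<Omega>. \<phi>t t z * v z)) (at t within {0..}) \<and>
        ((\<lambda>s. LINT z|lebesgue_on \<Omega>. \<rho>\<^sub>1 * wt s z * v z) has_real_derivative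
           (LINT z|lebesgue_on \<Omega>.
              - K * (\<psi> t z + Dx \<Omega> (w t) z) * px v z
              - K * (\<phi> t z + Dy \<Omega> (w t) z) * py v z)) (at t within {0..}) \<and>
        ((\<lambda>s. LINT z|lebesgue_on \<Omega>. \<rho>\<^sub>2 * \<psi>t s z * v z) has_real_derivative
           (LINT z|lebesgue_on \<Omega>.
              - D * Dx \<Omega> (\<psi> t) z * px v z
              - D * ((1 - \<mu>) / 2) * Dy \<Omega> (\<psi> t) z * py v z
              - D * ((1 + \<mu>) / 2) * Dx \<Omega> (\<phi> t) z * py v z
              - K * (\<psi> t z + Dx \<Omega> (w t) z) * v z
              - chi\<^sub>1 (\<psi>t t z) * v z)) (at t within {0..}) \<and>
        ((\<lambda>s. LINT z|lebesgue_on \<Omega>. \<rho>\<^sub>2 * \<phi>t s z * v z) has_real_derivative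
           (LINT z|lebesgue_on \<Omega>.
              - D * Dy \<Omega> (\<phi> t) z * py v z
              - D * ((1 - \<mu>) / 2) * Dx \<Omega> (\<phi> t) z * px v z
              - D * ((1 + \<mu>) / 2) * Dx \<Omega> (\<psi> t) z * py v z
              - K * (\<phi> t z + Dy \<Omega> (w t) z) * v z
              - chi\<^sub>2 (\<phi>t t z) * v z)) (at t within {0..}))"

definition RMT_energy ::
  "(real \<times> real) set \<Rightarrow> real \<Rightarrow> real \<Rightarrow> real \<Rightarrow> real \<Rightarrow> real \<Rightarrow>
   (real \<Rightarrow> field) \<Rightarrow> (real \<Rightarrow> field) \<Rightarrow> (real \<Rightarrow> field) \<Rightarrow> (real \<Rightarrow> field) \<Rightarrow>
   (real \<Rightarrow> field) \<Rightarrow> (real \<Rightarrow> field) \<Rightarrow> real \<Rightarrow> real" where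
  "RMT_energy \<Omega> \<rho>\<^sub>1 \<rho>\<^sub>2 K D \<mu> w wt \<psi> \<psi>t \<phi> \<phi>t t =
     1 / 2 * (LINT z|lebesgue_on \<Omega>.
        \<rho>\<^sub>1 * \<bar>wt t z\<bar>\<^sup>2 + \<rho>\<^sub>2 * \<bar>\<psi>t t z\<bar>\<^sup>2 + \<rho>\<^sub>2 * \<bar>\<phi>t t z\<bar>\<^sup>2
        + K * \<bar>\<psi> t z + Dx \<Omega> (w t) z\<bar>\<^sup>2 + K * \<bar>\<phi> t z + Dy \<Omega> (w t) z\<bar>\<^sup>2
        + D * \<bar>Dx \<Omega> (\<psi> t) z\<bar>\<^sup>2 + D * \<bar>Dy \<Omega> (\<phi> t) z\<bar>\<^sup>2
        + D * ((1 - \<mu>) / 2) * \<bar>Dy \<Omega> (\<psi> t) z + Dx \<Omega> (\<phi> t) z\<bar>\<^sup>2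
        + 2 * D * \<mu> * Dx \<Omega> (\<psi> t) z * Dy \<Omega> (\<phi> t) z)"

end

theory Submission
  imports Defs
begin

text \<open>
  A weak solution cannot be tested with its own velocity, which is only in \<open>L\<^sup>2\<close>. Instead two copies
  of the time variable are used: with \<open>u = (w, \<psi>, \<phi>)\<close>, its velocity \<open>v\<close>, the damping force \<open>f\<close> and
  the elastic bilinear form \<open>a\<close>, put \<open>G t s = (v t, u s)\<close> (weighted by the densities),
  \<open>P t s = (v t, v s)\<close>, \<open>Q t s = a (u t) (u s)\<close>, \<open>R t s = (f t, u s)\<close> and \<open>S t s = (f t, v s)\<close>.
  Testing at time \<open>t\<close> with the fixed function \<open>u s\<close> is legitimate and gives
  \<open>\<partial>\<^sub>t G = R - Q\<close>, \<open>\<partial>\<^sub>s G = P\<close> and \<open>\<partial>\<^sub>s R = S\<close>. Since \<open>P\<close> and \<open>Q\<close> are symmetric, these relations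
  alone imply that \<open>t \<mapsto> P t t + Q t t\<close>, which is twice the energy, has derivative \<open>2 * S t t\<close>.
  The form \<open>a\<close> of the weak equations agrees with the one of the energy because
  \<open>(\<partial>\<^sub>x u, \<partial>\<^sub>y v) = (\<partial>\<^sub>y u, \<partial>\<^sub>x v)\<close> for \<open>u, v \<in> H\<^sub>0\<^sup>1\<close>.
\<close>

section \<open>The \<open>L\<^sup>2\<close> inner product\<close>

text \<open>Differentiating \<open>Q t t\<close> directly would call for the elastic form of
  \<open>u t\<close> with the velocity \<open>v s\<close>, which has no meaning, since the velocity
  has no space derivatives. Pretending smoothness, d_t P = d_s (d_t G) = S - d_s Q. Exchanging the
  arguments by symmetry, d_s P + d_t Q equals S with swapped arguments. On the diagonal the four
  partial derivatives add up to 2 S, which explains the factor 2; difference quotients in s make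
  this computation rigorous. Two analytic inputs remain. The equations, given for smooth test
  functions, must persist for functions in \<open>L2_space\<close> or \<open>H10_space\<close>; this
  rests on density and on moduli of continuity in time that are uniform along the approximating
  sequence. And S must be jointly continuous, which requires continuity of u -> chi o u on L2 and
  comes from linear growth of chi. Density in L2 also makes weak derivatives unique up to null sets,
  and so relates the representatives that \<open>SOME\<close> selects for u, for v and for u -
  v.\<close>

definition L2_inner :: "(real \<times> real) set \<Rightarrow> field \<Rightarrow> field \<Rightarrow> real" where
  "L2_inner \<Omega> f g = (LINT z|lebesgue_on \<Omega>. f z * g z)"

lemma L2_spaceD:
  assumes "f \<in> L2_space \<Omega>"
  shows "f \<in> borel_measurable (lebesgue_on \<Omega>)" "integrable (lebesgue_on \<Omega>) (\<lambda>z. (f z)\<^sup>2)"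
  using assms by (auto simp: L2_space_def)

lemma L2_mult_integrable:
  assumes "f \<in> L2_space \<Omega>" "g \<in> L2_space \<Omega>"
  shows "integrable (lebesgue_on \<Omega>) (\<lambda>z. f z * g z)"
proof (rule Bochner_Integration.integrable_bound)
  show "integrable (lebesgue_on \<Omega>) (\<lambda>z. (f z)\<^sup>2 + (g z)\<^sup>2)"
    using assms by (simp add: L2_space_def)
  show "(\<lambda>z. f z * g z) \<in> borel_measurable (lebesgue_on \<Omega>)"
    using assms by (auto simp: L2_space_def)
  have "\<bar>a * b\<bar> \<le> a\<^sup>2 + b\<^sup>2" for a b :: real
  proof -
    have "0 \<le> \<bar>a\<bar> * \<bar>b\<bar>" by simp
    then show ?thesis
      using sum_squares_bound[of "\<bar>a\<bar>" "\<bar>b\<bar>"] unfolding abs_mult power2_abs by linarith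
  qed
  then show "AE z in lebesgue_on \<Omega>. norm (f z * g z) \<le> norm ((f z)\<^sup>2 + (g z)\<^sup>2)"
    by (simp add: sum_power2_ge_zero)
qed

lemma L2_add:
  assumes "f \<in> L2_space \<Omega>" "g \<in> L2_space \<Omega>"
  shows "(\<lambda>z. f z + g z) \<in> L2_space \<Omega>"
proof -
  have "integrable (lebesgue_on \<Omega>) (\<lambda>z. (f z)\<^sup>2 + 2 * (f z * g z) + (g z)\<^sup>2)"
    using L2_mult_integrable[OF assms] assms by (simp add: L2_space_def)
  then show ?thesis
    using assms by (auto simp: L2_space_def power2_sum algebra_simps)
qed

lemma L2_cmult: "f \<in> L2_space \<Omega> \<Longrightarrow> (\<lambda>z. c * f z) \<in> L2_space \<Omega>"
  by (auto simp: L2_space_def power_mult_distrib)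

lemma L2_diff:
  assumes "f \<in> L2_space \<Omega>" "g \<in> L2_space \<Omega>"
  shows "(\<lambda>z. f z - g z) \<in> L2_space \<Omega>"
  using L2_add[OF assms(1) L2_cmult[OF assms(2), of "-1"]] by simp

lemma L2_dominated:
  assumes "f \<in> borel_measurable (lebesgue_on \<Omega>)" "g \<in> L2_space \<Omega>" "\<And>z. \<bar>f z\<bar> \<le> \<bar>g z\<bar>"
  shows "f \<in> L2_space \<Omega>"
proof -
  have "integrable (lebesgue_on \<Omega>) (\<lambda>z. (f z)\<^sup>2)"
    by (rule Bochner_Integration.integrable_bound[OF L2_spaceD(2)[OF assms(2)]])
      (use assms in \<open>auto simp: abs_le_square_iff[symmetric]\<close>)
  then show ?thesis using assms by (simp add: L2_space_def)
qed

lemma L2_inner_commute: "L2_inner \<Omega> f g = L2_inner \<Omega> g f"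
  by (simp add: L2_inner_def mult.commute)

lemma L2_inner_add_left:
  assumes "f \<in> L2_space \<Omega>" "g \<in> L2_space \<Omega>" "h \<in> L2_space \<Omega>"
  shows "L2_inner \<Omega> (\<lambda>z. f z + g z) h = L2_inner \<Omega> f h + L2_inner \<Omega> g h"
  using L2_mult_integrable[OF assms(1,3)] L2_mult_integrable[OF assms(2,3)]
  by (simp add: L2_inner_def distrib_right)

lemma L2_inner_diff_left:
  assumes "f \<in> L2_space \<Omega>" "g \<in> L2_space \<Omega>" "h \<in> L2_space \<Omega>"
  shows "L2_inner \<Omega> (\<lambda>z. f z - g z) h = L2_inner \<Omega> f h - L2_inner \<Omega> g h"
  using L2_mult_integrable[OF assms(1,3)] L2_mult_integrable[OF assms(2,3)]
  by (simp add: L2_inner_def left_diff_distrib)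

lemma L2_inner_add_right:
  assumes "f \<in> L2_space \<Omega>" "g \<in> L2_space \<Omega>" "h \<in> L2_space \<Omega>"
  shows "L2_inner \<Omega> h (\<lambda>z. f z + g z) = L2_inner \<Omega> h f + L2_inner \<Omega> h g"
  using L2_inner_add_left[OF assms] by (simp add: L2_inner_commute)

lemma L2_inner_diff_right:
  assumes "f \<in> L2_space \<Omega>" "g \<in> L2_space \<Omega>" "h \<in> L2_space \<Omega>"
  shows "L2_inner \<Omega> h (\<lambda>z. f z - g z) = L2_inner \<Omega> h f - L2_inner \<Omega> h g"
  using L2_inner_diff_left[OF assms] by (simp add: L2_inner_commute)

lemma L2_inner_cmult_left: "L2_inner \<Omega> (\<lambda>z. c * f z) g = c * L2_inner \<Omega> f g"
  by (simp add: L2_inner_def mult.assoc)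

lemma L2_inner_cmult_right: "L2_inner \<Omega> f (\<lambda>z. c * g z) = c * L2_inner \<Omega> f g"
  by (simp add: L2_inner_def mult.left_commute)

lemma L2_norm_nonneg [simp]: "0 \<le> L2_norm \<Omega> f"
  by (simp add: L2_norm_def)

lemma L2_norm_square: "(L2_norm \<Omega> f)\<^sup>2 = L2_inner \<Omega> f f"
  by (simp add: L2_norm_def L2_inner_def power2_eq_square[symmetric])

lemma L2_norm_cmult: "L2_norm \<Omega> (\<lambda>z. c * f z) = \<bar>c\<bar> * L2_norm \<Omega> f"
  by (simp add: L2_norm_def power_mult_distrib real_sqrt_mult)

lemma L2_norm_minus_commute: "L2_norm \<Omega> (\<lambda>z. f z - g z) = L2_norm \<Omega> (\<lambda>z. g z - f z)"
  by (simp add: L2_norm_def power2_commute)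

lemma L2_norm_cong_AE:
  assumes "f \<in> borel_measurable (lebesgue_on \<Omega>)" "g \<in> borel_measurable (lebesgue_on \<Omega>)"
    "AE z in lebesgue_on \<Omega>. f z = g z"
  shows "L2_norm \<Omega> f = L2_norm \<Omega> g"
proof -
  have "(LINT z|lebesgue_on \<Omega>. (f z)\<^sup>2) = (LINT z|lebesgue_on \<Omega>. (g z)\<^sup>2)"
    using assms(3) by (intro integral_cong_AE borel_measurable_power assms(1,2)) auto
  then show ?thesis by (simp add: L2_norm_def)
qed

lemma L2_norm_mono:
  assumes "f \<in> L2_space \<Omega>" "g \<in> L2_space \<Omega>" "\<And>z. \<bar>f z\<bar> \<le> \<bar>g z\<bar>"
  shows "L2_norm \<Omega> f \<le> L2_norm \<Omega> g"
proof -
  have "(LINT z|lebesgue_on \<Omega>. (f z)\<^sup>2) \<le> (LINT z|lebesgue_on \<Omega>. (g z)\<^sup>2)"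
    using assms by (intro integral_mono L2_spaceD(2)) (auto simp: abs_le_square_iff[symmetric])
  then show ?thesis by (simp add: L2_norm_def)
qed

text \<open>This is the discriminant argument behind Cauchy-Schwarz, to be applied to t -> |f + t
  g|^2. The leading coefficient may vanish, because \<open>L2_norm\<close> is only a seminorm on
  functions.\<close>

lemma nonneg_quadratic_imp_discriminant:
  fixes a b c :: real
  assumes "\<And>t. 0 \<le> a + 2 * t * b + t\<^sup>2 * c" "0 \<le> c"
  shows "b\<^sup>2 \<le> a * c"
proof (cases "c = 0")
  case True
  have "b = 0"
  proof (rule ccontr)
    assume "b \<noteq> 0"
    \<comment> \<open>The witness makes the affine expression equal to -1.\<close>
    then show False
      using assms(1)[of "- (a + 1) / (2 * b)"] True by (simp add: field_simps)
  qed
  then show ?thesis using True by simp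
next
  case False
  \<comment> \<open>The quadratic is evaluated at its minimiser t = - b / c.\<close>
  then have "0 \<le> (a + 2 * (- b / c) * b + (- b / c)\<^sup>2 * c) * c"
    by (intro mult_nonneg_nonneg assms)
  also have "\<dots> = a * c - b\<^sup>2"
    using False by (simp add: field_simps power2_eq_square)
  finally show ?thesis by simp
qed

lemma L2_norm_add_square:
  assumes "f \<in> L2_space \<Omega>" "g \<in> L2_space \<Omega>"
  shows "(L2_norm \<Omega> (\<lambda>z. f z + g z))\<^sup>2 =
    (L2_norm \<Omega> f)\<^sup>2 + 2 * L2_inner \<Omega> f g + (L2_norm \<Omega> g)\<^sup>2"
  using assms
  by (simp add: L2_norm_square L2_inner_add_left L2_inner_add_right L2_add L2_inner_commute[of \<Omega> g f])

lemma L2_Cauchy_Schwarz: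
  assumes "f \<in> L2_space \<Omega>" "g \<in> L2_space \<Omega>"
  shows "\<bar>L2_inner \<Omega> f g\<bar> \<le> L2_norm \<Omega> f * L2_norm \<Omega> g"
proof -
  have "0 \<le> (L2_norm \<Omega> f)\<^sup>2 + 2 * t * L2_inner \<Omega> f g + t\<^sup>2 * (L2_norm \<Omega> g)\<^sup>2" for t
    using L2_norm_add_square[OF assms(1) L2_cmult[OF assms(2), of t]]
    by (simp add: L2_inner_cmult_right L2_norm_cmult power_mult_distrib mult.assoc)
      (smt (verit) zero_le_power2)
  then have "(L2_inner \<Omega> f g)\<^sup>2 \<le> (L2_norm \<Omega> f * L2_norm \<Omega> g)\<^sup>2"
    using nonneg_quadratic_imp_discriminant by (simp add: power_mult_distrib)
  then show ?thesis
    by (simp add: abs_le_square_iff[symmetric] abs_mult)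
qed

lemma L2_norm_triangle:
  assumes "f \<in> L2_space \<Omega>" "g \<in> L2_space \<Omega>"
  shows "L2_norm \<Omega> (\<lambda>z. f z + g z) \<le> L2_norm \<Omega> f + L2_norm \<Omega> g"
proof -
  have "(L2_norm \<Omega> (\<lambda>z. f z + g z))\<^sup>2 \<le> (L2_norm \<Omega> f + L2_norm \<Omega> g)\<^sup>2"
    using L2_norm_add_square[OF assms] L2_Cauchy_Schwarz[OF assms]
    by (simp add: power2_sum)
  then show ?thesis by (rule power2_le_imp_le) simp
qed

lemma L2_norm_triangle_diff:
  assumes "f \<in> L2_space \<Omega>" "g \<in> L2_space \<Omega>"
  shows "L2_norm \<Omega> f \<le> L2_norm \<Omega> (\<lambda>z. f z - g z) + L2_norm \<Omega> g"
  using L2_norm_triangle[OF L2_diff[OF assms] assms(2)] by simp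

text \<open>Fields are not identified modulo null sets, so limits are determined only almost
  everywhere and no type class topology is available. Moreover \<open>L2_norm\<close> is 0 on
  functions that are not square integrable, by the default value of the integral; the lemmas on sums
  and inner products therefore ask for membership in \<open>L2_space\<close>.\<close>

definition L2_tendsto :: "(real \<times> real) set \<Rightarrow> ('a \<Rightarrow> field) \<Rightarrow> field \<Rightarrow> 'a filter \<Rightarrow> bool" where
  "L2_tendsto \<Omega> f l F \<longleftrightarrow> ((\<lambda>x. L2_norm \<Omega> (\<lambda>z. f x z - l z)) \<longlongrightarrow> 0) F"

lemma L2_tendsto_const: "L2_tendsto \<Omega> (\<lambda>_. f) f F"
  by (simp add: L2_tendsto_def L2_norm_def)

lemma L2_tendsto_add:
  assumes "L2_tendsto \<Omega> f f' F" "L2_tendsto \<Omega> g g' F"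
    "\<forall>\<^sub>F x in F. f x \<in> L2_space \<Omega> \<and> g x \<in> L2_space \<Omega>" "f' \<in> L2_space \<Omega>" "g' \<in> L2_space \<Omega>"
  shows "L2_tendsto \<Omega> (\<lambda>x z. f x z + g x z) (\<lambda>z. f' z + g' z) F"
  unfolding L2_tendsto_def
proof (rule Lim_null_comparison)
  show "\<forall>\<^sub>F x in F. norm (L2_norm \<Omega> (\<lambda>z. f x z + g x z - (f' z + g' z))) \<le>
     L2_norm \<Omega> (\<lambda>z. f x z - f' z) + L2_norm \<Omega> (\<lambda>z. g x z - g' z)"
    using assms(3)
  proof eventually_elim
    case (elim x)
    have "L2_norm \<Omega> (\<lambda>z. (f x z - f' z) + (g x z - g' z)) \<le>
        L2_norm \<Omega> (\<lambda>z. f x z - f' z) + L2_norm \<Omega> (\<lambda>z. g x z - g' z)"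
      using elim assms(4,5) by (intro L2_norm_triangle L2_diff) auto
    then show ?case by (simp add: algebra_simps)
  qed
  show "((\<lambda>x. L2_norm \<Omega> (\<lambda>z. f x z - f' z) + L2_norm \<Omega> (\<lambda>z. g x z - g' z)) \<longlongrightarrow> 0) F"
    using tendsto_add[OF assms(1,2)[unfolded L2_tendsto_def]] by simp
qed

lemma L2_tendsto_cmult:
  assumes "L2_tendsto \<Omega> f f' F"
  shows "L2_tendsto \<Omega> (\<lambda>x z. c * f x z) (\<lambda>z. c * f' z) F"
  using tendsto_mult_left[OF assms[unfolded L2_tendsto_def], of "\<bar>c\<bar>"]
  by (simp add: L2_tendsto_def right_diff_distrib[symmetric] L2_norm_cmult)

lemma L2_inner_tendsto:
  assumes "L2_tendsto \<Omega> f f' F" "L2_tendsto \<Omega> g g' F"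
    "\<forall>\<^sub>F x in F. f x \<in> L2_space \<Omega> \<and> g x \<in> L2_space \<Omega>" "f' \<in> L2_space \<Omega>" "g' \<in> L2_space \<Omega>"
  shows "((\<lambda>x. L2_inner \<Omega> (f x) (g x)) \<longlongrightarrow> L2_inner \<Omega> f' g') F"
proof -
  define a where "a x = L2_norm \<Omega> (\<lambda>z. f x z - f' z)" for x
  define b where "b x = L2_norm \<Omega> (\<lambda>z. g x z - g' z)" for x
  have a: "(a \<longlongrightarrow> 0) F" and b: "(b \<longlongrightarrow> 0) F"
    using assms(1,2) by (simp_all add: L2_tendsto_def a_def b_def[abs_def] a_def[abs_def])
  have "norm (L2_inner \<Omega> (f x) (g x) - L2_inner \<Omega> f' g') \<le>
      a x * b x + a x * L2_norm \<Omega> g' + L2_norm \<Omega> f' * b x"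
    if x: "f x \<in> L2_space \<Omega> \<and> g x \<in> L2_space \<Omega>" for x
  proof -
    note [simp] = x assms(4,5) L2_diff
    have eq: "L2_inner \<Omega> (f x) (g x) - L2_inner \<Omega> f' g' =
      L2_inner \<Omega> (\<lambda>z. f x z - f' z) (\<lambda>z. g x z - g' z)
      + L2_inner \<Omega> (\<lambda>z. f x z - f' z) g' + L2_inner \<Omega> f' (\<lambda>z. g x z - g' z)"
      by (simp add: L2_inner_diff_left L2_inner_diff_right)
    have "\<bar>L2_inner \<Omega> (\<lambda>z. f x z - f' z) (\<lambda>z. g x z - g' z)\<bar> \<le> a x * b x"
      "\<bar>L2_inner \<Omega> (\<lambda>z. f x z - f' z) g'\<bar> \<le> a x * L2_norm \<Omega> g'"
      "\<bar>L2_inner \<Omega> f' (\<lambda>z. g x z - g' z)\<bar> \<le> L2_norm \<Omega> f' * b x"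
      unfolding a_def b_def by (intro L2_Cauchy_Schwarz; simp)+
    then show ?thesis unfolding eq by simp
  qed
  then have le: "\<forall>\<^sub>F x in F. norm (L2_inner \<Omega> (f x) (g x) - L2_inner \<Omega> f' g') \<le>
      a x * b x + a x * L2_norm \<Omega> g' + L2_norm \<Omega> f' * b x"
    using assms(3) by (auto elim: eventually_mono)
  have "((\<lambda>x. a x * b x + a x * L2_norm \<Omega> g' + L2_norm \<Omega> f' * b x)
      \<longlongrightarrow> 0 * 0 + 0 * L2_norm \<Omega> g' + L2_norm \<Omega> f' * 0) F"
    by (intro tendsto_intros a b)
  then have "((\<lambda>x. L2_inner \<Omega> (f x) (g x) - L2_inner \<Omega> f' g') \<longlongrightarrow> 0) F"
    by (intro Lim_null_comparison[OF le]) simp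
  then show ?thesis by (simp add: Lim_null[symmetric])
qed

section \<open>Differentiating along the diagonal\<close>

text \<open>Chain rule along the line s = t + c, with c of either sign. Joint differentiability at a
  point follows when one partial derivative exists there and the other is continuous;
  \<open>P\<close> is the continuous one, so the t-derivative is asked for at \<open>t0\<close>
  alone.\<close>

lemma has_real_derivative_shifted_diagonal:
  fixes G P :: "real \<Rightarrow> real \<Rightarrow> real"
  assumes Gt: "((\<lambda>t. G t (t0 + c)) has_real_derivative d) (at t0 within {0..})"
    and Gs: "\<And>t s. \<lbrakk>0 \<le> t; 0 \<le> s\<rbrakk> \<Longrightarrow> (G t has_real_derivative P t s) (at s within {0..})"
    and P: "continuous_on ({0..} \<times> {0..}) (\<lambda>(t, s). P t s)"
    and pos: "0 < t0" "0 < t0 + c"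
  shows "((\<lambda>t. G t (t + c)) has_real_derivative d + P t0 (t0 + c)) (at t0)"
proof -
  have "continuous (at (t0, t0 + c) within {0..} \<times> {0..}) (\<lambda>(x, y). P x y)"
    using P pos by (auto simp: continuous_on_eq_continuous_within)
  then have cont: "continuous (at (t0, t0 + c) within {0..} \<times> {0..}) (\<lambda>(x, y). blinfun_mult_right (P x y))"
    unfolding continuous_def split_beta
    by (intro bounded_linear.tendsto[OF bounded_linear_blinfun_mult_right])
  have "((\<lambda>(x, y). G x y) has_derivative
      (\<lambda>(tx, ty). d * tx + blinfun_mult_right (P t0 (t0 + c)) ty)) (at (t0, t0 + c) within {0..} \<times> {0..})"
    by (rule has_derivative_partialsI[where fy = "\<lambda>x y. blinfun_mult_right (P x y)"])
      (use Gt Gs cont pos in \<open>auto simp: has_field_derivative_def\<close>)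
  moreover have "at (t0, t0 + c) within {0..} \<times> {0..} = at (t0, t0 + c)"
    by (rule at_within_interior) (use pos in \<open>simp add: interior_Times\<close>)
  ultimately have "((\<lambda>(x, y). G x y) has_derivative
      (\<lambda>(tx, ty). d * tx + P t0 (t0 + c) * ty)) (at (t0, t0 + c))"
    by simp
  moreover have "((\<lambda>t. (t, t + c)) has_derivative (\<lambda>h. (h, h))) (at t0)"
    by (auto intro!: derivative_eq_intros)
  ultimately have "((\<lambda>t. (\<lambda>(x, y). G x y) (t, t + c)) has_derivative
      (\<lambda>h. (\<lambda>(tx, ty). d * tx + P t0 (t0 + c) * ty) (h, h))) (at t0)"
    by (rule has_derivative_compose[rotated])
  then show ?thesis
    by (simp add: has_field_derivative_def distrib_right[abs_def])
qed

text \<open>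
  The function
  \<open>Y h t = (G t (t + h) - G t (t - h)) / h - (\<integral>x=t-h..t. P x (x + h) - Q x (x + h)) / h\<close> tends to
  \<open>P t t + Q t t\<close> as \<open>h\<close> tends to 0. By symmetry of \<open>P\<close> and \<open>Q\<close>, its \<open>t\<close>-derivative is
  \<open>(R t (t + h) - R t (t - h)) / h\<close>, which the mean value theorem turns into a value of \<open>2 * S t\<close>
  near \<open>t\<close>. Thus \<open>P\<close> and \<open>Q\<close> need not be differentiable off the diagonal.
\<close>

lemma diagonal_derivative:
  fixes G P Q R S :: "real \<Rightarrow> real \<Rightarrow> real"
  assumes Gt: "\<And>t s. \<lbrakk>0 \<le> t; 0 \<le> s\<rbrakk> \<Longrightarrow>
      ((\<lambda>t. G t s) has_real_derivative R t s - Q t s) (at t within {0..})"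
    and Gs: "\<And>t s. \<lbrakk>0 \<le> t; 0 \<le> s\<rbrakk> \<Longrightarrow> (G t has_real_derivative P t s) (at s within {0..})"
    and Rs: "\<And>t s. \<lbrakk>0 \<le> t; 0 \<le> s\<rbrakk> \<Longrightarrow> (R t has_real_derivative S t s) (at s within {0..})"
    and P: "continuous_on ({0..} \<times> {0..}) (\<lambda>(t, s). P t s)"
    and Q: "continuous_on ({0..} \<times> {0..}) (\<lambda>(t, s). Q t s)"
    and S: "continuous_on ({0..} \<times> {0..}) (\<lambda>(t, s). S t s)"
    and sym: "\<And>t s. P t s = P s t" "\<And>t s. Q t s = Q s t"
    and c: "0 \<le> c"
  shows "((\<lambda>t. P t t + Q t t) has_real_derivative 2 * S c c) (at c within {0..})"
proof -
  have at_pos: "at t within {0..} = at t" if "0 < t" for t :: real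
    using that by (intro at_within_interior) simp
  define \<phi> where "\<phi> h x = P x (x + h) - Q x (x + h)" for h x
  define \<Phi> where "\<Phi> h t = integral {0..t} (\<phi> h)" for h t
  define Y where "Y h t = (G t (t + h) - G t (t - h) - (\<Phi> h t - \<Phi> h (t - h))) / h" for h t
  define E where "E t = P t t + Q t t" for t
  have comp: "continuous_on {0..} (\<lambda>x. F x (x + h))"
    if "continuous_on ({0..} \<times> {0..}) (\<lambda>(t, s). F t s)" "0 \<le> h" for F :: "real \<Rightarrow> real \<Rightarrow> real" and h
  proof -
    have "continuous_on {0..} ((\<lambda>(t, s). F t s) \<circ> (\<lambda>x. (x, x + h)))"
      by (rule continuous_on_compose[OF _ continuous_on_subset[OF that(1)]])
        (use that(2) in \<open>auto intro!: continuous_intros\<close>)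
    then show ?thesis by (simp add: o_def)
  qed
  have \<phi>: "continuous_on {0..} (\<phi> h)" if "0 \<le> h" for h
    unfolding \<phi>_def using comp[OF P that] comp[OF Q that] by (intro continuous_intros)
  have \<Phi>: "(\<Phi> h has_real_derivative \<phi> h t) (at t)" if "0 \<le> h" "0 < t" for h t
  proof -
    have "continuous_on {0..t + 1} (\<phi> h)"
      using \<phi>[OF that(1)] by (rule continuous_on_subset) auto
    then have "(\<Phi> h has_real_derivative \<phi> h t) (at t within {0..t + 1})"
      unfolding \<Phi>_def using that by (intro integral_has_real_derivative) auto
    moreover have "at t within {0..t + 1} = at t"
      by (rule at_within_interior) (use that in simp)
    ultimately show ?thesis by simp
  qed
  have dY: "(Y h has_real_derivative (R t (t + h) - R t (t - h)) / h) (at t)"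
    if h: "0 < h" "h < t" for h t
  proof -
    have "0 < t" using h by simp
    have 1: "((\<lambda>t. G t (t + h)) has_real_derivative R t (t + h) - Q t (t + h) + P t (t + h)) (at t)"
      by (rule has_real_derivative_shifted_diagonal[OF Gt Gs P]) (use h in auto)
    have 2: "((\<lambda>t. G t (t + - h)) has_real_derivative R t (t + - h) - Q t (t + - h) + P t (t + - h)) (at t)"
      by (rule has_real_derivative_shifted_diagonal[OF Gt Gs P]) (use h in auto)
    have 3: "((\<lambda>t. \<Phi> h (t - h)) has_real_derivative \<phi> h (t - h)) (at t)"
      using DERIV_shift[of "\<Phi> h" "\<phi> h (t - h)" t "- h"] \<Phi>[of h "t - h"] h by simp
    have "((\<lambda>t. (G t (t + h) - G t (t + - h) - (\<Phi> h t - \<Phi> h (t - h))) / h) has_real_derivative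
        (R t (t + h) - Q t (t + h) + P t (t + h) - (R t (t + - h) - Q t (t + - h) + P t (t + - h))
          - (\<phi> h t - \<phi> h (t - h))) / h) (at t)"
      using h by (intro DERIV_cdivide DERIV_diff 1 2 3 \<Phi>) auto
    \<comment> \<open>By symmetry the terms of \<open>P\<close> and \<open>Q\<close> at (t, t - h)
      are \<open>\<phi> h (t - h)\<close>, and those at (t, t + h) are \<open>\<phi> h t\<close>;
      both cancel against the derivative of the integral, and \<open>R\<close> alone is
      left.\<close>
    then show ?thesis
      by (simp add: Y_def[abs_def] \<phi>_def sym[of "t - h" t])
  qed
  have mvtS: "\<exists>\<eta>. t - h < \<eta> \<and> \<eta> < t + h \<and> (R t (t + h) - R t (t - h)) / h = 2 * S t \<eta>"
    if h: "0 < h" "h < t" for h t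
  proof -
    have "\<exists>z. t - h < z \<and> z < t + h \<and> R t (t + h) - R t (t - h) = (t + h - (t - h)) * S t z"
    proof (rule MVT2)
      show "(R t has_real_derivative S t x) (at x)" if "t - h \<le> x" "x \<le> t + h" for x
        using Rs[of t x] at_pos[of x] that h by simp
    qed (use h in auto)
    then show ?thesis using h by (auto simp: field_simps)
  qed
  \<comment> \<open>The symmetric quotient of \<open>G t\<close> contributes 2 P and the mean of
    \<open>\<phi> h\<close> over [t - h, t] contributes P - Q; their difference is P + Q.\<close>
  have YE: "((\<lambda>h. Y h t) \<longlongrightarrow> E t) (at_right 0)" if t: "0 < t" for t
  proof -
    have "(G t has_real_derivative P t t) (at t)"
      using Gs[of t t] t at_pos by simp
    then have q: "((\<lambda>h. (G t (t + h) - G t t) / h) \<longlongrightarrow> P t t) (at 0)"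
      by (simp add: DERIV_def)
    have "((\<lambda>h. (G t (t + - h) - G t t) / - h) \<longlongrightarrow> P t t) (at 0)"
      by (rule filterlim_compose[OF q]) (auto simp: filterlim_at intro!: tendsto_eq_intros eventually_at_filter[THEN iffD2])
    from tendsto_add[OF q this]
    have "((\<lambda>h. (G t (t + h) - G t (t - h)) / h) \<longlongrightarrow> P t t + P t t) (at 0)"
      by (simp add: diff_divide_distrib)
    then have A: "((\<lambda>h. (G t (t + h) - G t (t - h)) / h) \<longlongrightarrow> P t t + P t t) (at_right 0)"
      by (rule filterlim_at_split[THEN iffD1, THEN conjunct2])
    have "\<forall>h. \<exists>z. 0 < h \<and> h < t \<longrightarrow> t - h < z \<and> z < t \<and> (\<Phi> h t - \<Phi> h (t - h)) / h = \<phi> h z"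
    proof
      fix h
      show "\<exists>z. 0 < h \<and> h < t \<longrightarrow> t - h < z \<and> z < t \<and> (\<Phi> h t - \<Phi> h (t - h)) / h = \<phi> h z"
      proof (cases "0 < h \<and> h < t")
        case True
        then have "\<exists>z. t - h < z \<and> z < t \<and> \<Phi> h t - \<Phi> h (t - h) = (t - (t - h)) * \<phi> h z"
          by (intro MVT2 \<Phi>) auto
        with True show ?thesis by (auto simp: field_simps)
      qed auto
    qed
    then obtain z where z: "\<And>h. 0 < h \<Longrightarrow> h < t \<Longrightarrow>
        t - h < z h \<and> z h < t \<and> (\<Phi> h t - \<Phi> h (t - h)) / h = \<phi> h (z h)"
      by metis
    have small: "\<forall>\<^sub>F h in at_right 0. 0 < h \<and> h < t"
      using eventually_at_right_real[OF t] by simp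
    have zt: "(z \<longlongrightarrow> t) (at_right 0)"
    proof (rule tendsto_sandwich)
      show "((\<lambda>h. t - h) \<longlongrightarrow> t) (at_right 0)" by (auto intro!: tendsto_eq_intros)
      show "((\<lambda>h. t) \<longlongrightarrow> t) (at_right 0)" by simp
      show "\<forall>\<^sub>F h in at_right 0. t - h \<le> z h" using small by eventually_elim (use z in force)
      show "\<forall>\<^sub>F h in at_right 0. z h \<le> t" using small by eventually_elim (use z in force)
    qed
    have lim: "((\<lambda>h. F (z h) (z h + h)) \<longlongrightarrow> F t t) (at_right 0)"
      if "continuous_on ({0..} \<times> {0..}) (\<lambda>(t, s). F t s)" for F :: "real \<Rightarrow> real \<Rightarrow> real"
    proof -
      have "((\<lambda>h. (\<lambda>(t, s). F t s) (z h, z h + h)) \<longlongrightarrow> (\<lambda>(t, s). F t s) (t, t)) (at_right 0)"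
      proof (rule continuous_on_tendsto_compose[OF that])
        show "((\<lambda>h. (z h, z h + h)) \<longlongrightarrow> (t, t)) (at_right 0)"
          by (rule tendsto_Pair[OF zt]) (use tendsto_add[OF zt tendsto_ident_at] in simp)
        show "\<forall>\<^sub>F h in at_right 0. (z h, z h + h) \<in> {0..} \<times> {0..}"
          using small by eventually_elim (use z in force)
      qed (use t in auto)
      then show ?thesis by simp
    qed
    have "((\<lambda>h. \<phi> h (z h)) \<longlongrightarrow> P t t - Q t t) (at_right 0)"
      unfolding \<phi>_def by (intro tendsto_diff lim P Q)
    then have B: "((\<lambda>h. (\<Phi> h t - \<Phi> h (t - h)) / h) \<longlongrightarrow> P t t - Q t t) (at_right 0)"
      by (rule Lim_transform_eventually) (use small in eventually_elim, use z in force)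
    show ?thesis
      using tendsto_diff[OF A B] by (simp add: Y_def E_def diff_divide_distrib)
  qed
  \<comment> \<open>Pointwise convergence of \<open>Y h\<close> does not carry derivatives to the
    limit, but bounds on increments survive it. They are therefore proved for all pairs near c, with
    a > 0 so that all arguments stay positive for small h.\<close>
  have est: "\<exists>\<delta>>0. \<forall>a b. 0 < a \<and> a < b \<and> \<bar>a - c\<bar> < \<delta> \<and> \<bar>b - c\<bar> < \<delta> \<longrightarrow>
      \<bar>E b - E a - 2 * S c c * (b - a)\<bar> \<le> \<epsilon> * (b - a)" if \<epsilon>: "0 < \<epsilon>" for \<epsilon>
  proof -
    have "(c, c) \<in> {0..} \<times> {0..}" using c by simp
    then obtain d where d: "0 < d"
      "\<And>p. p \<in> {0..} \<times> {0..} \<Longrightarrow> dist p (c, c) < d \<Longrightarrow>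
         dist ((\<lambda>(t, s). S t s) p) (S c c) < \<epsilon> / 2"
      using S[unfolded continuous_on_iff, rule_format, of "(c, c)" "\<epsilon> / 2"] \<epsilon> by auto
    \<comment> \<open>The radius \<open>d / 2\<close> leaves room for two mean values: x lies
      between a and b, hence within \<open>d / 4\<close> of c, and y is closer than h <
      \<open>d / 4\<close> to x.\<close>
    have Sd: "\<bar>S x y - S c c\<bar> < \<epsilon> / 2" if "0 \<le> x" "0 \<le> y" "\<bar>x - c\<bar> < d / 2" "\<bar>y - c\<bar> < d / 2" for x y
    proof -
      have "dist (x, y) (c, c) \<le> dist x c + dist y c"
        using norm_Pair_le[of "x - c" "y - c"] by (simp add: dist_norm)
      also have "\<dots> < d" using that by (simp add: dist_real_def)
      finally show ?thesis using d(2)[of "(x, y)"] that by (simp add: dist_real_def)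
    qed
    have "\<bar>E b - E a - 2 * S c c * (b - a)\<bar> \<le> \<epsilon> * (b - a)"
      if ab: "0 < a" "a < b" "\<bar>a - c\<bar> < d / 4" "\<bar>b - c\<bar> < d / 4" for a b
    proof (rule tendsto_upperbound)
      show "((\<lambda>h. \<bar>Y h b - Y h a - 2 * S c c * (b - a)\<bar>) \<longlongrightarrow> \<bar>E b - E a - 2 * S c c * (b - a)\<bar>) (at_right 0)"
        using ab by (intro tendsto_intros YE) auto
      have "\<forall>\<^sub>F h in at_right 0. 0 < h \<and> h < min a (d / 4)"
        using eventually_at_right_real[of 0 "min a (d / 4)"] ab d by simp
      then show "\<forall>\<^sub>F h in at_right 0. \<bar>Y h b - Y h a - 2 * S c c * (b - a)\<bar> \<le> \<epsilon> * (b - a)"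
      proof eventually_elim
        case (elim h)
        have "\<exists>x. a < x \<and> x < b \<and> Y h b - Y h a = (b - a) * ((R x (x + h) - R x (x - h)) / h)"
          by (intro MVT2 dY) (use ab elim in auto)
        then obtain x where x: "a < x" "x < b" "Y h b - Y h a = (b - a) * ((R x (x + h) - R x (x - h)) / h)"
          by blast
        then obtain y where y: "x - h < y" "y < x + h" "(R x (x + h) - R x (x - h)) / h = 2 * S x y"
          using mvtS[of h x] elim by auto
        have "\<bar>S x y - S c c\<bar> < \<epsilon> / 2"
          by (rule Sd) (use x(1,2) y(1,2) ab elim in linarith)+
        moreover have "\<bar>Y h b - Y h a - 2 * S c c * (b - a)\<bar> = (b - a) * (2 * \<bar>S x y - S c c\<bar>)"
        proof -
          have "Y h b - Y h a - 2 * S c c * (b - a) = (b - a) * (2 * (S x y - S c c))"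
            unfolding x(3) y(3) by (simp add: algebra_simps)
          then show ?thesis using ab by (simp only: abs_mult)
        qed
        ultimately show ?case
          using ab by (simp add: mult.commute)
      qed
    qed simp
    then show ?thesis using d(1) by (intro exI[of _ "d / 4"]) auto
  qed
  have Econt: "continuous_on {0..} E"
    unfolding E_def using comp[OF P, of 0] comp[OF Q, of 0] by (intro continuous_intros) auto
  \<comment> \<open>Letting a decrease to 0 admits the left end point, which the one-sided
    derivative at c = 0 requires.\<close>
  have est0: "\<exists>\<delta>>0. \<forall>a b. 0 \<le> a \<and> a < b \<and> \<bar>a - c\<bar> < \<delta> \<and> \<bar>b - c\<bar> < \<delta> \<longrightarrow>
      \<bar>E b - E a - 2 * S c c * (b - a)\<bar> \<le> \<epsilon> * (b - a)" if \<epsilon>: "0 < \<epsilon>" for \<epsilon>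
  proof -
    obtain \<delta> where \<delta>: "0 < \<delta>" "\<And>a b. \<lbrakk>0 < a; a < b; \<bar>a - c\<bar> < \<delta>; \<bar>b - c\<bar> < \<delta>\<rbrakk> \<Longrightarrow>
      \<bar>E b - E a - 2 * S c c * (b - a)\<bar> \<le> \<epsilon> * (b - a)"
      using est[OF \<epsilon>] by blast
    have "\<bar>E b - E a - 2 * S c c * (b - a)\<bar> \<le> \<epsilon> * (b - a)"
      if ab: "0 \<le> a" "a < b" "\<bar>a - c\<bar> < \<delta>" "\<bar>b - c\<bar> < \<delta>" for a b
    proof (rule tendsto_le)
      have "(E \<longlongrightarrow> E a) (at_right a)"
        using Econt ab(1) by (auto simp: continuous_on_def intro: tendsto_within_subset)
      then show "((\<lambda>x. \<bar>E b - E x - 2 * S c c * (b - x)\<bar>) \<longlongrightarrow> \<bar>E b - E a - 2 * S c c * (b - a)\<bar>) (at_right a)"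
        by (intro tendsto_intros)
      show "((\<lambda>x. \<epsilon> * (b - x)) \<longlongrightarrow> \<epsilon> * (b - a)) (at_right a)"
        by (intro tendsto_intros)
      have "\<forall>\<^sub>F x in at_right a. a < x \<and> x < b"
        using eventually_at_right_real[OF ab(2)] by simp
      then show "\<forall>\<^sub>F x in at_right a. \<bar>E b - E x - 2 * S c c * (b - x)\<bar> \<le> \<epsilon> * (b - x)"
        by eventually_elim (use ab in \<open>intro \<delta>(2); auto\<close>)
    qed simp
    then show ?thesis using \<delta>(1) by blast
  qed
  have "(E has_derivative (\<lambda>h. 2 * S c c * h)) (at c within {0..})"
    unfolding has_derivative_within_alt
  proof (intro conjI allI impI)
    fix e :: real assume "0 < e"
    from est0[OF this] obtain \<delta> where \<delta>: "0 < \<delta>"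
      "\<And>a b. \<lbrakk>0 \<le> a; a < b; \<bar>a - c\<bar> < \<delta>; \<bar>b - c\<bar> < \<delta>\<rbrakk> \<Longrightarrow>
        \<bar>E b - E a - 2 * S c c * (b - a)\<bar> \<le> e * (b - a)"
      by blast
    have "norm (E y - E c - 2 * S c c * (y - c)) \<le> e * norm (y - c)"
      if y: "y \<in> {0..}" "norm (y - c) < \<delta>" for y
    proof (cases y c rule: linorder_cases)
      case less
      have "E y - E c - 2 * S c c * (y - c) = - (E c - E y - 2 * S c c * (c - y))"
        by (simp add: algebra_simps)
      moreover have "\<bar>E c - E y - 2 * S c c * (c - y)\<bar> \<le> e * (c - y)"
        using less y \<delta>(1) by (intro \<delta>(2)) auto
      moreover have "\<bar>y - c\<bar> = c - y" using less by simp
      ultimately show ?thesis by (simp only: real_norm_def abs_minus_cancel)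
    next
      case greater
      then show ?thesis using \<delta>(2)[of c y] y \<delta>(1) c by simp
    qed simp
    then show "\<exists>d>0. \<forall>y\<in>{0..}. norm (y - c) < d \<longrightarrow> norm (E y - E c - 2 * S c c * (y - c)) \<le> e * norm (y - c)"
      using \<delta>(1) by blast
  qed (rule bounded_linear_mult_right)
  then show ?thesis
    by (simp add: has_field_derivative_def E_def[abs_def])
qed

section \<open>Smooth functions with compact support\<close>

lemma px_has_real_derivative:
  assumes "f differentiable (at (x, y))"
  shows "((\<lambda>s. f (s, y)) has_real_derivative px f (x, y)) (at x)"
proof -
  obtain f' where f': "(f has_derivative f') (at (x, y))"
    using assms by (auto simp: differentiable_def)
  have "((\<lambda>s. (s, y)) has_derivative (\<lambda>h. (h, 0))) (at x)"
    by (auto intro!: derivative_eq_intros)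
  from has_derivative_compose[OF this f']
  have "(\<lambda>s. f (s, y)) differentiable (at x)"
    by (auto simp: differentiable_def)
  then show ?thesis
    by (simp add: px_def DERIV_deriv_iff_real_differentiable)
qed

lemma py_has_real_derivative:
  assumes "f differentiable (at (x, y))"
  shows "((\<lambda>s. f (x, s)) has_real_derivative py f (x, y)) (at y)"
proof -
  obtain f' where f': "(f has_derivative f') (at (x, y))"
    using assms by (auto simp: differentiable_def)
  have "((\<lambda>s. (x, s)) has_derivative (\<lambda>h. (0, h))) (at y)"
    by (auto intro!: derivative_eq_intros)
  from has_derivative_compose[OF this f']
  have "(\<lambda>s. f (x, s)) differentiable (at y)"
    by (auto simp: differentiable_def)
  then show ?thesis
    by (simp add: py_def DERIV_deriv_iff_real_differentiable)
qed

lemma px_eqI: "(\<And>x y. ((\<lambda>s. f (s, y)) has_real_derivative g (x, y)) (at x)) \<Longrightarrow> px f = g"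
  by (auto simp: px_def fun_eq_iff intro!: DERIV_imp_deriv)

lemma py_eqI: "(\<And>x y. ((\<lambda>s. f (x, s)) has_real_derivative g (x, y)) (at y)) \<Longrightarrow> py f = g"
  by (auto simp: py_def fun_eq_iff intro!: DERIV_imp_deriv)

lemma px_linear:
  assumes "\<And>z. f differentiable (at z)" "\<And>z. g differentiable (at z)"
  shows "px (\<lambda>z. a * f z + b * g z) = (\<lambda>z. a * px f z + b * px g z)"
  by (rule px_eqI) (intro DERIV_add DERIV_cmult px_has_real_derivative assms)

lemma py_linear:
  assumes "\<And>z. f differentiable (at z)" "\<And>z. g differentiable (at z)"
  shows "py (\<lambda>z. a * f z + b * g z) = (\<lambda>z. a * py f z + b * py g z)"
  by (rule py_eqI) (intro DERIV_add DERIV_cmult py_has_real_derivative assms)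

lemma Ck_imp_continuous: "Ck k f \<Longrightarrow> continuous_on UNIV f"
  by (cases k) (auto simp: continuous_on_eq_continuous_within intro: differentiable_imp_continuous_within)

lemma Ck_linear:
  assumes "Ck k f" "Ck k g"
  shows "Ck k (\<lambda>z. a * f z + b * g z)"
  using assms
proof (induction k arbitrary: f g)
  case 0
  then show ?case by (auto intro!: continuous_intros)
next
  case (Suc k)
  then have fg: "\<And>z. f differentiable (at z)" "\<And>z. g differentiable (at z)" by auto
  have "(\<lambda>z. a * f z + b * g z) differentiable (at z)" for z
    by (intro differentiable_add differentiable_mult differentiable_const fg)
  with Suc show ?case
    by (simp add: px_linear[OF fg] py_linear[OF fg])
qed

text \<open>Derivatives are existential witnesses rather than values of \<open>deriv\<close>, so
  that in each induction the candidate can simply be exhibited.\<close>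

fun smooth_upto :: "nat \<Rightarrow> (real \<Rightarrow> real) \<Rightarrow> bool" where
  "smooth_upto 0 f \<longleftrightarrow> continuous_on UNIV f"
| "smooth_upto (Suc k) f \<longleftrightarrow> (\<exists>f'. (\<forall>x. (f has_real_derivative f' x) (at x)) \<and> smooth_upto k f')"

lemma smooth_upto_imp_continuous: "smooth_upto k f \<Longrightarrow> continuous_on UNIV f"
  by (cases k) (auto intro!: continuous_at_imp_continuous_on intro: DERIV_isCont)

text \<open>In the product rule a derivative of order k meets a factor of order k + 1; this brings
  both to the same order.\<close>

lemma smooth_upto_Suc: "smooth_upto (Suc k) f \<Longrightarrow> smooth_upto k f"
proof (induction k arbitrary: f)
  case 0
  then show ?case using smooth_upto_imp_continuous[of "Suc 0" f] by simp
next
  case (Suc k)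
  then obtain f' where "\<forall>x. (f has_real_derivative f' x) (at x)" "smooth_upto (Suc k) f'" by auto
  with Suc.IH show ?case by auto
qed

lemma smooth_upto_const: "smooth_upto k (\<lambda>_. c)"
proof (induction k arbitrary: c)
  case (Suc k)
  then show ?case by (auto intro!: exI[of _ "\<lambda>_. 0"])
qed simp

lemma smooth_upto_add:
  assumes "smooth_upto k f" "smooth_upto k g"
  shows "smooth_upto k (\<lambda>x. f x + g x)"
  using assms
proof (induction k arbitrary: f g)
  case 0
  then show ?case by (auto intro!: continuous_intros)
next
  case (Suc k)
  then obtain f' g' where
    "\<forall>x. (f has_real_derivative f' x) (at x)" "smooth_upto k f'"
    "\<forall>x. (g has_real_derivative g' x) (at x)" "smooth_upto k g'" by auto
  with Suc.IH show ?case
    by (auto intro!: exI[of _ "\<lambda>x. f' x + g' x"] DERIV_add)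
qed

lemma smooth_upto_mult:
  assumes "smooth_upto k f" "smooth_upto k g"
  shows "smooth_upto k (\<lambda>x. f x * g x)"
  using assms
proof (induction k arbitrary: f g)
  case 0
  then show ?case by (auto intro!: continuous_intros)
next
  case (Suc k)
  then obtain f' g' where fg:
    "\<forall>x. (f has_real_derivative f' x) (at x)" "smooth_upto k f'"
    "\<forall>x. (g has_real_derivative g' x) (at x)" "smooth_upto k g'" by auto
  have "smooth_upto k (\<lambda>x. f' x * g x + g' x * f x)"
    using Suc fg smooth_upto_Suc by (intro smooth_upto_add Suc.IH) blast+
  with fg show ?case
    by (auto intro!: exI[of _ "\<lambda>x. f' x * g x + g' x * f x"] DERIV_mult)
qed

lemma smooth_upto_affine:
  assumes "smooth_upto k f"
  shows "smooth_upto k (\<lambda>x. f (a * x + b))"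
  using assms
proof (induction k arbitrary: f)
  case 0
  then show ?case
    by (auto intro!: continuous_intros intro: continuous_on_compose2[of UNIV f UNIV])
next
  case (Suc k)
  then obtain f' where f': "\<forall>x. (f has_real_derivative f' x) (at x)" "smooth_upto k f'" by auto
  have "((\<lambda>x. f (a * x + b)) has_real_derivative f' (a * x + b) * a) (at x)" for x
    by (rule DERIV_chain2[where f = f and g = "\<lambda>x. a * x + b"])
      (use f'(1) in \<open>auto intro!: derivative_eq_intros\<close>)
  moreover have "smooth_upto k (\<lambda>x. f' (a * x + b) * a)"
    by (intro smooth_upto_mult smooth_upto_const Suc.IH f')
  ultimately show ?case
    by (auto intro!: exI[of _ "\<lambda>x. f' (a * x + b) * a"])
qed

lemma tensor_differentiable:
  fixes f g :: "real \<Rightarrow> real"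
  assumes "\<And>x. f differentiable (at x)" "\<And>x. g differentiable (at x)"
  shows "(\<lambda>z. f (fst z) * g (snd z)) differentiable (at z)"
proof -
  have "(f \<circ> fst) differentiable (at z)" "(g \<circ> snd) differentiable (at z)"
    by (intro differentiable_chain_at assms
        bounded_linear_imp_differentiable bounded_linear_fst bounded_linear_snd)+
  then have "(\<lambda>z. f (fst z)) differentiable (at z)" "(\<lambda>z. g (snd z)) differentiable (at z)"
    by (simp_all add: o_def)
  then show ?thesis by (rule differentiable_mult)
qed

text \<open>Both partial derivatives of f(x) g(y) are again products of this kind, so the induction
  stays within the class.\<close>

lemma Ck_tensor:
  assumes "smooth_upto k f" "smooth_upto k g"
  shows "Ck k (\<lambda>z. f (fst z) * g (snd z))"
  using assms
proof (induction k arbitrary: f g)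
  case 0
  then show ?case
    by (auto intro!: continuous_intros intro: continuous_on_compose2[of UNIV])
next
  case (Suc k)
  then obtain f' g' where fg:
    "\<And>x. (f has_real_derivative f' x) (at x)" "smooth_upto k f'"
    "\<And>x. (g has_real_derivative g' x) (at x)" "smooth_upto k g'" by auto
  have "px (\<lambda>z. f (fst z) * g (snd z)) = (\<lambda>z. f' (fst z) * g (snd z))"
    by (rule px_eqI) (auto intro!: DERIV_cmult_right fg)
  moreover have "py (\<lambda>z. f (fst z) * g (snd z)) = (\<lambda>z. f (fst z) * g' (snd z))"
    by (rule py_eqI) (auto intro!: DERIV_cmult fg)
  moreover have "(\<lambda>z. f (fst z) * g (snd z)) differentiable (at z)" for z
    using fg(1,3) by (intro tensor_differentiable) (auto simp: real_differentiable_def)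
  ultimately show ?case
    using Suc fg smooth_upto_Suc by auto
qed

text \<open>The classical function exp(-1/x), extended by 0 to x <= 0. The extra division by x^m
  makes the family closed under differentiation up to linear combinations, which is what an
  induction on the order of smoothness needs.\<close>

definition flat :: "nat \<Rightarrow> real \<Rightarrow> real" where
  "flat m x = (if x > 0 then exp (- (1 / x)) / x ^ m else 0)"

lemma flat_tendsto_0: "((\<lambda>x. exp (- (1 / x)) / x ^ m) \<longlongrightarrow> (0::real)) (at_right 0)"
proof -
  have "((\<lambda>x. inverse x ^ m / exp (inverse x)) \<longlongrightarrow> (0::real)) (at_right 0)"
    by (rule filterlim_compose[OF tendsto_power_div_exp_0 filterlim_inverse_at_top_right])
  then show ?thesis
    by (simp add: exp_minus field_simps)
qed

lemma flat_has_real_derivative: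
  "(flat m has_real_derivative flat (m + 2) x - real m * flat (m + 1) x) (at x)"
proof (cases x "0 :: real" rule: linorder_cases)
  case less
  have "(flat m has_real_derivative 0) (at x)"
    by (rule has_field_derivative_transform_within_open[OF DERIV_const[of 0], of "{..<0}"])
      (use less in \<open>auto simp: flat_def\<close>)
  then show ?thesis using less by (simp add: flat_def)
next
  \<comment> \<open>At 0 the left difference quotient vanishes and the right one is exp(-1/h) /
    h^(m+1), which is the function with the next exponent and tends to 0.\<close>
  case equal
  have "((\<lambda>h. (flat m (0 + h) - flat m 0) / h) \<longlongrightarrow> 0) (at_right 0)"
  proof (rule Lim_transform_eventually[OF flat_tendsto_0[of "Suc m"]])
    show "\<forall>\<^sub>F h in at_right 0. exp (- (1 / h)) / h ^ Suc m = (flat m (0 + h) - flat m 0) / h"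
      using eventually_at_right_less[of "0::real"] by eventually_elim (simp add: flat_def)
  qed
  moreover have "((\<lambda>h. (flat m (0 + h) - flat m 0) / h) \<longlongrightarrow> 0) (at_left 0)"
  proof (rule Lim_transform_eventually[OF tendsto_const])
    show "\<forall>\<^sub>F h in at_left 0. 0 = (flat m (0 + h) - flat m 0) / h"
      by (simp add: flat_def eventually_at_filter)
  qed
  ultimately have "((\<lambda>h. (flat m (0 + h) - flat m 0) / h) \<longlongrightarrow> 0) (at 0)"
    by (simp add: filterlim_at_split)
  then have "(flat m has_real_derivative 0) (at 0)" by (simp add: DERIV_def)
  then show ?thesis using equal by (simp add: flat_def)
next
  case greater
  have "((\<lambda>x. exp (- (1 / x)) / x ^ m) has_real_derivative
      (exp (- (1 / x)) * (1 / x\<^sup>2) * x ^ m - exp (- (1 / x)) * (real m * x ^ (m - 1))) / (x ^ m * x ^ m)) (at x)"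
    using greater by (auto intro!: derivative_eq_intros simp: power2_eq_square)
  also have "(exp (- (1 / x)) * (1 / x\<^sup>2) * x ^ m - exp (- (1 / x)) * (real m * x ^ (m - 1))) / (x ^ m * x ^ m)
      = flat (m + 2) x - real m * flat (m + 1) x"
    using greater by (cases m) (auto simp: flat_def field_simps power2_eq_square power_add)
  finally show ?thesis
    by (rule has_field_derivative_transform_within_open[where S = "{0<..}"])
      (use greater in \<open>auto simp: flat_def\<close>)
qed

lemma smooth_upto_flat: "smooth_upto k (flat m)"
proof (induction k arbitrary: m)
  case 0
  have "isCont (flat m) x" for x
    by (rule DERIV_isCont[OF flat_has_real_derivative])
  then show ?case by (simp add: continuous_at_imp_continuous_on)
next
  case (Suc k)
  have "smooth_upto k (\<lambda>x. flat (m + 2) x + (- real m) * flat (m + 1) x)"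
    by (intro smooth_upto_add smooth_upto_mult smooth_upto_const Suc.IH)
  then show ?case
    using flat_has_real_derivative[of m] by (auto intro!: exI[of _ "\<lambda>x. flat (m + 2) x - real m * flat (m + 1) x"])
qed

lemma flat_0_bounds: "0 \<le> flat 0 x" "flat 0 x \<le> 1"
  by (auto simp: flat_def)

text \<open>The offset -1 keeps the support at distance 1/n from both end points, so it is compact
  inside the open interval. The factor n drives both arguments to infinity at every interior point,
  where \<open>flat 0\<close> tends to 1. For n = 0 the function is identically 0.\<close>

definition bump :: "nat \<Rightarrow> real \<Rightarrow> real \<Rightarrow> real \<Rightarrow> real" where
  "bump n a b x = flat 0 (real n * (x - a) - 1) * flat 0 (real n * (b - x) - 1)"

lemma smooth_upto_bump: "smooth_upto k (bump n a b)"
proof -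
  have "smooth_upto k (\<lambda>x. flat 0 (real n * x + (- real n * a - 1)) * flat 0 ((- real n) * x + (real n * b - 1)))"
    by (intro smooth_upto_mult smooth_upto_affine smooth_upto_flat)
  also have "(\<lambda>x. flat 0 (real n * x + (- real n * a - 1)) * flat 0 ((- real n) * x + (real n * b - 1))) = bump n a b"
    by (simp add: bump_def fun_eq_iff algebra_simps)
  finally show ?thesis .
qed

lemma bump_bounds: "0 \<le> bump n a b x" "bump n a b x \<le> 1"
  using flat_0_bounds by (auto simp: bump_def intro!: mult_le_one)

lemma bump_nonzeroD:
  assumes "bump n a b x \<noteq> 0"
  shows "a + 1 / real n \<le> x" "x \<le> b - 1 / real n" "0 < n"
proof -
  have *: "0 < real n * (x - a) - 1" "0 < real n * (b - x) - 1"
    using assms by (auto simp: bump_def flat_def split: if_splits)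
  then show "0 < n" by (cases n) auto
  with * show "a + 1 / real n \<le> x" "x \<le> b - 1 / real n"
    by (auto simp: field_simps)
qed

lemma flat_0_scaled_tendsto:
  assumes "0 < y"
  shows "(\<lambda>n. flat 0 (real n * y - 1)) \<longlonglongrightarrow> 1"
proof -
  have lim: "filterlim (\<lambda>n. real n * y - 1) at_top sequentially"
    using filterlim_tendsto_add_at_top[OF tendsto_const[of "-1"]
        filterlim_at_top_mult_tendsto_pos[OF tendsto_const[of y] assms filterlim_real_sequentially]]
    by (simp add: mult.commute)
  have "((\<lambda>x. exp (- (inverse x))) \<longlongrightarrow> exp (- 0)) (at_top :: real filter)"
    by (intro tendsto_intros tendsto_inverse_0_at_top filterlim_ident)
  moreover have "\<forall>\<^sub>F x in at_top. exp (- (inverse x)) = flat 0 x"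
    using eventually_gt_at_top[of "0::real"] by eventually_elim (simp add: flat_def divide_inverse)
  ultimately have "(flat 0 \<longlongrightarrow> exp (- 0)) at_top"
    by (rule Lim_transform_eventually)
  then have "(flat 0 \<longlongrightarrow> 1) at_top" by simp
  from filterlim_compose[OF this lim] show ?thesis .
qed

lemma bump_tendsto_indicator: "(\<lambda>n. bump n a b x) \<longlonglongrightarrow> indicator {a<..<b} x"
proof (cases "a < x \<and> x < b")
  case True
  have "(\<lambda>n. bump n a b x) \<longlonglongrightarrow> 1 * 1"
    unfolding bump_def using True by (intro tendsto_mult flat_0_scaled_tendsto) auto
  then show ?thesis using True by simp
next
  case False
  have "bump n a b x = 0" for n
  proof (rule ccontr)
    assume "bump n a b x \<noteq> 0"
    from bump_nonzeroD[OF this] have "a + 1 / real n \<le> x" "x \<le> b - 1 / real n" "0 < 1 / real n" by auto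
    then have "a < x \<and> x < b" by linarith
    with False show False by simp
  qed
  then show ?thesis using False by simp
qed

section \<open>Test functions on planar sets\<close>

lemma test_functions_I:
  assumes "\<And>k. Ck k v" "compact K" "K \<subseteq> \<Omega>" "\<And>z. z \<notin> K \<Longrightarrow> v z = 0"
  shows "v \<in> test_functions \<Omega>"
proof -
  have "closure {z. v z \<noteq> 0} \<subseteq> K"
    using assms(2,4) by (intro closure_minimal) (auto intro: compact_imp_closed)
  moreover from this have "compact (closure {z. v z \<noteq> 0})"
    using assms(2) by (metis closed_closure compact_Int_closed inf.absorb_iff2)
  ultimately show ?thesis using assms by (auto simp: test_functions_def)
qed

lemma test_functions_linear:
  assumes "v \<in> test_functions \<Omega>" "w \<in> test_functions \<Omega>"
  shows "(\<lambda>z. a * v z + b * w z) \<in> test_functions \<Omega>"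
proof (rule test_functions_I)
  show "compact (closure {z. v z \<noteq> 0} \<union> closure {z. w z \<noteq> 0})"
    using assms by (auto simp: test_functions_def)
  show "closure {z. v z \<noteq> 0} \<union> closure {z. w z \<noteq> 0} \<subseteq> \<Omega>"
    using assms by (auto simp: test_functions_def)
  show "Ck k (\<lambda>z. a * v z + b * w z)" for k
    using assms by (intro Ck_linear) (auto simp: test_functions_def)
  show "a * v z + b * w z = 0" if "z \<notin> closure {z. v z \<noteq> 0} \<union> closure {z. w z \<noteq> 0}" for z
  proof -
    have "v z = 0" "w z = 0"
      using that closure_subset[of "{z. v z \<noteq> 0}"] closure_subset[of "{z. w z \<noteq> 0}"] by blast+
    then show ?thesis by simp
  qed
qed

lemma zero_test_function: "(\<lambda>_. 0) \<in> test_functions \<Omega>"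
proof (rule test_functions_I[where K = "{}"])
  show "Ck k (\<lambda>_. 0)" for k
    using Ck_tensor[OF smooth_upto_const[of k 0] smooth_upto_const[of k 0]] by simp
qed auto

lemma bump_box_test_function:
  assumes "{a<..<b} \<times> {c<..<d} \<subseteq> \<Omega>"
  shows "(\<lambda>z. bump n a b (fst z) * bump n c d (snd z)) \<in> test_functions \<Omega>"
\<comment> \<open>Since \<open>1 / real 0 = 0\<close>, the shrunken box would be the full closed
  box, which may leave the domain; the bump is then zero anyway.\<close>
proof (cases "n = 0")
  case True
  then have "bump n a b x = 0" for x a b using bump_nonzeroD(3) by blast
  then show ?thesis using zero_test_function by simp
next
  case False
  show ?thesis
  proof (rule test_functions_I)
    show "compact ({a + 1 / real n .. b - 1 / real n} \<times> {c + 1 / real n .. d - 1 / real n})"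
      by (intro compact_Times compact_Icc)
    have "{a + 1 / real n .. b - 1 / real n} \<times> {c + 1 / real n .. d - 1 / real n} \<subseteq> {a<..<b} \<times> {c<..<d}"
    proof -
      have "{a + e .. b - e} \<times> {c + e .. d - e} \<subseteq> {a<..<b} \<times> {c<..<d}" if "0 < e" for e
        using that by auto
      from this[of "1 / real n"] show ?thesis using False by simp
    qed
    then show "{a + 1 / real n .. b - 1 / real n} \<times> {c + 1 / real n .. d - 1 / real n} \<subseteq> \<Omega>"
      using assms by blast
    show "Ck k (\<lambda>z. bump n a b (fst z) * bump n c d (snd z))" for k
      by (intro Ck_tensor smooth_upto_bump)
    show "bump n a b (fst z) * bump n c d (snd z) = 0"
      if "z \<notin> {a + 1 / real n .. b - 1 / real n} \<times> {c + 1 / real n .. d - 1 / real n}" for z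
      using that bump_nonzeroD[of n a b "fst z"] bump_nonzeroD[of n c d "snd z"]
      by (cases z) auto
  qed
qed

lemma test_functionD:
  assumes "v \<in> test_functions \<Omega>"
  shows "Ck k v" "\<And>z. v differentiable (at z)" "Ck k (px v)" "Ck k (py v)"
proof -
  show "Ck k v" "\<And>z. v differentiable (at z)" "Ck k (px v)" "Ck k (py v)"
    using assms[unfolded test_functions_def]
    by (auto dest!: spec[of "\<lambda>k. Ck k v" "Suc k"])
qed

text \<open>The complement of the closed support is open, so v vanishes on a whole product
  neighbourhood and in particular on both coordinate lines near z.\<close>

lemma px_py_zero_outside_support:
  assumes "z \<notin> closure {z. v z \<noteq> 0}"
  shows "v z = 0" "px v z = 0" "py v z = 0"
proof -
  define U where "U = - closure {z. v z \<noteq> 0}"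
  have U: "open U" "z \<in> U" using assms by (auto simp: U_def)
  have vU: "v p = 0" if "p \<in> U" for p
    using that closure_subset[of "{z. v z \<noteq> 0}"] by (auto simp: U_def)
  show "v z = 0" using vU U by simp
  obtain x y where z: "z = (x, y)" by (cases z)
  obtain A B where AB: "open A" "open B" "x \<in> A" "y \<in> B" "A \<times> B \<subseteq> U"
    using open_prod_elim[OF U] z by (metis mem_Sigma_iff)
  have "((\<lambda>s. v (s, y)) has_real_derivative 0) (at x)"
    by (rule has_field_derivative_transform_within_open[OF DERIV_const[of 0] AB(1,3)])
      (use vU AB in force)
  then show "px v z = 0" by (simp add: z px_def DERIV_imp_deriv)
  have "((\<lambda>s. v (x, s)) has_real_derivative 0) (at y)"
    by (rule has_field_derivative_transform_within_open[OF DERIV_const[of 0] AB(2,4)])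
      (use vU AB in force)
  then show "py v z = 0" by (simp add: z py_def DERIV_imp_deriv)
qed

lemma continuous_compact_support_L2:
  assumes "continuous_on UNIV f" "compact K" "\<And>z. z \<notin> K \<Longrightarrow> f z = 0" "\<Omega> \<in> lmeasurable"
  shows "f \<in> L2_space \<Omega>"
proof -
  interpret finite_measure "lebesgue_on \<Omega>" by (rule finite_measure_lebesgue_on[OF assms(4)])
  have "bounded (f ` K)"
    using assms(1,2) by (intro compact_imp_bounded compact_continuous_image continuous_on_subset[OF assms(1)]) auto
  then obtain B where B: "\<And>z. z \<in> K \<Longrightarrow> norm (f z) \<le> B" by (auto simp: bounded_iff)
  have le: "\<bar>f z\<bar> \<le> max B 0" for z
    using B[of z] assms(3)[of z] by (cases "z \<in> K") auto
  have m: "f \<in> borel_measurable (lebesgue_on \<Omega>)"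
    using assms by (intro continuous_imp_measurable_on_sets_lebesgue continuous_on_subset[OF assms(1)]) auto
  have "integrable (lebesgue_on \<Omega>) (\<lambda>z. (f z)\<^sup>2)"
  proof (rule integrable_const_bound)
    show "AE z in lebesgue_on \<Omega>. norm ((f z)\<^sup>2) \<le> (max B 0)\<^sup>2"
      using le by (simp add: abs_le_square_iff[symmetric])
  qed (use m in simp)
  with m show ?thesis by (simp add: L2_space_def)
qed

lemma test_function_L2:
  assumes "v \<in> test_functions \<Omega>" "\<Omega>' \<in> lmeasurable"
  shows "v \<in> L2_space \<Omega>'" "px v \<in> L2_space \<Omega>'" "py v \<in> L2_space \<Omega>'"
proof -
  have K: "compact (closure {z. v z \<noteq> 0})" using assms by (simp add: test_functions_def)
  show "v \<in> L2_space \<Omega>'" "px v \<in> L2_space \<Omega>'" "py v \<in> L2_space \<Omega>'"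
    using assms(2) Ck_imp_continuous[OF test_functionD(1)[OF assms(1)]]
      Ck_imp_continuous[OF test_functionD(3)[OF assms(1)]]
      Ck_imp_continuous[OF test_functionD(4)[OF assms(1)]]
    by (auto intro!: continuous_compact_support_L2[OF _ K] px_py_zero_outside_support)
qed

section \<open>Density of the test functions in \<open>L\<^sup>2\<close>\<close>

lemma rectangle_lmeasurable: "rectangle a b \<in> lmeasurable"
proof -
  have "bounded (rectangle a b)"
    unfolding rectangle_def by (intro bounded_Times) auto
  then show ?thesis
    by (intro lmeasurable_open) (auto simp: rectangle_def open_Times)
qed

lemma borel_measurable_lebesgue_onI:
  "f \<in> borel_measurable borel \<Longrightarrow> f \<in> borel_measurable (lebesgue_on \<Omega>)" for f :: field
  by (intro measurable_restrict_space1 measurable_completion) simp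

lemma bounded_L2:
  assumes "f \<in> borel_measurable (lebesgue_on \<Omega>)" "\<And>z. \<bar>f z\<bar> \<le> B" "\<Omega> \<in> lmeasurable"
  shows "f \<in> L2_space \<Omega>"
proof -
  interpret finite_measure "lebesgue_on \<Omega>" by (rule finite_measure_lebesgue_on[OF assms(3)])
  have "integrable (lebesgue_on \<Omega>) (\<lambda>z. (f z)\<^sup>2)"
  proof (rule integrable_const_bound)
    have "(f z)\<^sup>2 \<le> B\<^sup>2" for z
      using assms(2)[of z] by (simp add: abs_le_square_iff[symmetric])
    then show "AE z in lebesgue_on \<Omega>. norm ((f z)\<^sup>2) \<le> B\<^sup>2" by simp
  qed (use assms(1) in simp)
  with assms show ?thesis by (simp add: L2_space_def)
qed

lemma L2_tendsto_dominated:
  assumes "\<And>n. f n \<in> borel_measurable (lebesgue_on \<Omega>)" "l \<in> borel_measurable (lebesgue_on \<Omega>)"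
    and g: "g \<in> L2_space \<Omega>"
    and lim: "\<And>z. z \<in> \<Omega> \<Longrightarrow> (\<lambda>n::nat. f n z) \<longlonglongrightarrow> l z"
    and le: "\<And>n z. z \<in> \<Omega> \<Longrightarrow> \<bar>f n z - l z\<bar> \<le> \<bar>g z\<bar>"
  shows "L2_tendsto \<Omega> f l sequentially"
proof -
  have "(\<lambda>n. LINT z|lebesgue_on \<Omega>. (f n z - l z)\<^sup>2) \<longlonglongrightarrow> (LINT z|lebesgue_on \<Omega>. 0)"
  proof (rule integral_dominated_convergence)
    show "integrable (lebesgue_on \<Omega>) (\<lambda>z. (g z)\<^sup>2)" using g by (simp add: L2_space_def)
    show "AE z in lebesgue_on \<Omega>. norm ((f n z - l z)\<^sup>2) \<le> (g z)\<^sup>2" for n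
      using le by (intro AE_I2) (auto simp: abs_le_square_iff[symmetric])
    show "AE z in lebesgue_on \<Omega>. (\<lambda>n. (f n z - l z)\<^sup>2) \<longlonglongrightarrow> 0"
      using lim by (intro AE_I2) (auto intro!: tendsto_eq_intros)
  qed (use assms(1,2) in auto)
  from tendsto_real_sqrt[OF this] show ?thesis
    by (simp add: L2_tendsto_def L2_norm_def)
qed

text \<open>Density is proved by showing that this closed subspace contains indicators of boxes,
  then of all Borel sets, then all nonnegative square integrable Borel functions, and finally all of
  \<open>L2_space\<close>.\<close>

definition L2_closure_test :: "(real \<times> real) set \<Rightarrow> field set" where
  "L2_closure_test \<Omega> =
     {f \<in> L2_space \<Omega>. \<forall>\<epsilon>>0. \<exists>v\<in>test_functions \<Omega>. L2_norm \<Omega> (\<lambda>z. f z - v z) < \<epsilon>}"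

context
  fixes \<Omega> :: "(real \<times> real) set"
  assumes \<Omega>: "\<Omega> \<in> lmeasurable"
begin

lemma L2_closure_test_closed:
  assumes f: "f \<in> L2_space \<Omega>"
    and ap: "\<And>\<epsilon>. 0 < \<epsilon> \<Longrightarrow> \<exists>g\<in>L2_closure_test \<Omega>. L2_norm \<Omega> (\<lambda>z. f z - g z) < \<epsilon>"
  shows "f \<in> L2_closure_test \<Omega>"
  unfolding L2_closure_test_def
proof (intro CollectI conjI f allI impI)
  fix \<epsilon> :: real assume \<epsilon>: "0 < \<epsilon>"
  then obtain g where g: "g \<in> L2_closure_test \<Omega>" "L2_norm \<Omega> (\<lambda>z. f z - g z) < \<epsilon> / 2"
    using ap[of "\<epsilon> / 2"] by auto
  then obtain v where v: "v \<in> test_functions \<Omega>" "L2_norm \<Omega> (\<lambda>z. g z - v z) < \<epsilon> / 2"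
    using \<epsilon> by (auto simp: L2_closure_test_def dest!: spec[of _ "\<epsilon> / 2"])
  have "L2_norm \<Omega> (\<lambda>z. f z - v z) \<le> L2_norm \<Omega> (\<lambda>z. f z - g z) + L2_norm \<Omega> (\<lambda>z. g z - v z)"
    using L2_norm_triangle[of "\<lambda>z. f z - g z" \<Omega> "\<lambda>z. g z - v z"] f g(1) test_function_L2(1)[OF v(1) \<Omega>]
    by (simp add: L2_diff L2_closure_test_def)
  then show "\<exists>v\<in>test_functions \<Omega>. L2_norm \<Omega> (\<lambda>z. f z - v z) < \<epsilon>"
    using g v by (intro bexI[of _ v]) auto
qed

lemma L2_closure_test_limit:
  assumes "f \<in> L2_space \<Omega>" "\<And>n. g n \<in> L2_closure_test \<Omega>" "L2_tendsto \<Omega> g f sequentially"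
  shows "f \<in> L2_closure_test \<Omega>"
proof (rule L2_closure_test_closed[OF assms(1)])
  fix \<epsilon> :: real assume "0 < \<epsilon>"
  with assms(3) have "\<forall>\<^sub>F n in sequentially. L2_norm \<Omega> (\<lambda>z. g n z - f z) < \<epsilon>"
    unfolding L2_tendsto_def by (rule order_tendstoD)
  then obtain n where "L2_norm \<Omega> (\<lambda>z. g n z - f z) < \<epsilon>"
    by (auto simp: eventually_sequentially)
  then show "\<exists>g\<in>L2_closure_test \<Omega>. L2_norm \<Omega> (\<lambda>z. f z - g z) < \<epsilon>"
    using assms(2) by (intro bexI[of _ "g n"]) (auto simp: L2_norm_minus_commute)
qed

lemma test_functions_subset_closure:
  assumes "v \<in> test_functions \<Omega>" shows "v \<in> L2_closure_test \<Omega>"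
  using assms test_function_L2(1)[OF assms \<Omega>]
  by (auto simp: L2_closure_test_def intro!: bexI[of _ v]) (simp add: L2_norm_def)

lemma L2_closure_test_linear:
  assumes f: "f \<in> L2_closure_test \<Omega>" and g: "g \<in> L2_closure_test \<Omega>"
  shows "(\<lambda>z. a * f z + b * g z) \<in> L2_closure_test \<Omega>"
proof (rule L2_closure_test_closed)
  have L2: "f \<in> L2_space \<Omega>" "g \<in> L2_space \<Omega>" using f g by (auto simp: L2_closure_test_def)
  show "(\<lambda>z. a * f z + b * g z) \<in> L2_space \<Omega>" by (intro L2_add L2_cmult L2)
  fix \<epsilon> :: real assume \<epsilon>: "0 < \<epsilon>"
  \<comment> \<open>The summand 1 covers a = b = 0 and makes the final inequality strict.\<close>
  define d where "d = \<epsilon> / (\<bar>a\<bar> + \<bar>b\<bar> + 1)"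
  have d: "0 < d" using \<epsilon> by (simp add: d_def add_nonneg_pos)
  obtain v where v: "v \<in> test_functions \<Omega>" "L2_norm \<Omega> (\<lambda>z. f z - v z) < d"
    using f d by (auto simp: L2_closure_test_def)
  obtain w where w: "w \<in> test_functions \<Omega>" "L2_norm \<Omega> (\<lambda>z. g z - w z) < d"
    using g d by (auto simp: L2_closure_test_def)
  note vw = test_function_L2(1)[OF v(1) \<Omega>] test_function_L2(1)[OF w(1) \<Omega>]
  have "L2_norm \<Omega> (\<lambda>z. a * (f z - v z) + b * (g z - w z)) \<le>
      \<bar>a\<bar> * L2_norm \<Omega> (\<lambda>z. f z - v z) + \<bar>b\<bar> * L2_norm \<Omega> (\<lambda>z. g z - w z)"
    using L2_norm_triangle[OF L2_cmult[OF L2_diff[OF L2(1) vw(1)], of a] L2_cmult[OF L2_diff[OF L2(2) vw(2)], of b]]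
    by (simp add: L2_norm_cmult)
  also have "\<dots> \<le> \<bar>a\<bar> * d + \<bar>b\<bar> * d"
    using v w by (intro add_mono mult_left_mono) auto
  also have "\<dots> < (\<bar>a\<bar> + \<bar>b\<bar> + 1) * d" using d by (simp add: algebra_simps)
  also have "\<dots> = \<epsilon>" by (simp add: d_def)
  finally have "L2_norm \<Omega> (\<lambda>z. (a * f z + b * g z) - (a * v z + b * w z)) < \<epsilon>"
    by (simp add: algebra_simps)
  then show "\<exists>h\<in>L2_closure_test \<Omega>. L2_norm \<Omega> (\<lambda>z. (a * f z + b * g z) - h z) < \<epsilon>"
    using test_functions_subset_closure[OF test_functions_linear[OF v(1) w(1), of a b]]
    by (intro bexI[of _ "\<lambda>z. a * v z + b * w z"])
qed

lemma L2_closure_test_cong_AE: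
  assumes f: "f \<in> L2_closure_test \<Omega>" and g: "g \<in> borel_measurable (lebesgue_on \<Omega>)"
    and eq: "AE z in lebesgue_on \<Omega>. g z = f z"
  shows "g \<in> L2_closure_test \<Omega>"
proof -
  have fL2: "f \<in> L2_space \<Omega>" using f by (simp add: L2_closure_test_def)
  have "integrable (lebesgue_on \<Omega>) (\<lambda>z. (g z)\<^sup>2) \<longleftrightarrow> integrable (lebesgue_on \<Omega>) (\<lambda>z. (f z)\<^sup>2)"
    using eq by (intro integrable_cong_AE borel_measurable_power g L2_spaceD(1)[OF fL2]) auto
  then have gL2: "g \<in> L2_space \<Omega>" using g fL2 by (simp add: L2_space_def)
  have "L2_norm \<Omega> (\<lambda>z. g z - f z) = L2_norm \<Omega> (\<lambda>z. 0)"
    using eq by (intro L2_norm_cong_AE) (use g L2_spaceD(1)[OF fL2] in auto)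
  then have "L2_norm \<Omega> (\<lambda>z. g z - f z) = 0" by (simp add: L2_norm_def)
  then show ?thesis using f by (intro L2_closure_test_closed[OF gL2] bexI[of _ f]) auto
qed

text \<open>Dynkin's argument: open boxes generate the Borel sets and are stable under intersection.
  The Borel sets with the desired property are closed under complements, by linearity and
  \<open>full\<close>, and under countable disjoint unions, by dominated convergence.\<close>

lemma indicator_in_L2_closure_test:
  assumes boxes: "\<And>a b :: real \<times> real. indicator (box a b \<inter> \<Omega>) \<in> L2_closure_test \<Omega>"
    and full: "indicator \<Omega> \<in> L2_closure_test \<Omega>"
    and A: "A \<in> sets borel"
  shows "indicator (A \<inter> \<Omega>) \<in> L2_closure_test \<Omega>"
proof -
  define G :: "(real \<times> real) set set" where "G = range (\<lambda>(a, b). box a b)"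
  have sb: "sets borel = sigma_sets UNIV G"
    by (simp add: borel_eq_box G_def)
  have AG: "A \<in> sigma_sets UNIV G"
    using A sb by simp
  have G: "Int_stable G"
  proof (rule Int_stableI)
    fix X Y assume "X \<in> G" "Y \<in> G"
    then obtain a b c d where XY: "X = box a b" "Y = box c d" by (auto simp: G_def)
    obtain p q where "X \<inter> Y = box p q" unfolding XY box_Int_box by blast
    then show "X \<inter> Y \<in> G" unfolding G_def by (intro image_eqI[of _ _ "(p, q)"]) auto
  qed
  have \<Omega>m: "(indicator (X \<inter> \<Omega>) :: field) \<in> borel_measurable (lebesgue_on \<Omega>)"
    if "X \<in> sets borel" for X
  proof -
    have "(indicator X :: field) \<in> borel_measurable (lebesgue_on \<Omega>)"
      using that by (intro borel_measurable_lebesgue_onI) simp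
    then show ?thesis
      by (rule measurable_cong[THEN iffD1, rotated]) (auto simp: indicator_def)
  qed
  have "G \<subseteq> Pow UNIV" by simp
  from G this AG show ?thesis
  proof (induction rule: sigma_sets_induct_disjoint)
    case (basic A)
    then show ?case using boxes by (auto simp: G_def)
  next
    case empty
    show ?case using test_functions_subset_closure[OF zero_test_function] by (simp add: indicator_def[abs_def])
  next
    case (compl A)
    have "(\<lambda>z. 1 * indicator \<Omega> z + (- 1) * indicator (A \<inter> \<Omega>) z) \<in> L2_closure_test \<Omega>"
      by (intro L2_closure_test_linear full compl)
    also have "(\<lambda>z. 1 * indicator \<Omega> z + (- 1) * indicator (A \<inter> \<Omega>) z) = (indicator ((UNIV - A) \<inter> \<Omega>) :: field)"
      by (auto simp: fun_eq_iff indicator_def)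
    finally show ?case .
  next
    case (union A)
    have sum: "(\<lambda>z. \<Sum>i<n. indicator (A i \<inter> \<Omega>) z) \<in> L2_closure_test \<Omega>" for n :: nat
    proof (induction n)
      case 0
      then show ?case using test_functions_subset_closure[OF zero_test_function] by simp
    next
      case (Suc n)
      from L2_closure_test_linear[OF this union(3)[of n], of 1 1] show ?case by simp
    qed
    have eq: "(\<lambda>z. \<Sum>i<n. indicator (A i \<inter> \<Omega>) z) = (indicator ((\<Union>i<n. A i) \<inter> \<Omega>) :: field)" for n
    proof -
      have "disjoint_family_on (\<lambda>i. A i \<inter> \<Omega>) {..<n}"
        using union(1) by (auto simp: disjoint_family_on_def)
      moreover have "(\<Union>i<n. A i) \<inter> \<Omega> = (\<Union>i<n. A i \<inter> \<Omega>)" by auto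
      ultimately show ?thesis
        by (simp only: fun_eq_iff indicator_UN_disjoint[OF finite_lessThan]) simp
    qed
    have A: "A i \<in> sets borel" for i
      using union(2) by (auto simp: sb)
    then have UN: "(\<Union>i. A i) \<in> sets borel" "(\<Union>i<n. A i) \<in> sets borel" for n
      by auto
    show ?case
    proof (rule L2_closure_test_limit)
      show "indicator ((\<Union>i. A i) \<inter> \<Omega>) \<in> L2_space \<Omega>"
        by (rule bounded_L2[where B = 1, OF \<Omega>m[OF UN(1)] _ \<Omega>]) (simp add: indicator_def)
      show "(indicator ((\<Union>i<n. A i) \<inter> \<Omega>) :: field) \<in> L2_closure_test \<Omega>" for n
        using sum[of n] unfolding eq .
      show "L2_tendsto \<Omega> (\<lambda>n::nat. indicator ((\<Union>i<n. A i) \<inter> \<Omega>)) (indicator ((\<Union>i. A i) \<inter> \<Omega>)) sequentially"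
      proof (rule L2_tendsto_dominated)
        show "(\<lambda>_. 1) \<in> L2_space \<Omega>" by (intro bounded_L2[where B = 1] \<Omega>) auto
        show "(\<lambda>n. indicator ((\<Union>i<n. A i) \<inter> \<Omega>) z :: real) \<longlonglongrightarrow> indicator ((\<Union>i. A i) \<inter> \<Omega>) z"
          if "z \<in> \<Omega>" for z
          using LIMSEQ_indicator_UN[of A z] that by (simp add: indicator_def)
        show "(indicator ((\<Union>i<n. A i) \<inter> \<Omega>) :: field) \<in> borel_measurable (lebesgue_on \<Omega>)" for n
          by (rule \<Omega>m[OF UN(2)])
        show "(indicator ((\<Union>i. A i) \<inter> \<Omega>) :: field) \<in> borel_measurable (lebesgue_on \<Omega>)"
          by (rule \<Omega>m[OF UN(1)])
      qed (auto simp: indicator_def)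
    qed
  qed
qed

text \<open>Square integrability is carried as a premise through the monotone class induction:
  summands and approximants inherit it because they are nonnegative and dominated by the resulting
  function.\<close>

lemma nonneg_in_L2_closure_test:
  fixes u :: field
  assumes ind: "\<And>A. A \<in> sets borel \<Longrightarrow> indicator A \<in> L2_closure_test \<Omega>"
    and u: "u \<in> borel_measurable borel" "\<And>z. 0 \<le> u z" "u \<in> L2_space \<Omega>"
  shows "u \<in> L2_closure_test \<Omega>"
  using u
proof (induction rule: borel_measurable_induct_real)
  case (set A)
  then show ?case using ind by simp
next
  case (mult u c)
  show ?case
  \<comment> \<open>For c = 0 square integrability of the product says nothing about u, so the
    induction hypothesis cannot be invoked; the product is then the zero function.\<close>
  proof (cases "c = 0")
    case True
    then show ?thesis using test_functions_subset_closure[OF zero_test_function] by simp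
  next
    case False
    then have "u \<in> L2_space \<Omega>" using L2_cmult[OF mult.prems, of "1 / c"] by simp
    then have "(\<lambda>z. c * u z + 0 * u z) \<in> L2_closure_test \<Omega>"
      by (intro L2_closure_test_linear mult.IH)
    then show ?thesis by simp
  qed
next
  case (add u v)
  have m: "u \<in> borel_measurable (lebesgue_on \<Omega>)" "v \<in> borel_measurable (lebesgue_on \<Omega>)"
    using add.hyps by (auto intro: borel_measurable_lebesgue_onI)
  have "u \<in> L2_space \<Omega>" "v \<in> L2_space \<Omega>"
    using add.hyps by (auto intro!: L2_dominated[OF m(1) add.prems] L2_dominated[OF m(2) add.prems])
  then have "(\<lambda>z. 1 * v z + 1 * u z) \<in> L2_closure_test \<Omega>"
    by (intro L2_closure_test_linear add.IH)
  then show ?case by simp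
next
  case (seq U)
  have le: "U i z \<le> u z" for i z
  proof (rule incseq_le[where X = "\<lambda>i. U i z"])
    show "incseq (\<lambda>i. U i z)" using seq.hyps(3) by (simp add: incseq_def le_fun_def del: split_paired_All)
    show "(\<lambda>i. U i z) \<longlonglongrightarrow> u z" using seq.hyps(4)[of z] by simp
  qed
  have m: "U i \<in> borel_measurable (lebesgue_on \<Omega>)" for i
    using seq.hyps by (auto intro: borel_measurable_lebesgue_onI)
  have U0: "0 \<le> U i z" for i z using seq by simp
  have "U i \<in> L2_space \<Omega>" for i
    using le[of i] U0[of i] by (intro L2_dominated[OF m seq.prems]) (metis abs_ge_self abs_of_nonneg order_trans)
  then have "U i \<in> L2_closure_test \<Omega>" for i by (rule seq.IH)
  then show ?case
  proof (rule L2_closure_test_limit[OF seq.prems])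
    show "L2_tendsto \<Omega> U u sequentially"
    proof (rule L2_tendsto_dominated[OF m _ seq.prems])
      show "\<bar>U n z - u z\<bar> \<le> \<bar>u z\<bar>" for n z
        using le[of n z] U0[of n z] by simp
    qed (use seq L2_spaceD(1)[OF seq.prems] in auto)
  qed
qed

lemma L2_subset_closure_test:
  assumes boxes: "\<And>a b :: real \<times> real. indicator (box a b \<inter> \<Omega>) \<in> L2_closure_test \<Omega>"
    and full: "indicator \<Omega> \<in> L2_closure_test \<Omega>"
    and f: "f \<in> L2_space \<Omega>"
  shows "f \<in> L2_closure_test \<Omega>"
proof -
  have \<Omega>s: "\<Omega> \<inter> space lebesgue \<in> sets lebesgue" using \<Omega> by auto
  have ind: "indicator A \<in> L2_closure_test \<Omega>" if "A \<in> sets borel" for A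
  proof (rule L2_closure_test_cong_AE[OF indicator_in_L2_closure_test[OF boxes full that]])
    show "(indicator A :: field) \<in> borel_measurable (lebesgue_on \<Omega>)"
      using that by (intro borel_measurable_lebesgue_onI) simp
    show "AE z in lebesgue_on \<Omega>. indicator A z = indicator (A \<inter> \<Omega>) z"
      by (intro AE_I2) (auto simp: indicator_def)
  qed
  have "(\<lambda>z. indicator \<Omega> z *\<^sub>R f z) \<in> borel_measurable lebesgue"
    using L2_spaceD(1)[OF f] borel_measurable_restrict_space_iff[OF \<Omega>s, of f] by simp
  \<comment> \<open>\<open>f\<close> is merely Lebesgue measurable while the induction above is
    about Borel functions, hence the passage to a Borel function that agrees with \<open>f\<close>
    almost everywhere.\<close>
  from completion_ex_borel_measurable_real[OF this]
  obtain g where g: "g \<in> borel_measurable lborel" "AE z in lborel. indicator \<Omega> z *\<^sub>R f z = g z"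
    by auto
  have gm: "g \<in> borel_measurable borel" using g(1) by simp
  have "AE z in lebesgue. indicator \<Omega> z *\<^sub>R f z = g z"
    using g(2) by (rule AE_completion)
  then have fg: "AE z in lebesgue_on \<Omega>. f z = g z"
    unfolding AE_restrict_space_iff[OF \<Omega>s] by (auto elim!: eventually_mono)
  have gm': "g \<in> borel_measurable (lebesgue_on \<Omega>)" using gm by (rule borel_measurable_lebesgue_onI)
  have "integrable (lebesgue_on \<Omega>) (\<lambda>z. (g z)\<^sup>2) \<longleftrightarrow> integrable (lebesgue_on \<Omega>) (\<lambda>z. (f z)\<^sup>2)"
    using fg by (intro integrable_cong_AE borel_measurable_power gm' L2_spaceD(1)[OF f]) auto
  then have gL2: "g \<in> L2_space \<Omega>" using gm' f by (simp add: L2_space_def)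
  have pos: "(\<lambda>z. max 0 (g z)) \<in> L2_closure_test \<Omega>" "(\<lambda>z. max 0 (- g z)) \<in> L2_closure_test \<Omega>"
    using gm gm' by (auto intro!: nonneg_in_L2_closure_test ind L2_dominated[OF _ gL2])
  have "(\<lambda>z. 1 * max 0 (g z) + (- 1) * max 0 (- g z)) \<in> L2_closure_test \<Omega>"
    by (intro L2_closure_test_linear pos)
  also have "(\<lambda>z. 1 * max 0 (g z) + (- 1) * max 0 (- g z)) = g"
    by (auto simp: fun_eq_iff max_def)
  finally show ?thesis using L2_spaceD(1)[OF f] fg by (rule L2_closure_test_cong_AE)
qed

end

text \<open>Products of bumps converge to the indicator pointwise and take values in [0, 1], so the
  constant 1 dominates the error on a set of finite measure.\<close>

lemma rectangle_indicator_in_L2_closure_test: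
  assumes "{a<..<b} \<times> {c<..<d} \<subseteq> rectangle L1 L2"
  shows "indicator ({a<..<b} \<times> {c<..<d}) \<in> L2_closure_test (rectangle L1 L2)" (is "?f \<in> L2_closure_test ?\<Omega>")
proof -
  have m: "?f \<in> borel_measurable (lebesgue_on ?\<Omega>)"
    by (intro borel_measurable_lebesgue_onI borel_measurable_indicator borel_open open_Times) auto
  have test: "(\<lambda>z. bump n a b (fst z) * bump n c d (snd z)) \<in> test_functions ?\<Omega>" for n
    by (rule bump_box_test_function[OF assms])
  show ?thesis
  proof (rule L2_closure_test_limit[OF rectangle_lmeasurable])
    show "?f \<in> L2_space ?\<Omega>"
      by (rule bounded_L2[OF m _ rectangle_lmeasurable, of 1]) (auto simp: indicator_def)
    show "(\<lambda>z. bump n a b (fst z) * bump n c d (snd z)) \<in> L2_closure_test ?\<Omega>" for n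
      by (rule test_functions_subset_closure[OF rectangle_lmeasurable test])
    show "L2_tendsto ?\<Omega> (\<lambda>n z. bump n a b (fst z) * bump n c d (snd z)) ?f sequentially"
    proof (rule L2_tendsto_dominated)
      show "(\<lambda>z. bump n a b (fst z) * bump n c d (snd z)) \<in> borel_measurable (lebesgue_on ?\<Omega>)" for n
        by (rule L2_spaceD(1)[OF test_function_L2(1)[OF test rectangle_lmeasurable]])
      show "(\<lambda>_. 1) \<in> L2_space ?\<Omega>"
        by (intro bounded_L2[where B = 1] rectangle_lmeasurable) auto
      fix z :: "real \<times> real"
      have "?f z = indicator {a<..<b} (fst z) * indicator {c<..<d} (snd z)"
        by (auto simp: indicator_def mem_Times_iff)
      then show "(\<lambda>n. bump n a b (fst z) * bump n c d (snd z)) \<longlonglongrightarrow> ?f z"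
        by (simp add: tendsto_mult bump_tendsto_indicator)
      have "0 \<le> bump n a b (fst z) * bump n c d (snd z)" "bump n a b (fst z) * bump n c d (snd z) \<le> 1" for n
        using bump_bounds by (auto intro!: mult_le_one)
      then show "\<bar>bump n a b (fst z) * bump n c d (snd z) - ?f z\<bar> \<le> \<bar>1\<bar>" for n
        by (auto simp: indicator_def)
    qed (rule m)
  qed
qed

theorem test_functions_dense:
  assumes "f \<in> L2_space (rectangle L1 L2)"
  obtains v where "\<And>n. v n \<in> test_functions (rectangle L1 L2)"
    "L2_tendsto (rectangle L1 L2) v f sequentially"
proof -
  let ?\<Omega> = "rectangle L1 L2"
  have "f \<in> L2_closure_test ?\<Omega>"
  proof (rule L2_subset_closure_test[OF rectangle_lmeasurable _ _ assms])
    fix p q :: "real \<times> real"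
    obtain a c b d where pq: "p = (a, c)" "q = (b, d)" by (cases p, cases q) auto
    have "box p q \<inter> ?\<Omega> = {max a 0<..<min b L1} \<times> {max c 0<..<min d L2}"
      by (auto simp: pq rectangle_def box_def Basis_prod_def)
    then show "indicator (box p q \<inter> ?\<Omega>) \<in> L2_closure_test ?\<Omega>"
      using rectangle_indicator_in_L2_closure_test[of "max a 0" "min b L1" "max c 0" "min d L2" L1 L2]
      by (auto simp: rectangle_def)
  next
    show "indicator ?\<Omega> \<in> L2_closure_test ?\<Omega>"
      using rectangle_indicator_in_L2_closure_test[of 0 L1 0 L2 L1 L2] by (simp add: rectangle_def)
  qed
  then have "\<exists>v\<in>test_functions ?\<Omega>. L2_norm ?\<Omega> (\<lambda>z. f z - v z) < inverse (real (Suc n))" for n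
    by (simp add: L2_closure_test_def del: of_nat_Suc)
  then obtain v where v: "\<And>n. v n \<in> test_functions ?\<Omega>"
    "\<And>n. L2_norm ?\<Omega> (\<lambda>z. f z - v n z) < inverse (real (Suc n))"
    by metis
  have "L2_tendsto ?\<Omega> v f sequentially"
    unfolding L2_tendsto_def
  proof (rule Lim_null_comparison[OF always_eventually LIMSEQ_inverse_real_of_nat])
    show "\<forall>n. norm (L2_norm ?\<Omega> (\<lambda>z. v n z - f z)) \<le> inverse (real (Suc n))"
      using v(2) by (auto simp: L2_norm_minus_commute[of _ _ f] less_imp_le)
  qed
  with v(1) show ?thesis by (rule that)
qed

section \<open>Integration by parts and weak derivatives\<close>

lemma integral_compact_support_derivative:
  fixes F f :: "real \<Rightarrow> real"
  assumes "\<And>x. (F has_real_derivative f x) (at x)" "continuous_on UNIV f"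
    and zero: "\<And>x. R < \<bar>x\<bar> \<Longrightarrow> F x = 0 \<and> f x = 0" and "0 \<le> R"
  shows "(LINT x|lborel. f x) = 0"
proof -
  \<comment> \<open>The end points are moved to distance R + 1 because vanishing is assumed only
    strictly beyond R.\<close>
  have "(LINT x|lborel. f x * indicator {-(R + 1)..R + 1} x) = F (R + 1) - F (-(R + 1))"
    using assms by (intro integral_FTC_Icc_real) (auto simp: continuous_on_eq_continuous_at)
  also have "(\<lambda>x. f x * indicator {-(R + 1)..R + 1} x) = f"
  proof
    show "f x * indicator {-(R + 1)..R + 1} x = f x" for x
      using zero[of x] by (cases "R < \<bar>x\<bar>") (auto simp: indicator_def)
  qed
  also have "F (R + 1) - F (-(R + 1)) = 0"
    using zero[of "R + 1"] zero[of "-(R + 1)"] \<open>0 \<le> R\<close> by simp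
  finally show ?thesis .
qed

lemma compact_support_radius:
  fixes K :: "(real \<times> real) set"
  assumes "compact K"
  obtains R where "0 \<le> R" "\<And>x y. R < \<bar>x\<bar> \<Longrightarrow> (x, y) \<notin> K" "\<And>x y. R < \<bar>y\<bar> \<Longrightarrow> (x, y) \<notin> K"
proof -
  obtain B where B: "\<And>z. z \<in> K \<Longrightarrow> norm z \<le> B"
    using compact_imp_bounded[OF assms] by (auto simp: bounded_iff)
  have "\<bar>x\<bar> \<le> norm (x, y)" "\<bar>y\<bar> \<le> norm (x, y)" for x y :: real
    using norm_fst_le[of x y] norm_snd_le[of y x] by (simp_all add: norm_Pair)
  with B show ?thesis
    by (intro that[of "max B 0"]) (force simp: not_le[symmetric] dest: order_trans)+
qed

lemma integrable_continuous_compact_support: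
  fixes f :: field
  assumes "continuous_on UNIV f" "compact K" "\<And>z. z \<notin> K \<Longrightarrow> f z = 0"
  shows "integrable lborel f"
proof -
  have "integrable lborel (\<lambda>z. indicator K z *\<^sub>R f z)"
    using assms(1) by (intro borel_integrable_compact[OF assms(2)]) (auto intro: continuous_on_subset)
  also have "(\<lambda>z. indicator K z *\<^sub>R f z) = f"
    using assms(3) by (auto simp: fun_eq_iff indicator_def)
  finally show ?thesis .
qed

text \<open>Fubini's theorem, integrating first in the direction of the derivative, reduces this to
  the fundamental theorem of calculus on lines, where the primitive vanishes far out.\<close>

lemma integral_partial_derivative_zero:
  assumes f: "\<And>z. f differentiable (at z)" and K: "compact K" "\<And>z. z \<notin> K \<Longrightarrow> f z = 0"
  shows "\<lbrakk>continuous_on UNIV (px f); \<And>z. z \<notin> K \<Longrightarrow> px f z = 0\<rbrakk> \<Longrightarrow> (LINT z|lborel. px f z) = 0"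
    and "\<lbrakk>continuous_on UNIV (py f); \<And>z. z \<notin> K \<Longrightarrow> py f z = 0\<rbrakk> \<Longrightarrow> (LINT z|lborel. py f z) = 0"
proof -
  obtain R where R: "0 \<le> R" "\<And>x y. R < \<bar>x\<bar> \<Longrightarrow> (x, y) \<notin> K" "\<And>x y. R < \<bar>y\<bar> \<Longrightarrow> (x, y) \<notin> K"
    using compact_support_radius[OF K(1)] by blast
  {
    assume c: "continuous_on UNIV (px f)" and z: "\<And>z. z \<notin> K \<Longrightarrow> px f z = 0"
    have int: "integrable (lborel \<Otimes>\<^sub>M lborel) (\<lambda>(x, y). px f (x, y))"
      using integrable_continuous_compact_support[OF c K(1) z] by (simp add: lborel_prod)
    have "(LINT x|lborel. px f (x, y)) = 0" for y
    proof (rule integral_compact_support_derivative)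
      show "((\<lambda>x. f (x, y)) has_real_derivative px f (x, y)) (at x)" for x
        by (rule px_has_real_derivative[OF f])
      show "continuous_on UNIV (\<lambda>x. px f (x, y))"
        by (rule continuous_on_compose2[OF c]) (auto intro!: continuous_intros)
      show "R < \<bar>x\<bar> \<Longrightarrow> f (x, y) = 0 \<and> px f (x, y) = 0" for x using R K z by blast
    qed (rule R)
    with lborel_pair.integral_snd[OF int] show "(LINT z|lborel. px f z) = 0"
      by (simp add: lborel_prod)
  next
    assume c: "continuous_on UNIV (py f)" and z: "\<And>z. z \<notin> K \<Longrightarrow> py f z = 0"
    have int: "integrable (lborel \<Otimes>\<^sub>M lborel) (\<lambda>(x, y). py f (x, y))"
      using integrable_continuous_compact_support[OF c K(1) z] by (simp add: lborel_prod)
    have "(LINT y|lborel. py f (x, y)) = 0" for x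
    proof (rule integral_compact_support_derivative)
      show "((\<lambda>y. f (x, y)) has_real_derivative py f (x, y)) (at y)" for y
        by (rule py_has_real_derivative[OF f])
      show "continuous_on UNIV (\<lambda>y. py f (x, y))"
        by (rule continuous_on_compose2[OF c]) (auto intro!: continuous_intros)
      show "R < \<bar>y\<bar> \<Longrightarrow> f (x, y) = 0 \<and> py f (x, y) = 0" for y using R K z by blast
    qed (rule R)
    with lborel_pair.integral_fst'[OF int] show "(LINT z|lborel. py f z) = 0"
      by (simp add: lborel_prod)
  }
qed

lemma integral_lebesgue_on_support:
  fixes f :: field
  assumes "continuous_on UNIV f" "\<And>z. z \<notin> \<Omega> \<Longrightarrow> f z = 0" "\<Omega> \<in> lmeasurable"
  shows "(LINT z|lebesgue_on \<Omega>. f z) = (LINT z|lborel. f z)"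
proof -
  have "(LINT z|lebesgue_on \<Omega>. f z) = (LINT z|lebesgue. indicator \<Omega> z *\<^sub>R f z)"
    using assms(3) by (intro integral_restrict_space) auto
  also have "(\<lambda>z. indicator \<Omega> z *\<^sub>R f z) = f"
    using assms(2) by (auto simp: fun_eq_iff indicator_def)
  also have "(LINT z|lebesgue. f z) = (LINT z|lborel. f z)"
    using borel_measurable_continuous_onI[OF assms(1)] by (intro integral_completion) simp
  finally show ?thesis .
qed

text \<open>The product a b has its support inside that of a, hence inside the domain. So integrals
  over the domain are integrals over the plane, and the derivative of the product integrates to 0
  without boundary terms.\<close>

lemma L2_integration_by_parts:
  assumes a: "a \<in> test_functions \<Omega>" and b: "b \<in> test_functions \<Omega>" and \<Omega>: "\<Omega> \<in> lmeasurable"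
  shows "L2_inner \<Omega> (px a) b = - L2_inner \<Omega> a (px b)"
    and "L2_inner \<Omega> (py a) b = - L2_inner \<Omega> a (py b)"
proof -
  define f where "f z = a z * b z" for z
  define K where "K = closure {z. a z \<noteq> 0}"
  have K: "compact K" "K \<subseteq> \<Omega>" using a by (auto simp: K_def test_functions_def)
  note ab = test_functionD[OF a] test_functionD[OF b]
  note z = px_py_zero_outside_support[of _ a, folded K_def]
  have df: "f differentiable (at p)" for p
    unfolding f_def by (intro differentiable_mult ab)
  have px: "px f = (\<lambda>z. px a z * b z + px b z * a z)"
    unfolding f_def by (rule px_eqI) (intro DERIV_mult px_has_real_derivative ab)
  have py: "py f = (\<lambda>z. py a z * b z + py b z * a z)"
    unfolding f_def by (rule py_eqI) (intro DERIV_mult py_has_real_derivative ab)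
  have cont: "continuous_on UNIV (px f)" "continuous_on UNIV (py f)"
    unfolding px py by (intro continuous_intros Ck_imp_continuous[of 0] ab)+
  have zero: "f p = 0" "px f p = 0" "py f p = 0" if "p \<notin> K" for p
    using z[OF that] by (simp_all add: px py f_def)
  have zero_\<Omega>: "px f p = 0" "py f p = 0" if "p \<notin> \<Omega>" for p
    using zero[of p] K(2) that by blast+
  have "(LINT z|lebesgue_on \<Omega>. px f z) = 0" "(LINT z|lebesgue_on \<Omega>. py f z) = 0"
    using integral_lebesgue_on_support[OF cont(1) zero_\<Omega>(1) \<Omega>]
      integral_lebesgue_on_support[OF cont(2) zero_\<Omega>(2) \<Omega>]
      integral_partial_derivative_zero[OF df K(1) zero(1)] cont zero by simp_all
  moreover note L2 = test_function_L2[OF a \<Omega>] test_function_L2[OF b \<Omega>]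
  ultimately show "L2_inner \<Omega> (px a) b = - L2_inner \<Omega> a (px b)"
    "L2_inner \<Omega> (py a) b = - L2_inner \<Omega> a (py b)"
    using L2_mult_integrable[OF L2(2,4)] L2_mult_integrable[OF L2(5,1)]
      L2_mult_integrable[OF L2(3,4)] L2_mult_integrable[OF L2(6,1)]
    by (simp_all add: px py L2_inner_def mult.commute[of "a _"])
qed

text \<open>The second difference over a square can be read as an x-increment of y-increments or the
  other way round. Two applications of the mean value theorem in either order produce the two mixed
  derivatives.\<close>

lemma mixed_difference_mean_value:
  assumes f: "\<And>z. f differentiable (at z)" "\<And>z. px f differentiable (at z)" "\<And>z. py f differentiable (at z)"
    and h: "0 < h"
  shows "\<exists>\<xi> \<eta>. x < \<xi> \<and> \<xi> < x + h \<and> y < \<eta> \<and> \<eta> < y + h \<and>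
      f (x + h, y + h) - f (x + h, y) - f (x, y + h) + f (x, y) = h * h * py (px f) (\<xi>, \<eta>)"
    and "\<exists>\<xi> \<eta>. x < \<xi> \<and> \<xi> < x + h \<and> y < \<eta> \<and> \<eta> < y + h \<and>
      f (x + h, y + h) - f (x + h, y) - f (x, y + h) + f (x, y) = h * h * px (py f) (\<xi>, \<eta>)"
proof -
  have "\<exists>\<xi>. x < \<xi> \<and> \<xi> < x + h \<and>
      (f (x + h, y + h) - f (x + h, y)) - (f (x, y + h) - f (x, y)) = (x + h - x) * (px f (\<xi>, y + h) - px f (\<xi>, y))"
    using h by (intro MVT2 DERIV_diff px_has_real_derivative f) auto
  then obtain \<xi> where \<xi>: "x < \<xi>" "\<xi> < x + h"
    "(f (x + h, y + h) - f (x + h, y)) - (f (x, y + h) - f (x, y)) = h * (px f (\<xi>, y + h) - px f (\<xi>, y))"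
    by auto
  have "\<exists>\<eta>. y < \<eta> \<and> \<eta> < y + h \<and> px f (\<xi>, y + h) - px f (\<xi>, y) = (y + h - y) * py (px f) (\<xi>, \<eta>)"
    using h by (intro MVT2 py_has_real_derivative f) auto
  then obtain \<eta> where "y < \<eta>" "\<eta> < y + h" "px f (\<xi>, y + h) - px f (\<xi>, y) = h * py (px f) (\<xi>, \<eta>)"
    by auto
  with \<xi> show "\<exists>\<xi> \<eta>. x < \<xi> \<and> \<xi> < x + h \<and> y < \<eta> \<and> \<eta> < y + h \<and>
      f (x + h, y + h) - f (x + h, y) - f (x, y + h) + f (x, y) = h * h * py (px f) (\<xi>, \<eta>)"
    by (intro exI[of _ \<xi>] exI[of _ \<eta>]) simp
  have "\<exists>\<eta>. y < \<eta> \<and> \<eta> < y + h \<and>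
      (f (x + h, y + h) - f (x, y + h)) - (f (x + h, y) - f (x, y)) = (y + h - y) * (py f (x + h, \<eta>) - py f (x, \<eta>))"
    using h by (intro MVT2 DERIV_diff py_has_real_derivative f) auto
  then obtain \<eta> where \<eta>: "y < \<eta>" "\<eta> < y + h"
    "(f (x + h, y + h) - f (x, y + h)) - (f (x + h, y) - f (x, y)) = h * (py f (x + h, \<eta>) - py f (x, \<eta>))"
    by auto
  have "\<exists>\<xi>. x < \<xi> \<and> \<xi> < x + h \<and> py f (x + h, \<eta>) - py f (x, \<eta>) = (x + h - x) * px (py f) (\<xi>, \<eta>)"
    using h by (intro MVT2 px_has_real_derivative f) auto
  then obtain \<xi> where "x < \<xi>" "\<xi> < x + h" "py f (x + h, \<eta>) - py f (x, \<eta>) = h * px (py f) (\<xi>, \<eta>)"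
    by auto
  with \<eta> show "\<exists>\<xi> \<eta>. x < \<xi> \<and> \<xi> < x + h \<and> y < \<eta> \<and> \<eta> < y + h \<and>
      f (x + h, y + h) - f (x + h, y) - f (x, y + h) + f (x, y) = h * h * px (py f) (\<xi>, \<eta>)"
    by (intro exI[of _ \<xi>] exI[of _ \<eta>]) simp
qed

text \<open>Schwarz's theorem: on shrinking squares both mixed derivatives take a common value at
  suitable points, and continuity moves this equality to the corner.\<close>

lemma px_py_commute:
  assumes "Ck 2 f"
  shows "px (py f) = py (px f)"
proof
  fix z :: "real \<times> real"
  obtain x y where z: "z = (x, y)" by (cases z)
  have f: "\<And>z. f differentiable (at z)" "\<And>z. px f differentiable (at z)" "\<And>z. py f differentiable (at z)"
    "continuous_on UNIV (px (py f))" "continuous_on UNIV (py (px f))"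
    using assms by (auto simp: numeral_2_eq_2)
  define h where "h n = inverse (real (Suc n))" for n
  have h: "0 < h n" for n by (simp add: h_def)
  have "\<forall>n. \<exists>\<xi> \<eta> \<xi>' \<eta>'. x < \<xi> \<and> \<xi> < x + h n \<and> y < \<eta> \<and> \<eta> < y + h n \<and>
      x < \<xi>' \<and> \<xi>' < x + h n \<and> y < \<eta>' \<and> \<eta>' < y + h n \<and> px (py f) (\<xi>, \<eta>) = py (px f) (\<xi>', \<eta>')"
  proof
    fix n
    obtain \<xi> \<eta> \<xi>' \<eta>' where "x < \<xi>" "\<xi> < x + h n" "y < \<eta>" "\<eta> < y + h n"
      "x < \<xi>'" "\<xi>' < x + h n" "y < \<eta>'" "\<eta>' < y + h n"
      "h n * h n * px (py f) (\<xi>, \<eta>) = h n * h n * py (px f) (\<xi>', \<eta>')"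
      using mixed_difference_mean_value[OF f(1-3) h, of x n y] by metis
    then show "\<exists>\<xi> \<eta> \<xi>' \<eta>'. x < \<xi> \<and> \<xi> < x + h n \<and> y < \<eta> \<and> \<eta> < y + h n \<and>
      x < \<xi>' \<and> \<xi>' < x + h n \<and> y < \<eta>' \<and> \<eta>' < y + h n \<and> px (py f) (\<xi>, \<eta>) = py (px f) (\<xi>', \<eta>')"
      using h[of n] by (intro exI[of _ \<xi>] exI[of _ \<eta>] exI[of _ \<xi>'] exI[of _ \<eta>']) simp
  qed
  then obtain \<xi> \<eta> \<xi>' \<eta>' where seq: "\<And>n. x < \<xi> n" "\<And>n. \<xi> n < x + h n" "\<And>n. y < \<eta> n" "\<And>n. \<eta> n < y + h n"
      "\<And>n. x < \<xi>' n" "\<And>n. \<xi>' n < x + h n" "\<And>n. y < \<eta>' n" "\<And>n. \<eta>' n < y + h n"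
      "\<And>n. px (py f) (\<xi> n, \<eta> n) = py (px f) (\<xi>' n, \<eta>' n)"
    by metis
  have h0: "h \<longlonglongrightarrow> 0" unfolding h_def by (rule LIMSEQ_inverse_real_of_nat)
  have sandwich: "s \<longlonglongrightarrow> a" if "\<And>n. a < s n" "\<And>n. s n < a + h n" for s :: "nat \<Rightarrow> real" and a
  proof (rule tendsto_sandwich[of "\<lambda>_. a" _ _ "\<lambda>n. a + h n"])
    show "(\<lambda>n. a + h n) \<longlonglongrightarrow> a" using tendsto_add[OF tendsto_const h0, of a] by simp
  qed (use that in \<open>auto intro!: always_eventually less_imp_le\<close>)
  have "(\<lambda>n. px (py f) (\<xi> n, \<eta> n)) \<longlonglongrightarrow> px (py f) (x, y)"
    by (intro continuous_on_tendsto_compose[OF f(4)] tendsto_Pair sandwich seq) auto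
  moreover have "(\<lambda>n. py (px f) (\<xi>' n, \<eta>' n)) \<longlonglongrightarrow> py (px f) (x, y)"
    by (intro continuous_on_tendsto_compose[OF f(5)] tendsto_Pair sandwich seq) auto
  ultimately show "px (py f) z = py (px f) z"
    unfolding seq z by (rule LIMSEQ_unique)
qed

lemma test_function_partial:
  assumes "v \<in> test_functions \<Omega>"
  shows "px v \<in> test_functions \<Omega>" "py v \<in> test_functions \<Omega>"
proof -
  have K: "compact (closure {z. v z \<noteq> 0})" "closure {z. v z \<noteq> 0} \<subseteq> \<Omega>"
    using assms by (auto simp: test_functions_def)
  show "px v \<in> test_functions \<Omega>"
    by (rule test_functions_I[OF test_functionD(3)[OF assms] K px_py_zero_outside_support(2)])
  show "py v \<in> test_functions \<Omega>"
    by (rule test_functions_I[OF test_functionD(4)[OF assms] K px_py_zero_outside_support(3)])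
qed

text \<open>Moving both derivatives onto b gives - (a, \<open>px (py b)\<close>) on one side and -
  (a, \<open>py (px b)\<close>) on the other.\<close>

lemma test_function_cross_identity:
  assumes a: "a \<in> test_functions \<Omega>" and b: "b \<in> test_functions \<Omega>" and \<Omega>: "\<Omega> \<in> lmeasurable"
  shows "L2_inner \<Omega> (px a) (py b) = L2_inner \<Omega> (py a) (px b)"
  using L2_integration_by_parts(1)[OF a test_function_partial(2)[OF b] \<Omega>]
    L2_integration_by_parts(2)[OF a test_function_partial(1)[OF b] \<Omega>]
    px_py_commute[OF test_functionD(1)[OF b]]
  by simp

lemma weak_px_test_function:
  "\<lbrakk>v \<in> test_functions \<Omega>; \<Omega> \<in> lmeasurable\<rbrakk> \<Longrightarrow> weak_px \<Omega> v (px v)"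
  using L2_integration_by_parts(1)[of v \<Omega>] by (simp add: weak_px_def L2_inner_def)

lemma weak_py_test_function:
  "\<lbrakk>v \<in> test_functions \<Omega>; \<Omega> \<in> lmeasurable\<rbrakk> \<Longrightarrow> weak_py \<Omega> v (py v)"
  using L2_integration_by_parts(2)[of v \<Omega>] by (simp add: weak_py_def L2_inner_def)

text \<open>The fundamental lemma of the calculus of variations: along test functions tending to f
  in L2, the vanishing inner products tend to (f, f).\<close>

lemma orthogonal_test_functions_imp_zero:
  assumes f: "f \<in> L2_space (rectangle L1 L2)"
    and orth: "\<And>v. v \<in> test_functions (rectangle L1 L2) \<Longrightarrow> L2_inner (rectangle L1 L2) f v = 0"
  shows "L2_norm (rectangle L1 L2) f = 0"
proof -
  let ?\<Omega> = "rectangle L1 L2"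
  obtain v where v: "\<And>n. v n \<in> test_functions ?\<Omega>" "L2_tendsto ?\<Omega> v f sequentially"
    using test_functions_dense[OF f] by blast
  have "(\<lambda>n. L2_inner ?\<Omega> f (v n)) \<longlonglongrightarrow> L2_inner ?\<Omega> f f"
    by (rule L2_inner_tendsto[OF L2_tendsto_const v(2)])
      (use f test_function_L2(1)[OF v(1) rectangle_lmeasurable] in auto)
  then have "L2_inner ?\<Omega> f f = 0"
    using orth[OF v(1)] by (simp add: LIMSEQ_const_iff)
  then show ?thesis by (metis L2_norm_square power_eq_0_iff)
qed

section \<open>Weak derivatives and the Sobolev spaces on the rectangle\<close>

context
  fixes L1 L2 :: real and \<Omega> :: "(real \<times> real) set"
  assumes \<Omega>: "\<Omega> = rectangle L1 L2"
begin

lemma \<Omega>_lmeasurable: "\<Omega> \<in> lmeasurable"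
  by (simp add: \<Omega> rectangle_lmeasurable)

lemma weak_px_unique:
  assumes "weak_px \<Omega> u g" "weak_px \<Omega> u g'" "g \<in> L2_space \<Omega>" "g' \<in> L2_space \<Omega>"
  shows "L2_norm \<Omega> (\<lambda>z. g z - g' z) = 0"
  unfolding \<Omega>
proof (rule orthogonal_test_functions_imp_zero)
  fix v assume v: "v \<in> test_functions (rectangle L1 L2)"
  then have "L2_inner \<Omega> g v = L2_inner \<Omega> g' v"
    using assms(1,2) by (simp add: weak_px_def L2_inner_def \<Omega>)
  then show "L2_inner (rectangle L1 L2) (\<lambda>z. g z - g' z) v = 0"
    using L2_inner_diff_left[OF assms(3,4) test_function_L2(1)[OF v \<Omega>_lmeasurable]] by (simp add: \<Omega>)
qed (use assms L2_diff \<Omega> in auto)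

lemma weak_py_unique:
  assumes "weak_py \<Omega> u g" "weak_py \<Omega> u g'" "g \<in> L2_space \<Omega>" "g' \<in> L2_space \<Omega>"
  shows "L2_norm \<Omega> (\<lambda>z. g z - g' z) = 0"
  unfolding \<Omega>
proof (rule orthogonal_test_functions_imp_zero)
  fix v assume v: "v \<in> test_functions (rectangle L1 L2)"
  then have "L2_inner \<Omega> g v = L2_inner \<Omega> g' v"
    using assms(1,2) by (simp add: weak_py_def L2_inner_def \<Omega>)
  then show "L2_inner (rectangle L1 L2) (\<lambda>z. g z - g' z) v = 0"
    using L2_inner_diff_left[OF assms(3,4) test_function_L2(1)[OF v \<Omega>_lmeasurable]] by (simp add: \<Omega>)
qed (use assms L2_diff \<Omega> in auto)

lemma H1_spaceD:
  assumes "u \<in> H1_space \<Omega>"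
  shows "u \<in> L2_space \<Omega>" "Dx \<Omega> u \<in> L2_space \<Omega>" "weak_px \<Omega> u (Dx \<Omega> u)"
    "Dy \<Omega> u \<in> L2_space \<Omega>" "weak_py \<Omega> u (Dy \<Omega> u)"
proof -
  have "\<exists>g. g \<in> L2_space \<Omega> \<and> weak_px \<Omega> u g" "\<exists>g. g \<in> L2_space \<Omega> \<and> weak_py \<Omega> u g"
    using assms by (auto simp: H1_space_def)
  from someI_ex[OF this(1)] someI_ex[OF this(2)]
  show "Dx \<Omega> u \<in> L2_space \<Omega>" "weak_px \<Omega> u (Dx \<Omega> u)" "Dy \<Omega> u \<in> L2_space \<Omega>" "weak_py \<Omega> u (Dy \<Omega> u)"
    by (auto simp: Dx_def Dy_def)
qed (use assms in \<open>auto simp: H1_space_def\<close>)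

lemma H1_norm_diff_bounds:
  assumes u: "u \<in> L2_space \<Omega>" "gx \<in> L2_space \<Omega>" "gy \<in> L2_space \<Omega>" "weak_px \<Omega> u gx" "weak_py \<Omega> u gy"
    and v: "v \<in> L2_space \<Omega>" "hx \<in> L2_space \<Omega>" "hy \<in> L2_space \<Omega>" "weak_px \<Omega> v hx" "weak_py \<Omega> v hy"
  shows "L2_norm \<Omega> (\<lambda>z. u z - v z) \<le> H1_norm \<Omega> (\<lambda>z. u z - v z)"
    and "L2_norm \<Omega> (\<lambda>z. gx z - hx z) \<le> H1_norm \<Omega> (\<lambda>z. u z - v z)"
    and "L2_norm \<Omega> (\<lambda>z. gy z - hy z) \<le> H1_norm \<Omega> (\<lambda>z. u z - v z)"
proof -
  let ?d = "\<lambda>z. u z - v z"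
  have wx: "weak_px \<Omega> ?d (\<lambda>z. gx z - hx z)" and wy: "weak_py \<Omega> ?d (\<lambda>z. gy z - hy z)"
  proof -
    have "L2_inner \<Omega> ?d (px w) = - L2_inner \<Omega> (\<lambda>z. gx z - hx z) w"
      "L2_inner \<Omega> ?d (py w) = - L2_inner \<Omega> (\<lambda>z. gy z - hy z) w" if w: "w \<in> test_functions \<Omega>" for w
      using u v w test_function_L2[OF w \<Omega>_lmeasurable]
      by (simp_all add: L2_inner_diff_left) (simp_all add: L2_inner_def weak_px_def weak_py_def)
    then show "weak_px \<Omega> ?d (\<lambda>z. gx z - hx z)" "weak_py \<Omega> ?d (\<lambda>z. gy z - hy z)"
      by (auto simp: weak_px_def weak_py_def L2_inner_def)
  qed
  have "?d \<in> H1_space \<Omega>"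
    using wx wy u v L2_diff by (auto simp: H1_space_def)
  note D = H1_spaceD[OF this]
  have "L2_norm \<Omega> (\<lambda>z. (gx z - hx z) - Dx \<Omega> ?d z) = 0"
    using wx D u v by (intro weak_px_unique) (auto intro: L2_diff)
  then have x: "L2_norm \<Omega> (\<lambda>z. gx z - hx z) \<le> L2_norm \<Omega> (Dx \<Omega> ?d)"
    using L2_norm_triangle_diff[OF L2_diff[OF u(2) v(2)] D(2)] by simp
  have "L2_norm \<Omega> (\<lambda>z. (gy z - hy z) - Dy \<Omega> ?d z) = 0"
    using wy D u v by (intro weak_py_unique) (auto intro: L2_diff)
  then have y: "L2_norm \<Omega> (\<lambda>z. gy z - hy z) \<le> L2_norm \<Omega> (Dy \<Omega> ?d)"
    using L2_norm_triangle_diff[OF L2_diff[OF u(3) v(3)] D(4)] by simp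
  show "L2_norm \<Omega> ?d \<le> H1_norm \<Omega> ?d" unfolding H1_norm_def by (rule real_le_rsqrt) simp
  have "L2_norm \<Omega> (Dx \<Omega> ?d) \<le> H1_norm \<Omega> ?d" unfolding H1_norm_def by (rule real_le_rsqrt) simp
  with x show "L2_norm \<Omega> (\<lambda>z. gx z - hx z) \<le> H1_norm \<Omega> ?d" by simp
  have "L2_norm \<Omega> (Dy \<Omega> ?d) \<le> H1_norm \<Omega> ?d" unfolding H1_norm_def by (rule real_le_rsqrt) simp
  with y show "L2_norm \<Omega> (\<lambda>z. gy z - hy z) \<le> H1_norm \<Omega> ?d" by simp
qed

lemma L2_tendstoI:
  assumes "\<forall>\<^sub>F x in F. L2_norm \<Omega> (\<lambda>z. f x z - l z) \<le> e x" "(e \<longlongrightarrow> 0) F"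
  shows "L2_tendsto \<Omega> f l F"
  unfolding L2_tendsto_def
  by (rule Lim_null_comparison[OF _ assms(2)]) (use assms(1) in simp)

lemma H10_approximation:
  assumes "u \<in> H10_space \<Omega>"
  shows "\<exists>v. (\<forall>n. v n \<in> test_functions \<Omega>) \<and> L2_tendsto \<Omega> v u sequentially \<and>
    L2_tendsto \<Omega> (\<lambda>n. px (v n)) (Dx \<Omega> u) sequentially \<and>
    L2_tendsto \<Omega> (\<lambda>n. py (v n)) (Dy \<Omega> u) sequentially"
proof -
  have u: "u \<in> H1_space \<Omega>" using assms by (simp add: H10_space_def)
  obtain v where v: "\<And>n. v n \<in> test_functions \<Omega>"
    and lim: "(\<lambda>n. H1_norm \<Omega> (\<lambda>z. u z - v n z)) \<longlonglongrightarrow> 0"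
    using assms by (auto simp: H10_space_def)
  note D = H1_spaceD[OF u]
  note T = test_function_L2[OF v \<Omega>_lmeasurable]
  note B = H1_norm_diff_bounds[OF D(1,2,4,3,5) T(1,2,3) weak_px_test_function[OF v \<Omega>_lmeasurable]
      weak_py_test_function[OF v \<Omega>_lmeasurable]]
  have "L2_tendsto \<Omega> v u sequentially" "L2_tendsto \<Omega> (\<lambda>n. px (v n)) (Dx \<Omega> u) sequentially"
    "L2_tendsto \<Omega> (\<lambda>n. py (v n)) (Dy \<Omega> u) sequentially"
    using B by (auto intro!: L2_tendstoI[OF _ lim] always_eventually simp: L2_norm_minus_commute[of _ "v _"]
        L2_norm_minus_commute[of _ "px _"] L2_norm_minus_commute[of _ "py _"])
  with v show ?thesis by (intro exI[of _ v]) simp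
qed

lemma H10_curve_tendsto:
  assumes "continuous_curve (H10_space \<Omega>) (H1_norm \<Omega>) u" "0 \<le> t"
  shows "u t \<in> H1_space \<Omega>" "L2_tendsto \<Omega> u (u t) (at t within {0..})"
    "L2_tendsto \<Omega> (\<lambda>s. Dx \<Omega> (u s)) (Dx \<Omega> (u t)) (at t within {0..})"
    "L2_tendsto \<Omega> (\<lambda>s. Dy \<Omega> (u s)) (Dy \<Omega> (u t)) (at t within {0..})"
proof -
  have u: "u s \<in> H1_space \<Omega>" if "0 \<le> s" for s
    using assms(1) that by (auto simp: continuous_curve_def H10_space_def)
  then show "u t \<in> H1_space \<Omega>" using assms(2) by simp
  have lim: "((\<lambda>s. H1_norm \<Omega> (\<lambda>z. u s z - u t z)) \<longlongrightarrow> 0) (at t within {0..})"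
    using assms by (simp add: continuous_curve_def)
  have ev: "\<forall>\<^sub>F s in at t within {0..}. 0 \<le> s"
    by (auto simp: eventually_at_filter)
  note D = H1_spaceD[OF u] H1_spaceD[OF u[OF assms(2)]]
  note B = H1_norm_diff_bounds[OF D(1,2,4,3,5) D(6,7,9,8,10)]
  show "L2_tendsto \<Omega> u (u t) (at t within {0..})"
    by (rule L2_tendstoI[OF _ lim]) (use ev in eventually_elim, use B in blast)
  show "L2_tendsto \<Omega> (\<lambda>s. Dx \<Omega> (u s)) (Dx \<Omega> (u t)) (at t within {0..})"
    by (rule L2_tendstoI[OF _ lim]) (use ev in eventually_elim, use B in blast)
  show "L2_tendsto \<Omega> (\<lambda>s. Dy \<Omega> (u s)) (Dy \<Omega> (u t)) (at t within {0..})"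
    by (rule L2_tendstoI[OF _ lim]) (use ev in eventually_elim, use B in blast)
qed

text \<open>The boundary condition enters here: approximation by compactly supported functions
  transfers the identity that holds for them without boundary terms.\<close>

lemma H10_cross_identity:
  assumes "u \<in> H10_space \<Omega>" "v \<in> H10_space \<Omega>"
  shows "L2_inner \<Omega> (Dx \<Omega> u) (Dy \<Omega> v) = L2_inner \<Omega> (Dy \<Omega> u) (Dx \<Omega> v)"
proof -
  have uv: "u \<in> H1_space \<Omega>" "v \<in> H1_space \<Omega>" using assms by (auto simp: H10_space_def)
  obtain a where a: "\<And>n. a n \<in> test_functions \<Omega>" "L2_tendsto \<Omega> a u sequentially"
    "L2_tendsto \<Omega> (\<lambda>n. px (a n)) (Dx \<Omega> u) sequentially" "L2_tendsto \<Omega> (\<lambda>n. py (a n)) (Dy \<Omega> u) sequentially"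
    using H10_approximation[OF assms(1)] by blast
  obtain b where b: "\<And>n. b n \<in> test_functions \<Omega>" "L2_tendsto \<Omega> b v sequentially"
    "L2_tendsto \<Omega> (\<lambda>n. px (b n)) (Dx \<Omega> v) sequentially" "L2_tendsto \<Omega> (\<lambda>n. py (b n)) (Dy \<Omega> v) sequentially"
    using H10_approximation[OF assms(2)] by blast
  note T = test_function_L2[OF a(1) \<Omega>_lmeasurable] test_function_L2[OF b(1) \<Omega>_lmeasurable]
  have 1: "(\<lambda>n. L2_inner \<Omega> (px (a n)) (py (b n))) \<longlonglongrightarrow> L2_inner \<Omega> (Dx \<Omega> u) (Dy \<Omega> v)"
    by (rule L2_inner_tendsto[OF a(3) b(4)]) (use T uv H1_spaceD in auto)
  have 2: "(\<lambda>n. L2_inner \<Omega> (py (a n)) (px (b n))) \<longlonglongrightarrow> L2_inner \<Omega> (Dy \<Omega> u) (Dx \<Omega> v)"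
    by (rule L2_inner_tendsto[OF a(4) b(3)]) (use T uv H1_spaceD in auto)
  show ?thesis
    using 1 2 unfolding test_function_cross_identity[OF a(1) b(1) \<Omega>_lmeasurable] by (rule LIMSEQ_unique)
qed

end

section \<open>Superposition with a function of linear growth\<close>

text \<open>
  This pointwise estimate gives the continuity of \<open>u \<mapsto> chi \<circ> u\<close> on \<open>L\<^sup>2\<close> without passing to
  almost everywhere convergent subsequences.
\<close>

lemma linear_growth_modulus:
  fixes chi :: "real \<Rightarrow> real"
  assumes cont: "continuous_on UNIV chi" and C: "0 \<le> C" "\<And>s. \<bar>chi s\<bar> \<le> C * (1 + \<bar>s\<bar>)"
    and \<epsilon>: "0 < \<epsilon>" and M: "1 \<le> M"
  shows "\<exists>L\<ge>0. \<forall>a b. \<bar>chi a - chi b\<bar> \<le> \<epsilon> + L * \<bar>a - b\<bar> + 4 * C * (if M < \<bar>b\<bar> then \<bar>b\<bar> else 0)"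
proof -
  have "uniformly_continuous_on {-(M + 1)..M + 1} chi"
    by (intro compact_uniformly_continuous continuous_on_subset[OF cont]) auto
  then obtain \<delta> where \<delta>: "0 < \<delta>" "\<And>a b. \<lbrakk>a \<in> {-(M + 1)..M + 1}; b \<in> {-(M + 1)..M + 1}; \<bar>a - b\<bar> < \<delta>\<rbrakk>
      \<Longrightarrow> \<bar>chi a - chi b\<bar> < \<epsilon>"
    using \<epsilon> by (auto simp: uniformly_continuous_on_def dist_real_def)
  \<comment> \<open>The cap at 1 keeps a inside [-(M+1), M+1] whenever |b| <= M and |a - b| < m, so
    that uniform continuity applies.\<close>
  define m where "m = min \<delta> 1"
  have m: "0 < m" "m \<le> 1" "m \<le> \<delta>" using \<delta>(1) by (auto simp: m_def)
  \<comment> \<open>For |a - b| >= m the growth bound C (|a - b| + 2 + 2 M) is absorbed into a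
    multiple of |a - b|, using 1 <= |a - b| / m and m <= 1.\<close>
  define L where "L = C * (3 + 2 * M) / m"
  have L0: "0 \<le> L" using C M m by (simp add: L_def)
  have CL: "C \<le> L"
  proof -
    have "C * m \<le> C * (3 + 2 * M)" using C M m by (intro mult_left_mono) auto
    then show ?thesis using m by (simp add: L_def pos_le_divide_eq)
  qed
  have diff: "\<bar>chi a - chi b\<bar> \<le> C * (\<bar>a - b\<bar> + 2 + 2 * \<bar>b\<bar>)" for a b
  proof -
    have "\<bar>chi a - chi b\<bar> \<le> C * (1 + \<bar>a\<bar>) + C * (1 + \<bar>b\<bar>)"
      using C(2)[of a] C(2)[of b] by linarith
    also have "\<dots> = C * (2 + \<bar>a\<bar> + \<bar>b\<bar>)" by (simp add: algebra_simps)
    also have "\<dots> \<le> C * (\<bar>a - b\<bar> + 2 + 2 * \<bar>b\<bar>)" using C by (intro mult_left_mono) auto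
    finally show ?thesis .
  qed
  have "\<bar>chi a - chi b\<bar> \<le> \<epsilon> + L * \<bar>a - b\<bar> + 4 * C * (if M < \<bar>b\<bar> then \<bar>b\<bar> else 0)" for a b
  proof (cases "M < \<bar>b\<bar>")
    \<comment> \<open>Here |b| > M >= 1, so 2 + 2 |b| <= 4 |b|; this is the origin of the factor
      4.\<close>
    case True
    have "\<bar>chi a - chi b\<bar> \<le> C * (\<bar>a - b\<bar> + 4 * \<bar>b\<bar>)"
      using diff[of a b] mult_left_mono[of "\<bar>a - b\<bar> + 2 + 2 * \<bar>b\<bar>" "\<bar>a - b\<bar> + 4 * \<bar>b\<bar>" C] True M C
      by linarith
    also have "\<dots> = C * \<bar>a - b\<bar> + 4 * C * \<bar>b\<bar>" by (simp add: algebra_simps)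
    also have "C * \<bar>a - b\<bar> \<le> L * \<bar>a - b\<bar>" using CL by (intro mult_right_mono) auto
    finally show ?thesis using True \<epsilon> by simp
  next
    case False
    show ?thesis
    proof (cases "\<bar>a - b\<bar> < m")
      case True
      have "\<bar>chi a - chi b\<bar> < \<epsilon>"
        using True m False by (intro \<delta>(2)) auto
      moreover have "0 \<le> L * \<bar>a - b\<bar>" using L0 by simp
      ultimately show ?thesis using False by simp
    next
      case far: False
      have "\<bar>chi a - chi b\<bar> * m \<le> C * (\<bar>a - b\<bar> + 2 + 2 * M) * m"
        using diff[of a b] mult_left_mono[of "\<bar>a - b\<bar> + 2 + 2 * \<bar>b\<bar>" "\<bar>a - b\<bar> + 2 + 2 * M" C] False C m
        by (intro mult_right_mono) linarith+
      also have "\<dots> = C * (\<bar>a - b\<bar> * m + (2 + 2 * M) * m)" by (simp add: algebra_simps)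
      also have "\<dots> \<le> C * (\<bar>a - b\<bar> * 1 + (2 + 2 * M) * \<bar>a - b\<bar>)"
        using C m far M by (intro mult_left_mono add_mono) auto
      also have "\<dots> = C * (3 + 2 * M) * \<bar>a - b\<bar>" by (simp add: algebra_simps)
      finally have "\<bar>chi a - chi b\<bar> \<le> L * \<bar>a - b\<bar>"
        using m by (simp add: L_def field_simps)
      then show ?thesis using False \<epsilon> by simp
    qed
  qed
  with L0 show ?thesis by blast
qed

lemma superposition_L2:
  assumes cont: "continuous_on UNIV chi" and C: "0 \<le> C" "\<And>s. \<bar>chi s\<bar> \<le> C * (1 + \<bar>s\<bar>)"
    and \<Omega>: "\<Omega> \<in> lmeasurable" and u: "u \<in> L2_space \<Omega>"
  shows "(\<lambda>z. chi (u z)) \<in> L2_space \<Omega>"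
proof (rule L2_dominated)
  have "(\<lambda>_. 1) \<in> L2_space \<Omega>" by (intro bounded_L2[where B = 1] \<Omega>) auto
  moreover have "(\<lambda>z. \<bar>u z\<bar>) \<in> L2_space \<Omega>"
    using u by (intro L2_dominated[OF _ u]) (auto simp: L2_space_def)
  ultimately show "(\<lambda>z. C * (1 + \<bar>u z\<bar>)) \<in> L2_space \<Omega>"
    by (intro L2_cmult L2_add)
  show "(\<lambda>z. chi (u z)) \<in> borel_measurable (lebesgue_on \<Omega>)"
    using measurable_compose[OF L2_spaceD(1)[OF u] borel_measurable_continuous_onI[OF cont]] .
  show "\<bar>chi (u z)\<bar> \<le> \<bar>C * (1 + \<bar>u z\<bar>)\<bar>" for z
    using C(2)[of "u z"] by linarith
qed

lemma superposition_L2_tendsto: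
  assumes cont: "continuous_on UNIV chi" and C: "0 \<le> C" "\<And>s. \<bar>chi s\<bar> \<le> C * (1 + \<bar>s\<bar>)"
    and \<Omega>: "\<Omega> \<in> lmeasurable"
    and lim: "L2_tendsto \<Omega> u l F" and u: "\<forall>\<^sub>F x in F. u x \<in> L2_space \<Omega>" and l: "l \<in> L2_space \<Omega>"
  shows "L2_tendsto \<Omega> (\<lambda>x z. chi (u x z)) (\<lambda>z. chi (l z)) F"
  unfolding L2_tendsto_def
proof (rule tendstoI)
  fix e :: real assume e: "0 < e"
  have one: "(\<lambda>_. 1) \<in> L2_space \<Omega>" by (intro bounded_L2[where B = 1] \<Omega>) auto
  define m where "m = L2_norm \<Omega> (\<lambda>_. 1)"
  have m0: "0 \<le> m" by (simp add: m_def)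
  \<comment> \<open>One third of the error is allotted to the constant term; m + 1 replaces m
    because the domain may be a null set.\<close>
  define \<epsilon> where "\<epsilon> = e / (3 * (m + 1))"
  have \<epsilon>: "0 < \<epsilon>" using e m0 by (simp add: \<epsilon>_def)
  have \<epsilon>m: "\<epsilon> * m < e / 3"
  proof -
    have "\<epsilon> * m < \<epsilon> * (m + 1)" using \<epsilon> by simp
    also have "\<dots> = e / 3" using m0 by (simp add: \<epsilon>_def field_simps)
    finally show ?thesis .
  qed
  \<comment> \<open>The order of choices matters: the threshold n is fixed by the tail of the limit
    \<open>l\<close> alone, then the slope \<open>L\<close> depends on \<open>\<epsilon>\<close> and
    n, and only afterwards is u brought close to \<open>l\<close>.\<close>
  define tail where "tail n z = (if real n < \<bar>l z\<bar> then \<bar>l z\<bar> else 0)" for n z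
  have tail_meas: "tail n \<in> borel_measurable (lebesgue_on \<Omega>)" for n
    unfolding tail_def[abs_def] using L2_spaceD(1)[OF l] by measurable
  have tail_L2: "tail n \<in> L2_space \<Omega>" for n
    by (rule L2_dominated[OF tail_meas l]) (simp add: tail_def)
  have "L2_tendsto \<Omega> tail (\<lambda>_. 0) sequentially"
  proof (rule L2_tendsto_dominated[OF tail_meas _ l])
    fix z
    obtain N where "\<bar>l z\<bar> \<le> real N" using real_arch_simple by blast
    then have "\<forall>\<^sub>F n in sequentially. tail n z = 0"
      unfolding eventually_sequentially by (intro exI[of _ N]) (auto simp: tail_def)
    then show "(\<lambda>n. tail n z) \<longlonglongrightarrow> 0" by (rule tendsto_eventually)
    show "\<bar>tail n z - 0\<bar> \<le> \<bar>l z\<bar>" for n by (simp add: tail_def)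
  qed simp
  then have "(\<lambda>n. 4 * C * L2_norm \<Omega> (tail n)) \<longlonglongrightarrow> 4 * C * 0"
    by (intro tendsto_mult_left) (simp add: L2_tendsto_def)
  then have "\<forall>\<^sub>F n in sequentially. 4 * C * L2_norm \<Omega> (tail n) < e / 3"
    by (rule order_tendstoD) (use e in simp)
  with eventually_ge_at_top[of 1] have "\<forall>\<^sub>F n in sequentially. 1 \<le> n \<and> 4 * C * L2_norm \<Omega> (tail n) < e / 3"
    by eventually_elim simp
  then obtain n where n: "1 \<le> n" "4 * C * L2_norm \<Omega> (tail n) < e / 3"
    by (auto simp: eventually_sequentially)
  obtain L where L: "0 \<le> L" "\<And>a b. \<bar>chi a - chi b\<bar> \<le> \<epsilon> + L * \<bar>a - b\<bar> + 4 * C * (if real n < \<bar>b\<bar> then \<bar>b\<bar> else 0)"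
    using linear_growth_modulus[OF cont C \<epsilon>, of "real n"] n(1) by auto
  have "((\<lambda>x. L * L2_norm \<Omega> (\<lambda>z. u x z - l z)) \<longlongrightarrow> L * 0) F"
    using lim by (intro tendsto_mult_left) (simp add: L2_tendsto_def)
  then have "\<forall>\<^sub>F x in F. L * L2_norm \<Omega> (\<lambda>z. u x z - l z) < e / 3"
    by (rule order_tendstoD) (use e in simp)
  with u show "\<forall>\<^sub>F x in F. dist (L2_norm \<Omega> (\<lambda>z. chi (u x z) - chi (l z))) 0 < e"
  proof eventually_elim
    case (elim x)
    note d = L2_diff[OF elim(1) l]
    have ad: "(\<lambda>z. \<bar>u x z - l z\<bar>) \<in> L2_space \<Omega>"
      using L2_spaceD(1)[OF d] by (intro L2_dominated[OF _ d]) auto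
    have bound: "(\<lambda>z. \<epsilon> * 1 + L * \<bar>u x z - l z\<bar> + 4 * C * tail n z) \<in> L2_space \<Omega>"
      by (intro L2_add L2_cmult[OF one] L2_cmult[OF ad] L2_cmult[OF tail_L2])
    have "L2_norm \<Omega> (\<lambda>z. chi (u x z) - chi (l z)) \<le>
        L2_norm \<Omega> (\<lambda>z. \<epsilon> * 1 + L * \<bar>u x z - l z\<bar> + 4 * C * tail n z)"
    proof (rule L2_norm_mono[OF _ bound])
      show "(\<lambda>z. chi (u x z) - chi (l z)) \<in> L2_space \<Omega>"
        by (intro L2_diff superposition_L2[OF cont C \<Omega>] elim l)
      show "\<bar>chi (u x z) - chi (l z)\<bar> \<le> \<bar>\<epsilon> * 1 + L * \<bar>u x z - l z\<bar> + 4 * C * tail n z\<bar>" for z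
        using L(2)[of "u x z" "l z"] by (simp add: tail_def)
    qed
    also have "\<dots> \<le> L2_norm \<Omega> (\<lambda>z. \<epsilon> * 1 + L * \<bar>u x z - l z\<bar>) + L2_norm \<Omega> (\<lambda>z. 4 * C * tail n z)"
      by (intro L2_norm_triangle L2_add L2_cmult[OF one] L2_cmult[OF ad] L2_cmult[OF tail_L2])
    also have "L2_norm \<Omega> (\<lambda>z. \<epsilon> * 1 + L * \<bar>u x z - l z\<bar>) \<le>
        L2_norm \<Omega> (\<lambda>z. \<epsilon> * 1) + L2_norm \<Omega> (\<lambda>z. L * \<bar>u x z - l z\<bar>)"
      by (intro L2_norm_triangle L2_cmult[OF one] L2_cmult[OF ad])
    finally have "L2_norm \<Omega> (\<lambda>z. chi (u x z) - chi (l z)) \<le>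
        \<epsilon> * m + L * L2_norm \<Omega> (\<lambda>z. u x z - l z) + 4 * C * L2_norm \<Omega> (tail n)"
      using \<epsilon> L(1) C(1) unfolding L2_norm_cmult m_def by (simp add: L2_norm_def)
    then show ?case using \<epsilon>m n(2) elim(2) by simp
  qed
qed

section \<open>Curves in \<open>L\<^sup>2\<close> and extension of the weak equations\<close>

abbreviation L2_curve :: "(real \<times> real) set \<Rightarrow> (real \<Rightarrow> field) \<Rightarrow> bool" where
  "L2_curve \<Omega> \<equiv> continuous_curve (L2_space \<Omega>) (L2_norm \<Omega>)"

lemma L2_curve_iff:
  "L2_curve \<Omega> f \<longleftrightarrow> (\<forall>t\<ge>0. f t \<in> L2_space \<Omega> \<and> L2_tendsto \<Omega> f (f t) (at t within {0..}))"
  by (simp add: continuous_curve_def L2_tendsto_def)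

lemma L2_curveD: "\<lbrakk>L2_curve \<Omega> f; 0 \<le> t\<rbrakk> \<Longrightarrow> f t \<in> L2_space \<Omega>"
  by (simp add: L2_curve_iff)

lemma eventually_nonneg_at_within: "\<forall>\<^sub>F s in at t within {0..}. (0::real) \<le> s"
  by (auto simp: eventually_at_filter)

lemma L2_curve_add:
  assumes "L2_curve \<Omega> f" "L2_curve \<Omega> g"
  shows "L2_curve \<Omega> (\<lambda>t z. f t z + g t z)"
  unfolding L2_curve_iff
proof (intro allI impI conjI)
  fix t :: real assume t: "0 \<le> t"
  show "(\<lambda>z. f t z + g t z) \<in> L2_space \<Omega>" using assms t by (intro L2_add L2_curveD)
  have "\<forall>\<^sub>F s in at t within {0..}. f s \<in> L2_space \<Omega> \<and> g s \<in> L2_space \<Omega>"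
    using eventually_nonneg_at_within by eventually_elim (use assms L2_curveD in blast)
  then show "L2_tendsto \<Omega> (\<lambda>t z. f t z + g t z) (\<lambda>z. f t z + g t z) (at t within {0..})"
    using assms t by (intro L2_tendsto_add) (auto simp: L2_curve_iff)
qed

lemma L2_curve_cmult: "L2_curve \<Omega> f \<Longrightarrow> L2_curve \<Omega> (\<lambda>t z. c * f t z)"
  by (simp add: L2_curve_iff L2_cmult L2_tendsto_cmult)

lemma L2_curve_zero: "L2_curve \<Omega> (\<lambda>_ _. 0)"
proof -
  have "(\<lambda>_. 0) \<in> L2_space \<Omega>" by (simp add: L2_space_def)
  then show ?thesis by (simp add: L2_curve_iff L2_tendsto_const)
qed

lemma L2_curve_superposition:
  assumes "continuous_on UNIV chi" "0 \<le> C" "\<And>s. \<bar>chi s\<bar> \<le> C * (1 + \<bar>s\<bar>)"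
    "\<Omega> \<in> lmeasurable" "L2_curve \<Omega> u"
  shows "L2_curve \<Omega> (\<lambda>t z. chi (u t z))"
  unfolding L2_curve_iff
proof (intro allI impI conjI)
  fix t :: real assume t: "0 \<le> t"
  show "(\<lambda>z. chi (u t z)) \<in> L2_space \<Omega>"
    by (rule superposition_L2[OF assms(1-4) L2_curveD[OF assms(5) t]])
  have "\<forall>\<^sub>F s in at t within {0..}. u s \<in> L2_space \<Omega>"
    using eventually_nonneg_at_within by eventually_elim (use assms L2_curveD in blast)
  moreover have "L2_tendsto \<Omega> u (u t) (at t within {0..})"
    using assms(5) t by (simp add: L2_curve_iff)
  ultimately show "L2_tendsto \<Omega> (\<lambda>t z. chi (u t z)) (\<lambda>z. chi (u t z)) (at t within {0..})"
    using L2_curveD[OF assms(5) t] by (intro superposition_L2_tendsto[OF assms(1-4)])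
qed

text \<open>Norm continuity of both curves yields joint continuity in the two times, as
  \<open>diagonal_derivative\<close> demands; continuity in each variable separately would be too
  weak.\<close>

lemma L2_inner_curves_continuous:
  assumes "L2_curve \<Omega> f" "L2_curve \<Omega> g"
  shows "continuous_on ({0..} \<times> {0..}) (\<lambda>(t, s). L2_inner \<Omega> (f t) (g s))"
  unfolding continuous_on_def
proof
  fix p :: "real \<times> real" assume p: "p \<in> {0..} \<times> {0..}"
  let ?F = "at p within {0..} \<times> {0..}"
  have ev: "\<forall>\<^sub>F q in ?F. 0 \<le> fst q \<and> 0 \<le> snd q"
    by (auto simp: eventually_at_filter mem_Times_iff intro!: always_eventually)
  have lim: "L2_tendsto \<Omega> (\<lambda>x. h (\<tau> x)) (h t) ?F"
    if h: "L2_curve \<Omega> h" "0 \<le> t" and \<tau>: "(\<tau> \<longlongrightarrow> t) ?F" "\<forall>\<^sub>F x in ?F. 0 \<le> \<tau> x" for h \<tau> t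
  proof -
    \<comment> \<open>The punctured limit is turned into continuity, with value 0 at t, because
      \<open>\<tau>\<close> may take the value t itself.\<close>
    have "L2_norm \<Omega> (\<lambda>z. h t z - h t z) = 0" by (simp add: L2_norm_def)
    then have "continuous (at t within {0..}) (\<lambda>s. L2_norm \<Omega> (\<lambda>z. h s z - h t z))"
      using h by (simp add: continuous_within L2_curve_iff L2_tendsto_def)
    from continuous_within_tendsto_compose[OF this _ \<tau>(1)] \<tau>(2) show ?thesis
      by (simp add: L2_tendsto_def L2_norm_def)
  qed
  have "((\<lambda>q. L2_inner \<Omega> (f (fst q)) (g (snd q))) \<longlongrightarrow> L2_inner \<Omega> (f (fst p)) (g (snd p))) ?F"
  proof (rule L2_inner_tendsto)
    show "L2_tendsto \<Omega> (\<lambda>q. f (fst q)) (f (fst p)) ?F"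
      by (rule lim[OF assms(1)]) (use p ev in \<open>auto intro!: tendsto_intros elim: eventually_mono\<close>)
    show "L2_tendsto \<Omega> (\<lambda>q. g (snd q)) (g (snd p)) ?F"
      by (rule lim[OF assms(2)]) (use p ev in \<open>auto intro!: tendsto_intros elim: eventually_mono\<close>)
    show "\<forall>\<^sub>F q in ?F. f (fst q) \<in> L2_space \<Omega> \<and> g (snd q) \<in> L2_space \<Omega>"
      using ev by eventually_elim (use assms L2_curveD in blast)
  qed (use assms p L2_curveD in auto)
  then show "((\<lambda>(t, s). L2_inner \<Omega> (f t) (g s)) \<longlongrightarrow> (case p of (t, s) \<Rightarrow> L2_inner \<Omega> (f t) (g s))) ?F"
    by (simp add: case_prod_unfold)
qed

text \<open>In place of uniform convergence of the derivatives there is a modulus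
  \<open>\<omega>\<close> at the single point t that is common to all n. It gives a first-order
  remainder estimate uniform in n, which survives pointwise limits.\<close>

lemma has_real_derivative_limit:
  fixes F D :: "nat \<Rightarrow> real \<Rightarrow> real"
  assumes dF: "\<And>n s. 0 \<le> s \<Longrightarrow> (F n has_real_derivative D n s) (at s within {0..})"
    and lim: "\<And>s. 0 \<le> s \<Longrightarrow> (\<lambda>n. F n s) \<longlonglongrightarrow> F0 s" and D: "(\<lambda>n. D n t) \<longlonglongrightarrow> D0"
    and \<omega>: "\<And>n s. 0 \<le> s \<Longrightarrow> \<bar>D n s - D n t\<bar> \<le> \<omega> s" "(\<omega> \<longlongrightarrow> 0) (at t within {0..})"
    and t: "0 \<le> t"
  shows "(F0 has_real_derivative D0) (at t within {0..})"
proof -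
  have "(F0 has_derivative (\<lambda>h. D0 * h)) (at t within {0..})"
    unfolding has_derivative_within_alt
  proof (intro conjI allI impI)
    fix e :: real assume e: "0 < e"
    have "\<forall>\<^sub>F s in at t within {0..}. \<omega> s < e"
      by (rule order_tendstoD(2)[OF \<omega>(2) e])
    then obtain d where d: "0 < d" "\<And>s. \<lbrakk>0 \<le> s; s \<noteq> t; dist s t < d\<rbrakk> \<Longrightarrow> \<omega> s < e"
      by (auto simp: eventually_at)
    have small: "\<bar>D n s - D n t\<bar> \<le> e" if "s \<in> {0..} \<inter> ball t d" for n s
      using \<omega>(1)[of s n] d(2)[of s] that e by (cases "s = t") (auto simp: dist_commute)
    have "norm (F0 y - F0 t - D0 * (y - t)) \<le> e * norm (y - t)" if y: "y \<in> {0..}" "norm (y - t) < d" for y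
    proof (rule LIMSEQ_le_const2)
      show "(\<lambda>n. norm (F n y - F n t - D n t * (y - t))) \<longlonglongrightarrow> norm (F0 y - F0 t - D0 * (y - t))"
        using y t by (intro tendsto_intros lim D) auto
      have "norm (F n y - F n t - D n t * (y - t)) \<le> e * norm (y - t)" for n
      proof -
        \<comment> \<open>Subtracting the tangent slope leaves a function with derivative
          \<open>D n s - D n t\<close>, bounded by e on a convex neighbourhood of t in the half
          line.\<close>
        have "norm ((F n y - D n t * y) - (F n t - D n t * t)) \<le> e * norm (y - t)"
        proof (rule field_differentiable_bound)
          show "convex ({0..} \<inter> ball t d)" by (intro convex_Int convex_ball convex_real_interval)
          fix s assume s: "s \<in> {0..} \<inter> ball t d"
          have "(F n has_real_derivative D n s) (at s within {0..} \<inter> ball t d)"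
            using dF[of s n] s by (auto intro: DERIV_subset)
          then show "((\<lambda>s. F n s - D n t * s) has_real_derivative D n s - D n t) (at s within {0..} \<inter> ball t d)"
            by (auto intro!: derivative_eq_intros)
          show "norm (D n s - D n t) \<le> e" using small[OF s] by simp
        qed (use y t d(1) in \<open>auto simp: dist_real_def abs_minus_commute\<close>)
        then show ?thesis by (simp add: algebra_simps)
      qed
      then show "\<exists>N. \<forall>n\<ge>N. norm (F n y - F n t - D n t * (y - t)) \<le> e * norm (y - t)" by blast
    qed
    then show "\<exists>d>0. \<forall>y\<in>{0..}. norm (y - t) < d \<longrightarrow> norm (F0 y - F0 t - D0 * (y - t)) \<le> e * norm (y - t)"
      using d(1) by blast
  qed (rule bounded_linear_mult_right)
  then show ?thesis by (simp add: has_field_derivative_def)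
qed

lemma L2_tendsto_bounded:
  assumes "L2_tendsto \<Omega> v f sequentially" "\<And>n. v n \<in> L2_space \<Omega>" "f \<in> L2_space \<Omega>"
  shows "\<exists>B\<ge>0. \<forall>n::nat. L2_norm \<Omega> (v n) \<le> B"
proof -
  have "Bseq (\<lambda>n. L2_norm \<Omega> (\<lambda>z. v n z - f z))"
    using assms(1) unfolding L2_tendsto_def by (intro convergent_imp_Bseq convergentI)
  then obtain B where B: "0 < B" "\<And>n. L2_norm \<Omega> (\<lambda>z. v n z - f z) \<le> B"
    by (auto simp: Bseq_def)
  have "L2_norm \<Omega> (v n) \<le> B + L2_norm \<Omega> f" for n
    using L2_norm_triangle_diff[OF assms(2)[of n] assms(3)] B(2)[of n] by linarith
  then show ?thesis using B(1) by (intro exI[of _ "B + L2_norm \<Omega> f"]) (simp add: add_nonneg_nonneg)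
qed

lemma L2_inner_curve_modulus:
  assumes "L2_curve \<Omega> A" "0 \<le> s" "0 \<le> t" "v \<in> L2_space \<Omega>" "L2_norm \<Omega> v \<le> B"
  shows "\<bar>L2_inner \<Omega> (A s) v - L2_inner \<Omega> (A t) v\<bar> \<le> L2_norm \<Omega> (\<lambda>z. A s z - A t z) * B"
proof -
  note A = L2_curveD[OF assms(1,2)] L2_curveD[OF assms(1,3)]
  have "\<bar>L2_inner \<Omega> (A s) v - L2_inner \<Omega> (A t) v\<bar> \<le> L2_norm \<Omega> (\<lambda>z. A s z - A t z) * L2_norm \<Omega> v"
    using L2_Cauchy_Schwarz[OF L2_diff[OF A] assms(4)] by (simp add: L2_inner_diff_left[OF A assms(4)])
  also have "\<dots> \<le> L2_norm \<Omega> (\<lambda>z. A s z - A t z) * B"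
    using assms(5) by (intro mult_left_mono) auto
  finally show ?thesis .
qed

text \<open>No space derivative falls on the test function in the equations for w, \<psi> and
  \<phi>, so L2 approximation suffices. This allows testing with velocities and damping
  forces.\<close>

lemma weak_time_derivative_L2:
  assumes \<Omega>: "\<Omega> = rectangle L1 L2"
    and u: "\<And>t. 0 \<le> t \<Longrightarrow> u t \<in> L2_space \<Omega>" and ut: "L2_curve \<Omega> ut"
    and eq: "\<And>v t. \<lbrakk>v \<in> test_functions \<Omega>; 0 \<le> t\<rbrakk> \<Longrightarrow>
      ((\<lambda>s. L2_inner \<Omega> (u s) v) has_real_derivative L2_inner \<Omega> (ut t) v) (at t within {0..})"
    and f: "f \<in> L2_space \<Omega>" and t: "0 \<le> t"
  shows "((\<lambda>s. L2_inner \<Omega> (u s) f) has_real_derivative L2_inner \<Omega> (ut t) f) (at t within {0..})"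
proof -
  obtain v where v: "\<And>n. v n \<in> test_functions \<Omega>" "L2_tendsto \<Omega> v f sequentially"
    using test_functions_dense f unfolding \<Omega> by blast
  have vL2: "v n \<in> L2_space \<Omega>" for n
    using test_function_L2(1)[OF v(1)] rectangle_lmeasurable \<Omega> by blast
  obtain B where B: "0 \<le> B" "\<And>n. L2_norm \<Omega> (v n) \<le> B"
    using L2_tendsto_bounded[OF v(2) vL2 f] by blast
  have lim: "(\<lambda>n. L2_inner \<Omega> h (v n)) \<longlonglongrightarrow> L2_inner \<Omega> h f" if "h \<in> L2_space \<Omega>" for h
    by (rule L2_inner_tendsto[OF L2_tendsto_const v(2)]) (use that vL2 f in auto)
  show ?thesis
  proof (rule has_real_derivative_limit)
    show "((\<lambda>s. L2_inner \<Omega> (u s) (v n)) has_real_derivative L2_inner \<Omega> (ut s) (v n)) (at s within {0..})"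
      if "0 \<le> s" for n s by (rule eq[OF v(1) that])
    show "(\<lambda>n. L2_inner \<Omega> (u s) (v n)) \<longlonglongrightarrow> L2_inner \<Omega> (u s) f" if "0 \<le> s" for s
      by (rule lim[OF u[OF that]])
    show "(\<lambda>n. L2_inner \<Omega> (ut t) (v n)) \<longlonglongrightarrow> L2_inner \<Omega> (ut t) f"
      by (rule lim[OF L2_curveD[OF ut t]])
    show "\<bar>L2_inner \<Omega> (ut s) (v n) - L2_inner \<Omega> (ut t) (v n)\<bar> \<le> L2_norm \<Omega> (\<lambda>z. ut s z - ut t z) * B"
      if "0 \<le> s" for n s by (rule L2_inner_curve_modulus[OF ut that t vL2 B(2)])
    have "((\<lambda>s. L2_norm \<Omega> (\<lambda>z. ut s z - ut t z) * B) \<longlongrightarrow> 0 * B) (at t within {0..})"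
      using ut t by (intro tendsto_mult_right) (simp add: L2_curve_iff L2_tendsto_def)
    then show "((\<lambda>s. L2_norm \<Omega> (\<lambda>z. ut s z - ut t z) * B) \<longlongrightarrow> 0) (at t within {0..})" by simp
  qed (rule t)
qed

text \<open>Common form of the three momentum equations: \<open>A\<close> and \<open>B\<close> are
  the fluxes paired with the x- and y-derivative of the test function, \<open>C\<close> is the force
  paired with the function itself. The fluxes are only in L2, so the derivatives of the
  approximating functions must converge as well, hence \<open>H10_space\<close>.\<close>

lemma weak_equation_H10:
  assumes \<Omega>: "\<Omega> = rectangle L1 L2"
    and q: "\<And>t. 0 \<le> t \<Longrightarrow> q t \<in> L2_space \<Omega>"
    and A: "L2_curve \<Omega> A" and B: "L2_curve \<Omega> B" and C: "L2_curve \<Omega> C"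
    and eq: "\<And>v t. \<lbrakk>v \<in> test_functions \<Omega>; 0 \<le> t\<rbrakk> \<Longrightarrow>
      ((\<lambda>s. L2_inner \<Omega> (q s) v) has_real_derivative
        - L2_inner \<Omega> (A t) (px v) - L2_inner \<Omega> (B t) (py v) - L2_inner \<Omega> (C t) v) (at t within {0..})"
    and f: "f \<in> H10_space \<Omega>" and t: "0 \<le> t"
  shows "((\<lambda>s. L2_inner \<Omega> (q s) f) has_real_derivative
        - L2_inner \<Omega> (A t) (Dx \<Omega> f) - L2_inner \<Omega> (B t) (Dy \<Omega> f) - L2_inner \<Omega> (C t) f) (at t within {0..})"
proof -
  have "f \<in> H1_space \<Omega>" using f by (simp add: H10_space_def)
  note D = H1_spaceD[OF \<Omega> this]
  obtain v where v: "\<And>n. v n \<in> test_functions \<Omega>" "L2_tendsto \<Omega> v f sequentially"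
    "L2_tendsto \<Omega> (\<lambda>n. px (v n)) (Dx \<Omega> f) sequentially" "L2_tendsto \<Omega> (\<lambda>n. py (v n)) (Dy \<Omega> f) sequentially"
    using H10_approximation[OF \<Omega> f] by blast
  note T = test_function_L2[OF v(1) \<Omega>_lmeasurable[OF \<Omega>]]
  obtain b0 b1 b2 where b: "\<And>n. L2_norm \<Omega> (v n) \<le> b0" "\<And>n. L2_norm \<Omega> (px (v n)) \<le> b1"
    "\<And>n. L2_norm \<Omega> (py (v n)) \<le> b2"
    using L2_tendsto_bounded[OF v(2) T(1) D(1)] L2_tendsto_bounded[OF v(3) T(2) D(2)]
      L2_tendsto_bounded[OF v(4) T(3) D(4)] by blast
  have lim: "(\<lambda>n. L2_inner \<Omega> h (g n)) \<longlonglongrightarrow> L2_inner \<Omega> h l"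
    if "h \<in> L2_space \<Omega>" "L2_tendsto \<Omega> g l sequentially" "\<And>n. g n \<in> L2_space \<Omega>" "l \<in> L2_space \<Omega>" for h g l
    by (rule L2_inner_tendsto[OF L2_tendsto_const that(2)]) (use that in auto)
  define \<omega> where "\<omega> s = L2_norm \<Omega> (\<lambda>z. A s z - A t z) * b1 + L2_norm \<Omega> (\<lambda>z. B s z - B t z) * b2
    + L2_norm \<Omega> (\<lambda>z. C s z - C t z) * b0" for s
  show ?thesis
  proof (rule has_real_derivative_limit)
    show "((\<lambda>s. L2_inner \<Omega> (q s) (v n)) has_real_derivative
        - L2_inner \<Omega> (A s) (px (v n)) - L2_inner \<Omega> (B s) (py (v n)) - L2_inner \<Omega> (C s) (v n)) (at s within {0..})"
      if "0 \<le> s" for n s by (rule eq[OF v(1) that])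
    show "(\<lambda>n. L2_inner \<Omega> (q s) (v n)) \<longlonglongrightarrow> L2_inner \<Omega> (q s) f" if "0 \<le> s" for s
      by (rule lim[OF q[OF that] v(2) T(1) D(1)])
    show "(\<lambda>n. - L2_inner \<Omega> (A t) (px (v n)) - L2_inner \<Omega> (B t) (py (v n)) - L2_inner \<Omega> (C t) (v n))
      \<longlonglongrightarrow> - L2_inner \<Omega> (A t) (Dx \<Omega> f) - L2_inner \<Omega> (B t) (Dy \<Omega> f) - L2_inner \<Omega> (C t) f"
      by (intro tendsto_diff tendsto_minus lim[OF L2_curveD[OF A t] v(3) T(2) D(2)]
          lim[OF L2_curveD[OF B t] v(4) T(3) D(4)] lim[OF L2_curveD[OF C t] v(2) T(1) D(1)])
    show "\<bar>- L2_inner \<Omega> (A s) (px (v n)) - L2_inner \<Omega> (B s) (py (v n)) - L2_inner \<Omega> (C s) (v n)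
      - (- L2_inner \<Omega> (A t) (px (v n)) - L2_inner \<Omega> (B t) (py (v n)) - L2_inner \<Omega> (C t) (v n))\<bar> \<le> \<omega> s"
      if s: "0 \<le> s" for n s
      using L2_inner_curve_modulus[OF A s t T(2) b(2), of n] L2_inner_curve_modulus[OF B s t T(3) b(3), of n]
        L2_inner_curve_modulus[OF C s t T(1) b(1), of n]
      unfolding \<omega>_def by linarith
    have "(\<omega> \<longlongrightarrow> 0 * b1 + 0 * b2 + 0 * b0) (at t within {0..})"
      unfolding \<omega>_def using A B C t
      by (intro tendsto_add tendsto_mult_right) (simp_all add: L2_curve_iff L2_tendsto_def)
    then show "(\<omega> \<longlongrightarrow> 0) (at t within {0..})" by simp
  qed (rule t)
qed

section \<open>The energy identity\<close>

text \<open>The conclusions serve two ends: continuity and linear growth turn the damping force into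
  a continuous curve in L2, and the sign makes it dissipate energy.\<close>

lemma damping_assumption_consequences:
  assumes "damping_assumption chi1 chi2" and chi: "chi \<in> {chi1, chi2}"
  shows "continuous_on UNIV chi" "\<exists>C\<ge>0. \<forall>s. \<bar>chi s\<bar> \<le> C * (1 + \<bar>s\<bar>)" "0 \<le> s * chi s"
proof -
  obtain c1 c2 :: real and g :: "real \<Rightarrow> real" where c: "0 < c1" "0 < c2"
    and g: "strict_mono g" "\<And>s. g (- s) = - g s"
    and small: "\<And>s. \<bar>s\<bar> \<le> 1 \<Longrightarrow> \<bar>chi s\<bar> \<le> c2 * inv g \<bar>s\<bar>"
    and large: "\<And>s. 1 \<le> \<bar>s\<bar> \<Longrightarrow> \<bar>chi s\<bar> \<le> c2 * \<bar>s\<bar>"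
    using assms unfolding damping_assumption_def by blast
  show cont: "continuous_on UNIV chi" using assms by (auto simp: damping_assumption_def)
  have mono: "mono chi" using assms by (auto simp: damping_assumption_def)
  have "g 0 = 0" using g(2)[of 0] by simp
  then have "inv g 0 = 0"
    using inv_f_f[OF strict_mono_imp_inj_on[OF g(1)], of 0] by simp
  \<comment> \<open>The upper bound by \<open>inv g\<close> at s = 0 pins the value of chi to 0;
    monotonicity then yields the sign of s chi(s).\<close>
  then have chi0: "chi 0 = 0" using small[of 0] by simp
  show "0 \<le> s * chi s"
    using monoD[OF mono, of 0 s] monoD[OF mono, of s 0] chi0
    by (cases "0 \<le> s") (auto intro: mult_nonneg_nonneg mult_nonpos_nonpos)
  have "bounded (chi ` {-1..1})"
    by (intro compact_imp_bounded compact_continuous_image continuous_on_subset[OF cont]) auto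
  then obtain B where B: "\<And>s. s \<in> {-1..1} \<Longrightarrow> \<bar>chi s\<bar> \<le> B" unfolding bounded_iff by fastforce
  have "0 \<le> B" using B[of 0] by simp
  have "\<bar>chi s\<bar> \<le> (B + c2) * (1 + \<bar>s\<bar>)" for s
  proof (cases "\<bar>s\<bar> \<le> 1")
    case True
    then have "\<bar>chi s\<bar> \<le> B * 1" using B[of s] by (simp add: abs_le_iff)
    also have "\<dots> \<le> (B + c2) * (1 + \<bar>s\<bar>)" using \<open>0 \<le> B\<close> c by (intro mult_mono) auto
    finally show ?thesis .
  next
    case False
    then have "\<bar>chi s\<bar> \<le> c2 * \<bar>s\<bar>" using large by simp
    also have "\<dots> \<le> (B + c2) * (1 + \<bar>s\<bar>)" using \<open>0 \<le> B\<close> c by (intro mult_mono) auto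
    finally show ?thesis .
  qed
  then show "\<exists>C\<ge>0. \<forall>s. \<bar>chi s\<bar> \<le> C * (1 + \<bar>s\<bar>)"
    using \<open>0 \<le> B\<close> c by (intro exI[of _ "B + c2"]) auto
qed

lemma weak_form_split:
  assumes "A \<in> L2_space \<Omega>" "B \<in> L2_space \<Omega>" "C \<in> L2_space \<Omega>"
    "a \<in> L2_space \<Omega>" "b \<in> L2_space \<Omega>" "c \<in> L2_space \<Omega>"
    and eq: "\<And>z. h z = - (A z * a z) - B z * b z - C z * c z"
  shows "(LINT z|lebesgue_on \<Omega>. h z) = - L2_inner \<Omega> A a - L2_inner \<Omega> B b - L2_inner \<Omega> C c"
  using L2_mult_integrable[OF assms(1,4)] L2_mult_integrable[OF assms(2,5)] L2_mult_integrable[OF assms(3,6)]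
  unfolding L2_inner_def eq by simp

theorem proposition3p1:
  fixes L\<^sub>1 L\<^sub>2 \<rho>\<^sub>1 \<rho>\<^sub>2 K D \<mu> :: real
    and chi\<^sub>1 chi\<^sub>2 :: "real \<Rightarrow> real"
    and \<Omega> :: "(real \<times> real) set"
    and w\<^sub>0 w\<^sub>1 \<psi>\<^sub>0 \<psi>\<^sub>1 \<phi>\<^sub>0 \<phi>\<^sub>1 :: field
    and w wt \<psi> \<psi>t \<phi> \<phi>t :: "real \<Rightarrow> field"
    and E :: "real \<Rightarrow> real"
  assumes "L\<^sub>1 > 0" and "L\<^sub>2 > 0" and "\<Omega> = rectangle L\<^sub>1 L\<^sub>2"
    and "\<rho>\<^sub>1 > 0" and "\<rho>\<^sub>2 > 0" and "K > 0" and "D > 0" and "0 < \<mu>" and "\<mu> < 1 / 2"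
    and "damping_assumption chi\<^sub>1 chi\<^sub>2"
    and "w\<^sub>0 \<in> H10_space \<Omega>" and "w\<^sub>1 \<in> L2_space \<Omega>"
    and "\<psi>\<^sub>0 \<in> H10_space \<Omega>" and "\<psi>\<^sub>1 \<in> L2_space \<Omega>"
    and "\<phi>\<^sub>0 \<in> H10_space \<Omega>" and "\<phi>\<^sub>1 \<in> L2_space \<Omega>"
    and "RMT_solution \<Omega> \<rho>\<^sub>1 \<rho>\<^sub>2 K D \<mu> chi\<^sub>1 chi\<^sub>2 (w\<^sub>0, w\<^sub>1, \<psi>\<^sub>0, \<psi>\<^sub>1, \<phi>\<^sub>0, \<phi>\<^sub>1) w wt \<psi> \<psi>t \<phi> \<phi>t"
    and "E = RMT_energy \<Omega> \<rho>\<^sub>1 \<rho>\<^sub>2 K D \<mu> w wt \<psi> \<psi>t \<phi> \<phi>t"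
  shows "(\<forall>t\<ge>0. (E has_real_derivative
             - (LINT z|lebesgue_on \<Omega>. \<psi>t t z * chi\<^sub>1 (\<psi>t t z) + \<phi>t t z * chi\<^sub>2 (\<phi>t t z)))
             (at t within {0..})) \<and>
         (\<forall>t\<ge>0. E t \<le> E 0)"
proof -

  \<comment> \<open>Curves in L2 attached to the solution\<close>
  note \<Omega> = assms(3)
  have \<Omega>m: "\<Omega> \<in> lmeasurable" by (rule \<Omega>_lmeasurable[OF \<Omega>])
  note sol = assms(17)[unfolded RMT_solution_def]
  note weak = sol[THEN conjunct2, THEN conjunct2, THEN conjunct2, THEN bspec, THEN spec, THEN mp]
  note weak_w = weak[THEN conjunct2, THEN conjunct2, THEN conjunct2, THEN conjunct1]
    and weak_\<psi> = weak[THEN conjunct2, THEN conjunct2, THEN conjunct2, THEN conjunct2, THEN conjunct1]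
    and weak_\<phi> = weak[THEN conjunct2, THEN conjunct2, THEN conjunct2, THEN conjunct2, THEN conjunct2]
  have curves: "continuous_curve (H10_space \<Omega>) (H1_norm \<Omega>) w"
    "continuous_curve (H10_space \<Omega>) (H1_norm \<Omega>) \<psi>" "continuous_curve (H10_space \<Omega>) (H1_norm \<Omega>) \<phi>"
    and vel: "L2_curve \<Omega> wt" "L2_curve \<Omega> \<psi>t" "L2_curve \<Omega> \<phi>t"
    using sol by auto
  have H10: "u t \<in> H10_space \<Omega>" if "continuous_curve (H10_space \<Omega>) (H1_norm \<Omega>) u" "0 \<le> t" for u t
    using that by (simp add: continuous_curve_def)
  have cu: "L2_curve \<Omega> u" "L2_curve \<Omega> (\<lambda>t. Dx \<Omega> (u t))" "L2_curve \<Omega> (\<lambda>t. Dy \<Omega> (u t))"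
    if "continuous_curve (H10_space \<Omega>) (H1_norm \<Omega>) u" for u
    using H10_curve_tendsto[OF \<Omega> that] H1_spaceD[OF \<Omega>] unfolding L2_curve_iff by blast+
  note cw = cu[OF curves(1)] and c\<psi> = cu[OF curves(2)] and c\<phi> = cu[OF curves(3)]
  define X1 where "X1 t z = chi\<^sub>1 (\<psi>t t z)" for t z
  define X2 where "X2 t z = chi\<^sub>2 (\<phi>t t z)" for t z
  define \<alpha> where "\<alpha> t z = \<psi> t z + Dx \<Omega> (w t) z" for t z
  define \<beta> where "\<beta> t z = \<phi> t z + Dy \<Omega> (w t) z" for t z
  define \<gamma> where "\<gamma> t z = Dy \<Omega> (\<psi> t) z + Dx \<Omega> (\<phi> t) z" for t z
  have cX: "L2_curve \<Omega> X1" "L2_curve \<Omega> X2"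
  proof -
    note d1 = damping_assumption_consequences[OF assms(10), of chi\<^sub>1]
      and d2 = damping_assumption_consequences[OF assms(10), of chi\<^sub>2]
    obtain C1 where C1: "0 \<le> C1" "\<And>s. \<bar>chi\<^sub>1 s\<bar> \<le> C1 * (1 + \<bar>s\<bar>)" using d1(2) by auto
    obtain C2 where C2: "0 \<le> C2" "\<And>s. \<bar>chi\<^sub>2 s\<bar> \<le> C2 * (1 + \<bar>s\<bar>)" using d2(2) by auto
    show "L2_curve \<Omega> X1" "L2_curve \<Omega> X2"
      using L2_curve_superposition[OF d1(1) C1 \<Omega>m vel(2)] L2_curve_superposition[OF d2(1) C2 \<Omega>m vel(3)]
      by (simp_all add: X1_def[abs_def] X2_def[abs_def])
  qed
  have c\<alpha>: "L2_curve \<Omega> \<alpha>" and c\<beta>: "L2_curve \<Omega> \<beta>" and c\<gamma>: "L2_curve \<Omega> \<gamma>"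
    unfolding \<alpha>_def[abs_def] \<beta>_def[abs_def] \<gamma>_def[abs_def]
    by (intro L2_curve_add cw c\<psi> c\<phi>)+
  let ?ip = "L2_inner \<Omega>"
  note L2D = L2_curveD[OF cw(1)] L2_curveD[OF cw(2)] L2_curveD[OF cw(3)]
    L2_curveD[OF c\<psi>(1)] L2_curveD[OF c\<psi>(2)] L2_curveD[OF c\<psi>(3)]
    L2_curveD[OF c\<phi>(1)] L2_curveD[OF c\<phi>(2)] L2_curveD[OF c\<phi>(3)]
    L2_curveD[OF vel(1)] L2_curveD[OF vel(2)] L2_curveD[OF vel(3)]
    L2_curveD[OF cX(1)] L2_curveD[OF cX(2)] L2_curveD[OF c\<alpha>] L2_curveD[OF c\<beta>] L2_curveD[OF c\<gamma>]

  \<comment> \<open>The weak equations with extended classes of test functions\<close>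
  have time: "((\<lambda>s. ?ip f (u s)) has_real_derivative ?ip f (ut t)) (at t within {0..})"
    if "(u, ut) \<in> {(w, wt), (\<psi>, \<psi>t), (\<phi>, \<phi>t)}" "f \<in> L2_space \<Omega>" "0 \<le> t" for u ut f t
  proof -
    have "((\<lambda>s. ?ip (u s) f) has_real_derivative ?ip (ut t) f) (at t within {0..})"
    proof (rule weak_time_derivative_L2[OF \<Omega> _ _ _ that(2,3)])
      show "u t \<in> L2_space \<Omega>" if "0 \<le> t" for t using L2D \<open>(u, ut) \<in> _\<close> that by auto
      show "L2_curve \<Omega> ut" using vel that(1) by auto
      show "((\<lambda>s. ?ip (u s) v) has_real_derivative ?ip (ut t) v) (at t within {0..})"
        if "v \<in> test_functions \<Omega>" "0 \<le> t" for v t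
        using sol that \<open>(u, ut) \<in> _\<close> unfolding L2_inner_def by auto
    qed
    then show ?thesis by (simp add: L2_inner_commute)
  qed

  \<comment> \<open>The letter tells the pairing: A with the x-derivative of the test function, B
    with its y-derivative, C with the function itself. In both rotation equations the mixed term
    sits in B, because the weak formulation moves the y-derivative there.\<close>
  define Aw where "Aw t z = K * \<alpha> t z" for t z
  define Bw where "Bw t z = K * \<beta> t z" for t z
  define A\<psi> where "A\<psi> t z = D * Dx \<Omega> (\<psi> t) z" for t z
  define B\<psi> where "B\<psi> t z = D * ((1 - \<mu>) / 2) * Dy \<Omega> (\<psi> t) z + D * ((1 + \<mu>) / 2) * Dx \<Omega> (\<phi> t) z" for t z
  define C\<psi> where "C\<psi> t z = K * \<alpha> t z + X1 t z" for t z
  define A\<phi> where "A\<phi> t z = D * ((1 - \<mu>) / 2) * Dx \<Omega> (\<phi> t) z" for t z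
  define B\<phi> where "B\<phi> t z = D * Dy \<Omega> (\<phi> t) z + D * ((1 + \<mu>) / 2) * Dx \<Omega> (\<psi> t) z" for t z
  define C\<phi> where "C\<phi> t z = K * \<beta> t z + X2 t z" for t z
  have coef: "L2_curve \<Omega> Aw" "L2_curve \<Omega> Bw" "L2_curve \<Omega> A\<psi>" "L2_curve \<Omega> B\<psi>" "L2_curve \<Omega> C\<psi>"
    "L2_curve \<Omega> A\<phi>" "L2_curve \<Omega> B\<phi>" "L2_curve \<Omega> C\<phi>"
    unfolding Aw_def[abs_def] Bw_def[abs_def] A\<psi>_def[abs_def] B\<psi>_def[abs_def] C\<psi>_def[abs_def]
      A\<phi>_def[abs_def] B\<phi>_def[abs_def] C\<phi>_def[abs_def]
    by (intro L2_curve_add L2_curve_cmult cw c\<psi> c\<phi> c\<alpha> c\<beta> cX)+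
  note coefD = coef[THEN L2_curveD]
  have zeroD: "(\<lambda>_. 0) \<in> L2_space \<Omega>" by (simp add: L2_space_def)

  have eq_w: "((\<lambda>s. ?ip (\<lambda>z. \<rho>\<^sub>1 * wt s z) f) has_real_derivative
      - ?ip (Aw t) (Dx \<Omega> f) - ?ip (Bw t) (Dy \<Omega> f) - ?ip (\<lambda>_. 0) f) (at t within {0..})"
    if f: "f \<in> H10_space \<Omega>" "0 \<le> t" for f t
  proof (rule weak_equation_H10[OF \<Omega> _ coef(1,2) L2_curve_zero _ f])
    show "(\<lambda>z. \<rho>\<^sub>1 * wt t z) \<in> L2_space \<Omega>" if "0 \<le> t" for t by (intro L2_cmult L2D that)
    fix v and t :: real assume v: "v \<in> test_functions \<Omega>" and t: "0 \<le> t"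
    have eq: "(LINT z|lebesgue_on \<Omega>. - K * (\<psi> t z + Dx \<Omega> (w t) z) * px v z
              - K * (\<phi> t z + Dy \<Omega> (w t) z) * py v z)
        = - ?ip (Aw t) (px v) - ?ip (Bw t) (py v) - ?ip (\<lambda>_. 0) v"
      by (rule weak_form_split[OF coefD(1)[OF t] coefD(2)[OF t] zeroD test_function_L2(2,3,1)[OF v \<Omega>m]])
        (simp add: Aw_def Bw_def \<alpha>_def \<beta>_def)
    show "((\<lambda>s. ?ip (\<lambda>z. \<rho>\<^sub>1 * wt s z) v) has_real_derivative
        - ?ip (Aw t) (px v) - ?ip (Bw t) (py v) - ?ip (\<lambda>_. 0) v) (at t within {0..})"
      using weak_w[OF v t, unfolded eq] by (simp only: L2_inner_def)
  qed
  have eq_\<psi>: "((\<lambda>s. ?ip (\<lambda>z. \<rho>\<^sub>2 * \<psi>t s z) f) has_real_derivative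
      - ?ip (A\<psi> t) (Dx \<Omega> f) - ?ip (B\<psi> t) (Dy \<Omega> f) - ?ip (C\<psi> t) f) (at t within {0..})"
    if f: "f \<in> H10_space \<Omega>" "0 \<le> t" for f t
  proof (rule weak_equation_H10[OF \<Omega> _ coef(3,4,5) _ f])
    show "(\<lambda>z. \<rho>\<^sub>2 * \<psi>t t z) \<in> L2_space \<Omega>" if "0 \<le> t" for t by (intro L2_cmult L2D that)
    fix v and t :: real assume v: "v \<in> test_functions \<Omega>" and t: "0 \<le> t"
    have eq: "(LINT z|lebesgue_on \<Omega>.
              - D * Dx \<Omega> (\<psi> t) z * px v z
              - D * ((1 - \<mu>) / 2) * Dy \<Omega> (\<psi> t) z * py v z
              - D * ((1 + \<mu>) / 2) * Dx \<Omega> (\<phi> t) z * py v z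
              - K * (\<psi> t z + Dx \<Omega> (w t) z) * v z
              - chi\<^sub>1 (\<psi>t t z) * v z)
        = - ?ip (A\<psi> t) (px v) - ?ip (B\<psi> t) (py v) - ?ip (C\<psi> t) v"
      by (rule weak_form_split[OF coefD(3)[OF t] coefD(4)[OF t] coefD(5)[OF t] test_function_L2(2,3,1)[OF v \<Omega>m]])
        (simp add: A\<psi>_def B\<psi>_def C\<psi>_def \<alpha>_def X1_def distrib_right)
    show "((\<lambda>s. ?ip (\<lambda>z. \<rho>\<^sub>2 * \<psi>t s z) v) has_real_derivative
        - ?ip (A\<psi> t) (px v) - ?ip (B\<psi> t) (py v) - ?ip (C\<psi> t) v) (at t within {0..})"
      using weak_\<psi>[OF v t, unfolded eq] by (simp only: L2_inner_def)
  qed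
  have eq_\<phi>: "((\<lambda>s. ?ip (\<lambda>z. \<rho>\<^sub>2 * \<phi>t s z) f) has_real_derivative
      - ?ip (A\<phi> t) (Dx \<Omega> f) - ?ip (B\<phi> t) (Dy \<Omega> f) - ?ip (C\<phi> t) f) (at t within {0..})"
    if f: "f \<in> H10_space \<Omega>" "0 \<le> t" for f t
  proof (rule weak_equation_H10[OF \<Omega> _ coef(6,7,8) _ f])
    show "(\<lambda>z. \<rho>\<^sub>2 * \<phi>t t z) \<in> L2_space \<Omega>" if "0 \<le> t" for t by (intro L2_cmult L2D that)
    fix v and t :: real assume v: "v \<in> test_functions \<Omega>" and t: "0 \<le> t"
    have eq: "(LINT z|lebesgue_on \<Omega>.
              - D * Dy \<Omega> (\<phi> t) z * py v z
              - D * ((1 - \<mu>) / 2) * Dx \<Omega> (\<phi> t) z * px v z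
              - D * ((1 + \<mu>) / 2) * Dx \<Omega> (\<psi> t) z * py v z
              - K * (\<phi> t z + Dy \<Omega> (w t) z) * v z
              - chi\<^sub>2 (\<phi>t t z) * v z)
        = - ?ip (A\<phi> t) (px v) - ?ip (B\<phi> t) (py v) - ?ip (C\<phi> t) v"
      by (rule weak_form_split[OF coefD(6)[OF t] coefD(7)[OF t] coefD(8)[OF t] test_function_L2(2,3,1)[OF v \<Omega>m]])
        (simp add: A\<phi>_def B\<phi>_def C\<phi>_def \<beta>_def X2_def distrib_right)
    show "((\<lambda>s. ?ip (\<lambda>z. \<rho>\<^sub>2 * \<phi>t s z) v) has_real_derivative
        - ?ip (A\<phi> t) (px v) - ?ip (B\<phi> t) (py v) - ?ip (C\<phi> t) v) (at t within {0..})"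
      using weak_\<phi>[OF v t, unfolded eq] by (simp only: L2_inner_def)
  qed

  \<comment> \<open>The two-time functions and their relations\<close>
  define G where "G t s = ?ip (\<lambda>z. \<rho>\<^sub>1 * wt t z) (w s) + ?ip (\<lambda>z. \<rho>\<^sub>2 * \<psi>t t z) (\<psi> s)
    + ?ip (\<lambda>z. \<rho>\<^sub>2 * \<phi>t t z) (\<phi> s)" for t s
  define P where "P t s = \<rho>\<^sub>1 * ?ip (wt t) (wt s) + \<rho>\<^sub>2 * ?ip (\<psi>t t) (\<psi>t s) + \<rho>\<^sub>2 * ?ip (\<phi>t t) (\<phi>t s)" for t s
  \<comment> \<open>The coupling term of the energy is polarised into two halves, which makes
    \<open>Q\<close> symmetric and equals twice one half on the diagonal.\<close>
  define Q where "Q t s = K * ?ip (\<alpha> t) (\<alpha> s) + K * ?ip (\<beta> t) (\<beta> s)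
    + D * ?ip (Dx \<Omega> (\<psi> t)) (Dx \<Omega> (\<psi> s)) + D * ?ip (Dy \<Omega> (\<phi> t)) (Dy \<Omega> (\<phi> s))
    + D * ((1 - \<mu>) / 2) * ?ip (\<gamma> t) (\<gamma> s)
    + D * \<mu> * (?ip (Dx \<Omega> (\<psi> t)) (Dy \<Omega> (\<phi> s)) + ?ip (Dy \<Omega> (\<phi> t)) (Dx \<Omega> (\<psi> s)))" for t s
  define R where "R t s = - ?ip (X1 t) (\<psi> s) - ?ip (X2 t) (\<phi> s)" for t s
  define S where "S t s = - ?ip (X1 t) (\<psi>t s) - ?ip (X2 t) (\<phi>t s)" for t s

  have Gt: "((\<lambda>t. G t s) has_real_derivative R t s - Q t s) (at t within {0..})" if t: "0 \<le> t" and s: "0 \<le> s" for t s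
  proof -
    note Ls = L2D[OF s] and Lt = L2D[OF t]
    \<comment> \<open>The coefficient of the mixed terms splits as (1 + \<mu>)/2 = (1 - \<mu>)/2 +
      \<mu>. In each equation one share must supply a mixed product of the shear term in
      \<open>\<gamma>\<close> and the other a half of the \<mu>-coupling, and these differ by which
      function carries which derivative. The two identities exchange them.\<close>
    have cross: "?ip (Dy \<Omega> (\<psi> t)) (Dx \<Omega> (\<phi> s)) = ?ip (Dx \<Omega> (\<psi> t)) (Dy \<Omega> (\<phi> s))"
      "?ip (Dx \<Omega> (\<phi> t)) (Dy \<Omega> (\<psi> s)) = ?ip (Dy \<Omega> (\<phi> t)) (Dx \<Omega> (\<psi> s))"
      using H10_cross_identity[OF \<Omega> H10[OF curves(2) t] H10[OF curves(3) s]]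
        H10_cross_identity[OF \<Omega> H10[OF curves(3) t] H10[OF curves(2) s]] by simp_all
    have "- ?ip (Aw t) (Dx \<Omega> (w s)) - ?ip (Bw t) (Dy \<Omega> (w s)) - ?ip (\<lambda>_. 0) (w s)
      + (- ?ip (A\<psi> t) (Dx \<Omega> (\<psi> s)) - ?ip (B\<psi> t) (Dy \<Omega> (\<psi> s)) - ?ip (C\<psi> t) (\<psi> s))
      + (- ?ip (A\<phi> t) (Dx \<Omega> (\<phi> s)) - ?ip (B\<phi> t) (Dy \<Omega> (\<phi> s)) - ?ip (C\<phi> t) (\<phi> s)) = R t s - Q t s"
    proof -
      have 1: "?ip (\<lambda>_. 0) (w s) = 0" by (simp add: L2_inner_def)
      have 2: "?ip (B\<psi> t) (Dy \<Omega> (\<psi> s)) = D * ((1 - \<mu>) / 2) * ?ip (Dy \<Omega> (\<psi> t)) (Dy \<Omega> (\<psi> s))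
          + D * ((1 + \<mu>) / 2) * ?ip (Dx \<Omega> (\<phi> t)) (Dy \<Omega> (\<psi> s))"
        unfolding B\<psi>_def[abs_def] by (simp only: L2_inner_add_left L2_cmult Ls Lt L2_inner_cmult_left)
      have 3: "?ip (B\<phi> t) (Dy \<Omega> (\<phi> s)) = D * ?ip (Dy \<Omega> (\<phi> t)) (Dy \<Omega> (\<phi> s))
          + D * ((1 + \<mu>) / 2) * ?ip (Dx \<Omega> (\<psi> t)) (Dy \<Omega> (\<phi> s))"
        unfolding B\<phi>_def[abs_def] by (simp only: L2_inner_add_left L2_cmult Ls Lt L2_inner_cmult_left)
      have 4: "?ip (C\<psi> t) (\<psi> s) = K * ?ip (\<alpha> t) (\<psi> s) + ?ip (X1 t) (\<psi> s)"
        "?ip (C\<phi> t) (\<phi> s) = K * ?ip (\<beta> t) (\<phi> s) + ?ip (X2 t) (\<phi> s)"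
        unfolding C\<psi>_def[abs_def] C\<phi>_def[abs_def]
        by (simp_all only: L2_inner_add_left L2_cmult Ls Lt L2_inner_cmult_left)
      \<comment> \<open>The zero-order term of a rotation equation and the flux term of the w
        equation are the two halves of one shear product.\<close>
      have 5: "?ip (\<alpha> t) (\<alpha> s) = ?ip (\<alpha> t) (\<psi> s) + ?ip (\<alpha> t) (Dx \<Omega> (w s))"
        "?ip (\<beta> t) (\<beta> s) = ?ip (\<beta> t) (\<phi> s) + ?ip (\<beta> t) (Dy \<Omega> (w s))"
        using L2_inner_add_right[OF Ls(4,2) Lt(15)] L2_inner_add_right[OF Ls(7,3) Lt(16)]
        by (simp_all add: \<alpha>_def[of s, abs_def] \<beta>_def[of s, abs_def])
      have 6: "?ip (\<gamma> t) (\<gamma> s) = ?ip (Dy \<Omega> (\<psi> t)) (Dy \<Omega> (\<psi> s)) + ?ip (Dy \<Omega> (\<psi> t)) (Dx \<Omega> (\<phi> s))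
          + (?ip (Dx \<Omega> (\<phi> t)) (Dy \<Omega> (\<psi> s)) + ?ip (Dx \<Omega> (\<phi> t)) (Dx \<Omega> (\<phi> s)))"
        unfolding \<gamma>_def[abs_def] by (simp only: L2_inner_add_left L2_inner_add_right L2_add Ls Lt)
      have 7: "?ip (Aw t) h = K * ?ip (\<alpha> t) h" "?ip (Bw t) h = K * ?ip (\<beta> t) h"
        "?ip (A\<psi> t) h = D * ?ip (Dx \<Omega> (\<psi> t)) h"
        "?ip (A\<phi> t) h = D * ((1 - \<mu>) / 2) * ?ip (Dx \<Omega> (\<phi> t)) h" for h
        unfolding Aw_def[abs_def] Bw_def[abs_def] A\<psi>_def[abs_def] A\<phi>_def[abs_def]
        by (simp_all only: L2_inner_cmult_left)
      show ?thesis
        unfolding 1 2 3 4 7 R_def Q_def 5 6 cross by (simp add: field_simps)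
    qed
    moreover have "((\<lambda>t. G t s) has_real_derivative
      - ?ip (Aw t) (Dx \<Omega> (w s)) - ?ip (Bw t) (Dy \<Omega> (w s)) - ?ip (\<lambda>_. 0) (w s)
      + (- ?ip (A\<psi> t) (Dx \<Omega> (\<psi> s)) - ?ip (B\<psi> t) (Dy \<Omega> (\<psi> s)) - ?ip (C\<psi> t) (\<psi> s))
      + (- ?ip (A\<phi> t) (Dx \<Omega> (\<phi> s)) - ?ip (B\<phi> t) (Dy \<Omega> (\<phi> s)) - ?ip (C\<phi> t) (\<phi> s))) (at t within {0..})"
      unfolding G_def
      by (intro DERIV_add eq_w eq_\<psi> eq_\<phi> H10[OF curves(1) s] H10[OF curves(2) s] H10[OF curves(3) s] t)
    ultimately show ?thesis by simp
  qed
  have Gs: "(G t has_real_derivative P t s) (at s within {0..})" if t: "0 \<le> t" and s: "0 \<le> s" for t s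
  proof -
    have "(G t has_real_derivative ?ip (\<lambda>z. \<rho>\<^sub>1 * wt t z) (wt s) + ?ip (\<lambda>z. \<rho>\<^sub>2 * \<psi>t t z) (\<psi>t s)
        + ?ip (\<lambda>z. \<rho>\<^sub>2 * \<phi>t t z) (\<phi>t s)) (at s within {0..})"
      unfolding G_def by (intro DERIV_add time L2_cmult L2D t s) auto
    then show ?thesis by (simp add: P_def L2_inner_cmult_left)
  qed
  have Rs: "(R t has_real_derivative S t s) (at s within {0..})" if t: "0 \<le> t" and s: "0 \<le> s" for t s
    unfolding R_def S_def by (intro DERIV_diff DERIV_minus time L2D t s) auto
  have cont2: "continuous_on ({0..} \<times> {0..}) (\<lambda>p. ?ip (f (fst p)) (g (snd p)))"
    if "L2_curve \<Omega> f" "L2_curve \<Omega> g" for f g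
    using L2_inner_curves_continuous[OF that] by (simp add: case_prod_unfold)
  have contP: "continuous_on ({0..} \<times> {0..}) (\<lambda>(t, s). P t s)"
    unfolding P_def case_prod_unfold by (intro continuous_intros cont2 vel)
  have contQ: "continuous_on ({0..} \<times> {0..}) (\<lambda>(t, s). Q t s)"
    unfolding Q_def case_prod_unfold by (intro continuous_intros cont2 c\<alpha> c\<beta> c\<gamma> c\<psi> c\<phi>)
  have contS: "continuous_on ({0..} \<times> {0..}) (\<lambda>(t, s). S t s)"
    unfolding S_def case_prod_unfold by (intro continuous_intros cont2 vel cX)
  have symP: "P t s = P s t" and symQ: "Q t s = Q s t" for t s
    by (simp_all add: P_def Q_def L2_inner_commute[of _ "_ t" "_ s"] L2_inner_commute[of _ "_ (_ t)" "_ (_ s)"] add.commute)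

  \<comment> \<open>Energy and dissipation on the diagonal\<close>
  have E_eq: "E t = 1 / 2 * (P t t + Q t t)" if t: "0 \<le> t" for t
  proof -
    note [simp] = L2_mult_integrable[OF L2D(10)[OF t] L2D(10)[OF t]]
      L2_mult_integrable[OF L2D(11)[OF t] L2D(11)[OF t]] L2_mult_integrable[OF L2D(12)[OF t] L2D(12)[OF t]]
      L2_mult_integrable[OF L2D(15)[OF t] L2D(15)[OF t]] L2_mult_integrable[OF L2D(16)[OF t] L2D(16)[OF t]]
      L2_mult_integrable[OF L2D(5)[OF t] L2D(5)[OF t]] L2_mult_integrable[OF L2D(9)[OF t] L2D(9)[OF t]]
      L2_mult_integrable[OF L2D(17)[OF t] L2D(17)[OF t]] L2_mult_integrable[OF L2D(5)[OF t] L2D(9)[OF t]]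
    have "E t = 1 / 2 * (LINT z|lebesgue_on \<Omega>.
        \<rho>\<^sub>1 * (wt t z * wt t z) + \<rho>\<^sub>2 * (\<psi>t t z * \<psi>t t z) + \<rho>\<^sub>2 * (\<phi>t t z * \<phi>t t z)
        + K * (\<alpha> t z * \<alpha> t z) + K * (\<beta> t z * \<beta> t z)
        + D * (Dx \<Omega> (\<psi> t) z * Dx \<Omega> (\<psi> t) z) + D * (Dy \<Omega> (\<phi> t) z * Dy \<Omega> (\<phi> t) z)
        + D * ((1 - \<mu>) / 2) * (\<gamma> t z * \<gamma> t z)
        + 2 * D * \<mu> * (Dx \<Omega> (\<psi> t) z * Dy \<Omega> (\<phi> t) z))"
      unfolding assms(18) RMT_energy_def \<alpha>_def \<beta>_def \<gamma>_def power2_eq_square by (simp only: mult.assoc abs_mult_self_eq)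
    also have "\<dots> = 1 / 2 * (\<rho>\<^sub>1 * ?ip (wt t) (wt t) + \<rho>\<^sub>2 * ?ip (\<psi>t t) (\<psi>t t) + \<rho>\<^sub>2 * ?ip (\<phi>t t) (\<phi>t t)
        + K * ?ip (\<alpha> t) (\<alpha> t) + K * ?ip (\<beta> t) (\<beta> t)
        + D * ?ip (Dx \<Omega> (\<psi> t)) (Dx \<Omega> (\<psi> t)) + D * ?ip (Dy \<Omega> (\<phi> t)) (Dy \<Omega> (\<phi> t))
        + D * ((1 - \<mu>) / 2) * ?ip (\<gamma> t) (\<gamma> t)
        + 2 * D * \<mu> * ?ip (Dx \<Omega> (\<psi> t)) (Dy \<Omega> (\<phi> t)))"
      unfolding L2_inner_def by (simp del: mult_cancel_left)
    also have "\<dots> = 1 / 2 * (P t t + Q t t)"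
      by (simp add: P_def Q_def L2_inner_commute[of _ "Dy \<Omega> (\<phi> t)" "Dx \<Omega> (\<psi> t)"] algebra_simps)
    finally show ?thesis .
  qed
  have S_eq: "S t t = - (LINT z|lebesgue_on \<Omega>. \<psi>t t z * chi\<^sub>1 (\<psi>t t z) + \<phi>t t z * chi\<^sub>2 (\<phi>t t z))"
    if t: "0 \<le> t" for t
    using L2_mult_integrable[OF L2D(11)[OF t] L2D(13)[OF t]] L2_mult_integrable[OF L2D(12)[OF t] L2D(14)[OF t]]
    by (simp add: S_def L2_inner_def X1_def X2_def mult.commute[of "chi\<^sub>1 _"] mult.commute[of "chi\<^sub>2 _"])
  have dE: "(E has_real_derivative S t t) (at t within {0..})" if t: "0 \<le> t" for t
  proof -
    have "((\<lambda>t. P t t + Q t t) has_real_derivative 2 * S t t) (at t within {0..})"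
      by (rule diagonal_derivative[OF Gt Gs Rs contP contQ contS symP symQ t])
    from DERIV_cmult[OF this, of "1 / 2"]
    have "((\<lambda>t. 1 / 2 * (P t t + Q t t)) has_real_derivative S t t) (at t within {0..})" by simp
    then show ?thesis
      by (rule has_field_derivative_transform_within[where d = 1]) (use t E_eq in auto)
  qed
  have S_nonpos: "S t t \<le> 0" if t: "0 \<le> t" for t
    unfolding S_eq[OF t] using damping_assumption_consequences(3)[OF assms(10)]
    by (simp add: integral_nonneg_AE)
  have "E t \<le> E 0" if t: "0 \<le> t" for t
  proof (cases "t = 0")
    case False
    then have "0 < t" using t by simp
    then show ?thesis
    proof (rule DERIV_nonpos_imp_decreasing_open[OF less_imp_le])
      show "\<exists>y. (E has_real_derivative y) (at x) \<and> y \<le> 0" if "0 < x" "x < t" for x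
        using dE[of x] S_nonpos[of x] that at_within_interior[of x "{0..}"] by auto
      show "continuous_on {0..t} E"
        by (rule continuous_on_subset[of "{0..}"])
          (use dE in \<open>auto simp: continuous_on_eq_continuous_within intro: DERIV_continuous\<close>)
    qed
  qed simp
  with dE S_eq show ?thesis by simp
qed

end
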